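(* Let $\mathscr{T}$ be a rigidly-compactly generated tt-category and let $\mathscr{H}$ be a directed poset (under inclusion) of subgroups of the Picard group $\mathrm{Pic}(\mathscr{T})$. For $G=\bigcup_{H\in\mathscr{H}}H$, we have $$\mathrm{Spc}(\mathscr{T}_{\langle G\rangle}^c)\cong\lim_{H\in\mathscr{H}}\mathrm{Spc}(\mathscr{T}_{\langle H\rangle}^c).$$
   Context: A rigidly-compactly generated tt-category is a triangulated category with compatible closed symmetric monoidal structure $(\otimes,\mathbb{1})$ and all small coproducts, which is compactly generated and whose compact objects coincide with its dualizable objects; $\mathscr{T}^c$ denotes the compact objects. $\mathrm{Pic}(\mathscr{T})$ is the group (under $\otimes$) of isomorphism classes of $\otimes$-invertible objects. For a set $\mathscr{G}\subseteq\mathscr{T}^c$ of compact objects such that $\mathrm{thick}\langle\mathscr{G}\rangle$ is a rigid tensor-subcategory (for instance a subgroup of $\mathrm{Pic}(\mathscr{T})$), the concentration of $\mathscr{T}$ at $\mathscr{G}$ is the localizing subcategory $\mathscr{T}_{\langle\mathscr{G}\rangle}=\mathrm{Loc}\langle\mathscr{G}\rangle\subseteq\mathscr{T}$; it is itself a rigidly-compactly generated tt-category with $\mathscr{T}_{\langle\mathscr{G}\rangle}^c=\mathrm{thick}\langle\mathscr{G}\rangle$. $\mathrm{Spc}(\mathscr{K})$ is the Balmer spectrum of an essentially small tt-category (prime thick tensor-ideals, basis of closed sets $\mathrm{supp}(a)=\{\mathscr{P}:a\notin\mathscr{P}\}$). The limit is taken in topological spaces (equivalently spectral spaces), along the maps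 induced by the inclusions $\mathscr{T}_{\langle H\rangle}\subseteq\mathscr{T}_{\langle H'\rangle}$ for $H\subseteq H'$ in $\mathscr{H}$, and the homeomorphism is the one induced by the inclusions $\mathscr{T}_{\langle H\rangle}\subseteq\mathscr{T}_{\langle G\rangle}$. *)

theory Defs
  imports "HOL-Analysis.Analysis" "HOL-Algebra.FiniteProduct"
begin

section \<open>Smallness\<close>

text \<open>
  Coproducts in a ``big'' category are indexed by small sets. Smallness is a parameter: a class of
  subsets of an index type with the closure properties below. The sets of cardinality
  \<open>< \<kappa>\<close> for an uncountable regular cardinal \<open>\<kappa>\<close> are an instance; in particular \<open>\<kappa>\<close> may be
  inaccessible, which is smallness with respect to a Grothendieck universe. Hom-sets are sets, but
  they are not required to be small in this sense.
\<close>

locale smallness =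
  fixes small :: "'i set \<Rightarrow> bool"
  assumes small_subset: "small I \<Longrightarrow> J \<subseteq> I \<Longrightarrow> small J"
    and small_image: "small I \<Longrightarrow> small ((f :: 'i \<Rightarrow> 'i) ` I)"
    and small_Union: "small I \<Longrightarrow> (\<And>k. k \<in> I \<Longrightarrow> small (A k)) \<Longrightarrow> small (\<Union>k\<in>I. A k)"
    and infinite_small: "\<exists>I. small I \<and> infinite I"

definition small_set :: "('i set \<Rightarrow> bool) \<Rightarrow> 'a set \<Rightarrow> bool" where
  "small_set small A \<longleftrightarrow> (\<exists>I f. small I \<and> A = f ` I)"


section \<open>Categories\<close>

record ('o, 'm) category =
  Obj :: "'o set"
  Arr :: "'m set"
  Dom :: "'m \<Rightarrow> 'o"
  Cod :: "'m \<Rightarrow> 'o"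
  Ident :: "'o \<Rightarrow> 'm"
  Comp :: "'m \<Rightarrow> 'm \<Rightarrow> 'm" (infixr "\<cdot>\<index>" 70)

definition Hom :: "('o, 'm, 'z) category_scheme \<Rightarrow> 'o \<Rightarrow> 'o \<Rightarrow> 'm set" where
  "Hom C x y = {f \<in> Arr C. Dom C f = x \<and> Cod C f = y}"

locale category =
  fixes C :: "('o, 'm, 'z) category_scheme" (structure)
  assumes Dom_Obj: "f \<in> Arr C \<Longrightarrow> Dom C f \<in> Obj C"
    and Cod_Obj: "f \<in> Arr C \<Longrightarrow> Cod C f \<in> Obj C"
    and Ident_Hom: "x \<in> Obj C \<Longrightarrow> Ident C x \<in> Hom C x x"
    and Comp_Hom: "f \<in> Hom C x y \<Longrightarrow> g \<in> Hom C y z \<Longrightarrow> g \<cdot> f \<in> Hom C x z"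
    and Ident_left: "f \<in> Hom C x y \<Longrightarrow> Ident C y \<cdot> f = f"
    and Ident_right: "f \<in> Hom C x y \<Longrightarrow> f \<cdot> Ident C x = f"
    and Comp_assoc: "f \<in> Hom C w x \<Longrightarrow> g \<in> Hom C x y \<Longrightarrow> h \<in> Hom C y z \<Longrightarrow>
        h \<cdot> (g \<cdot> f) = (h \<cdot> g) \<cdot> f"

definition inverse_arrows :: "('o, 'm, 'z) category_scheme \<Rightarrow> 'm \<Rightarrow> 'm \<Rightarrow> bool" where
  "inverse_arrows C f g \<longleftrightarrow> f \<in> Arr C \<and> g \<in> Hom C (Cod C f) (Dom C f) \<and>
     g \<cdot>\<^bsub>C\<^esub> f = Ident C (Dom C f) \<and> f \<cdot>\<^bsub>C\<^esub> g = Ident C (Cod C f)"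

definition is_iso :: "('o, 'm, 'z) category_scheme \<Rightarrow> 'm \<Rightarrow> bool" where
  "is_iso C f \<longleftrightarrow> (\<exists>g. inverse_arrows C f g)"

definition isomorphic :: "('o, 'm, 'z) category_scheme \<Rightarrow> 'o \<Rightarrow> 'o \<Rightarrow> bool" where
  "isomorphic C x y \<longleftrightarrow> (\<exists>f \<in> Hom C x y. is_iso C f)"

definition iso_class :: "('o, 'm, 'z) category_scheme \<Rightarrow> 'o \<Rightarrow> 'o set" where
  "iso_class C x = {y \<in> Obj C. isomorphic C x y}"

definition is_zero_object :: "('o, 'm, 'z) category_scheme \<Rightarrow> 'o \<Rightarrow> bool" where
  "is_zero_object C z \<longleftrightarrow> z \<in> Obj C \<and>
     (\<forall>x \<in> Obj C. (\<exists>!f. f \<in> Hom C z x) \<and> (\<exists>!f. f \<in> Hom C x z))"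

text \<open>\<open>is_coproduct C I x s \<iota>\<close>: the maps \<open>\<iota> k : x k \<rightarrow> s\<close> exhibit \<open>s\<close> as the coproduct of the \<open>x k\<close>, \<open>k \<in> I\<close>.\<close>

definition is_coproduct ::
  "('o, 'm, 'z) category_scheme \<Rightarrow> 'i set \<Rightarrow> ('i \<Rightarrow> 'o) \<Rightarrow> 'o \<Rightarrow> ('i \<Rightarrow> 'm) \<Rightarrow> bool" where
  "is_coproduct C I x s \<iota> \<longleftrightarrow> s \<in> Obj C \<and> (\<forall>k\<in>I. \<iota> k \<in> Hom C (x k) s) \<and>
     (\<forall>z \<in> Obj C. \<forall>f. (\<forall>k\<in>I. f k \<in> Hom C (x k) z) \<longrightarrow>
        (\<exists>!g. g \<in> Hom C s z \<and> (\<forall>k\<in>I. g \<cdot>\<^bsub>C\<^esub> \<iota> k = f k)))"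


section \<open>Additive categories\<close>

record ('o, 'm) additive_category = "('o, 'm) category" +
  Add :: "'m \<Rightarrow> 'm \<Rightarrow> 'm" (infixl "\<oplus>\<^sub>h\<index>" 65)
  Zero :: "'o \<Rightarrow> 'o \<Rightarrow> 'm"

definition hom_group :: "('o, 'm, 'z) additive_category_scheme \<Rightarrow> 'o \<Rightarrow> 'o \<Rightarrow> 'm monoid" where
  "hom_group C x y = \<lparr>carrier = Hom C x y, mult = Add C, one = Zero C x y\<rparr>"

definition neg :: "('o, 'm, 'z) additive_category_scheme \<Rightarrow> 'm \<Rightarrow> 'm" where
  "neg C f = inv\<^bsub>hom_group C (Dom C f) (Cod C f)\<^esub> f"

text \<open>\<open>is_biproduct C x y s\<close>: \<open>s\<close> is a direct sum of \<open>x\<close> and \<open>y\<close>.\<close>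

definition is_biproduct :: "('o, 'm, 'z) additive_category_scheme \<Rightarrow> 'o \<Rightarrow> 'o \<Rightarrow> 'o \<Rightarrow> bool" where
  "is_biproduct C x y s \<longleftrightarrow>
     (\<exists>i \<in> Hom C x s. \<exists>j \<in> Hom C y s. \<exists>p \<in> Hom C s x. \<exists>q \<in> Hom C s y.
        p \<cdot>\<^bsub>C\<^esub> i = Ident C x \<and> q \<cdot>\<^bsub>C\<^esub> j = Ident C y \<and>
        p \<cdot>\<^bsub>C\<^esub> j = Zero C y x \<and> q \<cdot>\<^bsub>C\<^esub> i = Zero C x y \<and>
        (i \<cdot>\<^bsub>C\<^esub> p) \<oplus>\<^sub>h\<^bsub>C\<^esub> (j \<cdot>\<^bsub>C\<^esub> q) = Ident C s)"

locale additive_category = category C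
  for C :: "('o, 'm, 'z) additive_category_scheme" (structure) +
  assumes hom_comm_group: "x \<in> Obj C \<Longrightarrow> y \<in> Obj C \<Longrightarrow> comm_group (hom_group C x y)"
    and Comp_Add_right: "f \<in> Hom C x y \<Longrightarrow> f' \<in> Hom C x y \<Longrightarrow> g \<in> Hom C y z \<Longrightarrow>
        g \<cdot> (f \<oplus>\<^sub>h f') = (g \<cdot> f) \<oplus>\<^sub>h (g \<cdot> f')"
    and Comp_Add_left: "f \<in> Hom C x y \<Longrightarrow> g \<in> Hom C y z \<Longrightarrow> g' \<in> Hom C y z \<Longrightarrow>
        (g \<oplus>\<^sub>h g') \<cdot> f = (g \<cdot> f) \<oplus>\<^sub>h (g' \<cdot> f)"
    and zero_object_exists: "\<exists>z. is_zero_object C z"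
    and biproduct_exists: "x \<in> Obj C \<Longrightarrow> y \<in> Obj C \<Longrightarrow> \<exists>s. is_biproduct C x y s"

text \<open>
  An object \<open>c\<close> is compact if, for every small coproduct \<open>s\<close> of objects \<open>x k\<close>, the canonical map from
  the direct sum of the groups \<open>Hom(c, x k)\<close> to \<open>Hom(c, s)\<close> is bijective. Elements of the direct sum
  are the families with finite support; \<open>finprod\<close> in \<open>hom_group\<close> is the finite sum of morphisms.
\<close>

definition compact_object ::
  "('i set \<Rightarrow> bool) \<Rightarrow> ('o, 'm, 'z) additive_category_scheme \<Rightarrow> 'o \<Rightarrow> bool" where
  "compact_object small C c \<longleftrightarrow> c \<in> Obj C \<and>
     (\<forall>I x s \<iota>. small I \<and> is_coproduct C I x s \<iota> \<longrightarrow>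
        bij_betw
          (\<lambda>\<phi>. finprod (hom_group C c s) (\<lambda>k. \<iota> k \<cdot>\<^bsub>C\<^esub> \<phi> k) {k \<in> I. \<phi> k \<noteq> Zero C c (x k)})
          {\<phi> \<in> \<Pi>\<^sub>E k\<in>I. Hom C c (x k). finite {k \<in> I. \<phi> k \<noteq> Zero C c (x k)}}
          (Hom C c s))"


section \<open>Triangulated categories\<close>

text \<open>A triple \<open>(f, g, h)\<close> in \<open>Tri\<close> stands for the distinguished triangle
  \<open>x \<rightarrow> y \<rightarrow> z \<rightarrow> Shift x\<close> with these three maps.\<close>

record ('o, 'm) triangulated_category = "('o, 'm) additive_category" +
  Shift :: "'o \<Rightarrow> 'o"
  Shift_arr :: "'m \<Rightarrow> 'm"
  Tri :: "('m \<times> 'm \<times> 'm) set"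

definition is_triangle ::
  "('o, 'm, 'z) triangulated_category_scheme \<Rightarrow> 'o \<Rightarrow> 'o \<Rightarrow> 'o \<Rightarrow> 'm \<Rightarrow> 'm \<Rightarrow> 'm \<Rightarrow> bool" where
  "is_triangle C x y z f g h \<longleftrightarrow>
     f \<in> Hom C x y \<and> g \<in> Hom C y z \<and> h \<in> Hom C z (Shift C x)"

definition dist_triangle ::
  "('o, 'm, 'z) triangulated_category_scheme \<Rightarrow> 'o \<Rightarrow> 'o \<Rightarrow> 'o \<Rightarrow> 'm \<Rightarrow> 'm \<Rightarrow> 'm \<Rightarrow> bool" where
  "dist_triangle C x y z f g h \<longleftrightarrow> is_triangle C x y z f g h \<and> (f, g, h) \<in> Tri C"

text \<open>The shift is an auto-equivalence, not necessarily an automorphism.\<close>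

locale triangulated_category = additive_category C
  for C :: "('o, 'm, 'z) triangulated_category_scheme" (structure) +
  assumes Shift_Obj: "x \<in> Obj C \<Longrightarrow> Shift C x \<in> Obj C"
    and Shift_Ident: "x \<in> Obj C \<Longrightarrow> Shift_arr C (Ident C x) = Ident C (Shift C x)"
    and Shift_Comp: "f \<in> Hom C x y \<Longrightarrow> g \<in> Hom C y z \<Longrightarrow>
        Shift_arr C (g \<cdot> f) = Shift_arr C g \<cdot> Shift_arr C f"
    and Shift_Add: "f \<in> Hom C x y \<Longrightarrow> f' \<in> Hom C x y \<Longrightarrow>
        Shift_arr C (f \<oplus>\<^sub>h f') = Shift_arr C f \<oplus>\<^sub>h Shift_arr C f'"
    and Shift_fully_faithful: "x \<in> Obj C \<Longrightarrow> y \<in> Obj C \<Longrightarrow>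
        bij_betw (Shift_arr C) (Hom C x y) (Hom C (Shift C x) (Shift C y))"
    and Shift_ess_surj: "y \<in> Obj C \<Longrightarrow> \<exists>x \<in> Obj C. isomorphic C (Shift C x) y"
    and Tri_typed: "(f, g, h) \<in> Tri C \<Longrightarrow> \<exists>x y z. is_triangle C x y z f g h"
    and TR1_Ident: "x \<in> Obj C \<Longrightarrow> is_zero_object C z \<Longrightarrow>
        dist_triangle C x x z (Ident C x) (Zero C x z) (Zero C z (Shift C x))"
    and TR1_iso: "dist_triangle C x y z f g h \<Longrightarrow> is_triangle C x' y' z' f' g' h' \<Longrightarrow>
        a \<in> Hom C x x' \<Longrightarrow> b \<in> Hom C y y' \<Longrightarrow> c \<in> Hom C z z' \<Longrightarrow>
        is_iso C a \<Longrightarrow> is_iso C b \<Longrightarrow> is_iso C c \<Longrightarrow>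
        b \<cdot> f = f' \<cdot> a \<Longrightarrow> c \<cdot> g = g' \<cdot> b \<Longrightarrow> Shift_arr C a \<cdot> h = h' \<cdot> c \<Longrightarrow>
        dist_triangle C x' y' z' f' g' h'"
    and TR1_cone: "f \<in> Hom C x y \<Longrightarrow> \<exists>z g h. dist_triangle C x y z f g h"
    and TR2: "is_triangle C x y z f g h \<Longrightarrow>
        dist_triangle C x y z f g h \<longleftrightarrow> dist_triangle C y z (Shift C x) g h (neg C (Shift_arr C f))"
    and TR3: "dist_triangle C x y z f g h \<Longrightarrow> dist_triangle C x' y' z' f' g' h' \<Longrightarrow>
        a \<in> Hom C x x' \<Longrightarrow> b \<in> Hom C y y' \<Longrightarrow> b \<cdot> f = f' \<cdot> a \<Longrightarrow>
        \<exists>c \<in> Hom C z z'. c \<cdot> g = g' \<cdot> b \<and> Shift_arr C a \<cdot> h = h' \<cdot> c"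
    and TR4: "dist_triangle C x y u f p\<^sub>1 d\<^sub>1 \<Longrightarrow> dist_triangle C x z v (g \<cdot> f) p\<^sub>2 d\<^sub>2 \<Longrightarrow>
        dist_triangle C y z w g p\<^sub>3 d\<^sub>3 \<Longrightarrow>
        \<exists>a b. dist_triangle C u v w a b (Shift_arr C p\<^sub>1 \<cdot> d\<^sub>3) \<and>
          a \<cdot> p\<^sub>1 = p\<^sub>2 \<cdot> g \<and> d\<^sub>2 \<cdot> a = d\<^sub>1 \<and>
          b \<cdot> p\<^sub>2 = p\<^sub>3 \<and> d\<^sub>3 \<cdot> b = Shift_arr C f \<cdot> d\<^sub>2"

definition triangulated_subcategory ::
  "('o, 'm, 'z) triangulated_category_scheme \<Rightarrow> 'o set \<Rightarrow> bool" where
  "triangulated_subcategory C S \<longleftrightarrow> S \<subseteq> Obj C \<and>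
     (\<forall>z. is_zero_object C z \<longrightarrow> z \<in> S) \<and>
     (\<forall>x y. x \<in> S \<and> isomorphic C x y \<longrightarrow> y \<in> S) \<and>
     (\<forall>x \<in> Obj C. Shift C x \<in> S \<longleftrightarrow> x \<in> S) \<and>
     (\<forall>x y z f g h. dist_triangle C x y z f g h \<and> x \<in> S \<and> y \<in> S \<longrightarrow> z \<in> S)"

definition thick_subcategory ::
  "('o, 'm, 'z) triangulated_category_scheme \<Rightarrow> 'o set \<Rightarrow> bool" where
  "thick_subcategory C S \<longleftrightarrow> triangulated_subcategory C S \<and>
     (\<forall>x y s. is_biproduct C x y s \<and> s \<in> S \<longrightarrow> x \<in> S \<and> y \<in> S)"

definition localizing_subcategory ::
  "('i set \<Rightarrow> bool) \<Rightarrow> ('o, 'm, 'z) triangulated_category_scheme \<Rightarrow> 'o set \<Rightarrow> bool" where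
  "localizing_subcategory small C S \<longleftrightarrow> triangulated_subcategory C S \<and>
     (\<forall>I x s \<iota>. small I \<and> (\<forall>k\<in>I. x k \<in> S) \<and> is_coproduct C I x s \<iota> \<longrightarrow> s \<in> S)"

definition Loc ::
  "('i set \<Rightarrow> bool) \<Rightarrow> ('o, 'm, 'z) triangulated_category_scheme \<Rightarrow> 'o set \<Rightarrow> 'o set" where
  "Loc small C \<G> = \<Inter>{S. localizing_subcategory small C S \<and> \<G> \<subseteq> S}"

text \<open>The full subcategory on a set of objects, with all structure (including tensor products when
  present) restricted from the ambient category.\<close>

definition full_subcategory ::
  "('o, 'm, 'z) triangulated_category_scheme \<Rightarrow> 'o set \<Rightarrow> ('o, 'm, 'z) triangulated_category_scheme" where
  "full_subcategory C S = C\<lparr>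
     Obj := S,
     Arr := {f \<in> Arr C. Dom C f \<in> S \<and> Cod C f \<in> S},
     Tri := {(f, g, h) \<in> Tri C. Dom C f \<in> S \<and> Cod C f \<in> S \<and> Cod C g \<in> S}\<rparr>"

text \<open>Vanishing of \<open>Hom(c, Shift^n x)\<close> for all integers \<open>n\<close>; as the shift need not be strictly
  invertible, negative \<open>n\<close> are put on the other side.\<close>

definition compactly_generated ::
  "('i set \<Rightarrow> bool) \<Rightarrow> ('o, 'm, 'z) triangulated_category_scheme \<Rightarrow> bool" where
  "compactly_generated small C \<longleftrightarrow>
     (\<exists>\<G>. small_set small \<G> \<and> (\<forall>c\<in>\<G>. compact_object small C c) \<and>
        (\<forall>x \<in> Obj C.
           (\<forall>c\<in>\<G>. \<forall>n. Hom C c ((Shift C ^^ n) x) = {Zero C c ((Shift C ^^ n) x)} \<and>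
                       Hom C ((Shift C ^^ n) c) x = {Zero C ((Shift C ^^ n) c) x}) \<longrightarrow>
           is_zero_object C x))"


section \<open>Tensor-triangulated categories\<close>

text \<open>\<open>Susp x y\<close> is the isomorphism from \<open>Shift x \<boxtimes> y\<close> to \<open>Shift (x \<boxtimes> y)\<close>.\<close>

record ('o, 'm) tt_category = "('o, 'm) triangulated_category" +
  Tens :: "'o \<Rightarrow> 'o \<Rightarrow> 'o" (infixr "\<boxtimes>\<index>" 75)
  Tens_arr :: "'m \<Rightarrow> 'm \<Rightarrow> 'm" (infixr "\<boxtimes>\<^sub>a\<index>" 75)
  Unit :: "'o" ("\<one>\<^sub>t\<index>")
  Assoc :: "'o \<Rightarrow> 'o \<Rightarrow> 'o \<Rightarrow> 'm"
  Lunit :: "'o \<Rightarrow> 'm"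
  Runit :: "'o \<Rightarrow> 'm"
  Braid :: "'o \<Rightarrow> 'o \<Rightarrow> 'm"
  Susp :: "'o \<Rightarrow> 'o \<Rightarrow> 'm"

locale symmetric_monoidal_category = category C
  for C :: "('o, 'm, 'z) tt_category_scheme" (structure) +
  assumes Tens_Obj: "x \<in> Obj C \<Longrightarrow> y \<in> Obj C \<Longrightarrow> x \<boxtimes> y \<in> Obj C"
    and Unit_Obj: "\<one>\<^sub>t \<in> Obj C"
    and Tens_arr_Hom: "f \<in> Hom C x x' \<Longrightarrow> g \<in> Hom C y y' \<Longrightarrow>
        f \<boxtimes>\<^sub>a g \<in> Hom C (x \<boxtimes> y) (x' \<boxtimes> y')"
    and Tens_Ident: "x \<in> Obj C \<Longrightarrow> y \<in> Obj C \<Longrightarrow>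
        Ident C x \<boxtimes>\<^sub>a Ident C y = Ident C (x \<boxtimes> y)"
    and Tens_Comp: "f \<in> Hom C x x' \<Longrightarrow> f' \<in> Hom C x' x'' \<Longrightarrow> g \<in> Hom C y y' \<Longrightarrow> g' \<in> Hom C y' y'' \<Longrightarrow>
        (f' \<cdot> f) \<boxtimes>\<^sub>a (g' \<cdot> g) = (f' \<boxtimes>\<^sub>a g') \<cdot> (f \<boxtimes>\<^sub>a g)"
    and Assoc_Hom: "x \<in> Obj C \<Longrightarrow> y \<in> Obj C \<Longrightarrow> z \<in> Obj C \<Longrightarrow>
        Assoc C x y z \<in> Hom C ((x \<boxtimes> y) \<boxtimes> z) (x \<boxtimes> (y \<boxtimes> z))"
    and Assoc_iso: "x \<in> Obj C \<Longrightarrow> y \<in> Obj C \<Longrightarrow> z \<in> Obj C \<Longrightarrow> is_iso C (Assoc C x y z)"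
    and Assoc_natural: "f \<in> Hom C x x' \<Longrightarrow> g \<in> Hom C y y' \<Longrightarrow> h \<in> Hom C z z' \<Longrightarrow>
        Assoc C x' y' z' \<cdot> ((f \<boxtimes>\<^sub>a g) \<boxtimes>\<^sub>a h) = (f \<boxtimes>\<^sub>a (g \<boxtimes>\<^sub>a h)) \<cdot> Assoc C x y z"
    and Lunit_Hom: "x \<in> Obj C \<Longrightarrow> Lunit C x \<in> Hom C (\<one>\<^sub>t \<boxtimes> x) x"
    and Lunit_iso: "x \<in> Obj C \<Longrightarrow> is_iso C (Lunit C x)"
    and Lunit_natural: "f \<in> Hom C x x' \<Longrightarrow>
        Lunit C x' \<cdot> (Ident C \<one>\<^sub>t \<boxtimes>\<^sub>a f) = f \<cdot> Lunit C x"
    and Runit_Hom: "x \<in> Obj C \<Longrightarrow> Runit C x \<in> Hom C (x \<boxtimes> \<one>\<^sub>t) x"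
    and Runit_iso: "x \<in> Obj C \<Longrightarrow> is_iso C (Runit C x)"
    and Runit_natural: "f \<in> Hom C x x' \<Longrightarrow>
        Runit C x' \<cdot> (f \<boxtimes>\<^sub>a Ident C \<one>\<^sub>t) = f \<cdot> Runit C x"
    and Braid_Hom: "x \<in> Obj C \<Longrightarrow> y \<in> Obj C \<Longrightarrow> Braid C x y \<in> Hom C (x \<boxtimes> y) (y \<boxtimes> x)"
    and Braid_natural: "f \<in> Hom C x x' \<Longrightarrow> g \<in> Hom C y y' \<Longrightarrow>
        Braid C x' y' \<cdot> (f \<boxtimes>\<^sub>a g) = (g \<boxtimes>\<^sub>a f) \<cdot> Braid C x y"
    and Braid_symmetric: "x \<in> Obj C \<Longrightarrow> y \<in> Obj C \<Longrightarrow>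
        Braid C y x \<cdot> Braid C x y = Ident C (x \<boxtimes> y)"
    and pentagon: "w \<in> Obj C \<Longrightarrow> x \<in> Obj C \<Longrightarrow> y \<in> Obj C \<Longrightarrow> z \<in> Obj C \<Longrightarrow>
        (Ident C w \<boxtimes>\<^sub>a Assoc C x y z) \<cdot> Assoc C w (x \<boxtimes> y) z \<cdot> (Assoc C w x y \<boxtimes>\<^sub>a Ident C z) =
        Assoc C w x (y \<boxtimes> z) \<cdot> Assoc C (w \<boxtimes> x) y z"
    and triangle: "x \<in> Obj C \<Longrightarrow> y \<in> Obj C \<Longrightarrow>
        (Ident C x \<boxtimes>\<^sub>a Lunit C y) \<cdot> Assoc C x \<one>\<^sub>t y = Runit C x \<boxtimes>\<^sub>a Ident C y"
    and hexagon: "x \<in> Obj C \<Longrightarrow> y \<in> Obj C \<Longrightarrow> z \<in> Obj C \<Longrightarrow>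
        Assoc C y z x \<cdot> Braid C x (y \<boxtimes> z) \<cdot> Assoc C x y z =
        (Ident C y \<boxtimes>\<^sub>a Braid C x z) \<cdot> Assoc C y x z \<cdot> (Braid C x y \<boxtimes>\<^sub>a Ident C z)"

text \<open>Closedness: each functor \<open>- \<boxtimes> y\<close> has a right adjoint, given by internal hom objects \<open>h\<close> and
  evaluation maps \<open>ev\<close>.\<close>

locale closed_symmetric_monoidal_category = symmetric_monoidal_category C
  for C :: "('o, 'm, 'z) tt_category_scheme" (structure) +
  assumes closed: "y \<in> Obj C \<Longrightarrow> z \<in> Obj C \<Longrightarrow>
        \<exists>h \<in> Obj C. \<exists>ev \<in> Hom C (h \<boxtimes> y) z. \<forall>x \<in> Obj C. \<forall>f \<in> Hom C (x \<boxtimes> y) z.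
          \<exists>!g. g \<in> Hom C x h \<and> ev \<cdot> (g \<boxtimes>\<^sub>a Ident C y) = f"

text \<open>
  Compatibility of the tensor product with the triangulation: exactness with respect to the natural
  isomorphism \<open>Susp\<close>, coherence of \<open>Susp\<close> with the unit and associativity isomorphisms, and the sign
  rule for the interchange of two suspensions. Exactness in the second variable follows by
  transport along \<open>Braid\<close>.
\<close>

locale closed_tt_category = triangulated_category C + closed_symmetric_monoidal_category C
  for C :: "('o, 'm, 'z) tt_category_scheme" (structure) +
  assumes Tens_Add_left: "f \<in> Hom C x x' \<Longrightarrow> f' \<in> Hom C x x' \<Longrightarrow> g \<in> Hom C y y' \<Longrightarrow>
        (f \<oplus>\<^sub>h f') \<boxtimes>\<^sub>a g = (f \<boxtimes>\<^sub>a g) \<oplus>\<^sub>h (f' \<boxtimes>\<^sub>a g)"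
    and Tens_Add_right: "f \<in> Hom C x x' \<Longrightarrow> g \<in> Hom C y y' \<Longrightarrow> g' \<in> Hom C y y' \<Longrightarrow>
        f \<boxtimes>\<^sub>a (g \<oplus>\<^sub>h g') = (f \<boxtimes>\<^sub>a g) \<oplus>\<^sub>h (f \<boxtimes>\<^sub>a g')"
    and Susp_Hom: "x \<in> Obj C \<Longrightarrow> y \<in> Obj C \<Longrightarrow>
        Susp C x y \<in> Hom C (Shift C x \<boxtimes> y) (Shift C (x \<boxtimes> y))"
    and Susp_iso: "x \<in> Obj C \<Longrightarrow> y \<in> Obj C \<Longrightarrow> is_iso C (Susp C x y)"
    and Susp_natural: "f \<in> Hom C x x' \<Longrightarrow> g \<in> Hom C y y' \<Longrightarrow>
        Susp C x' y' \<cdot> (Shift_arr C f \<boxtimes>\<^sub>a g) = Shift_arr C (f \<boxtimes>\<^sub>a g) \<cdot> Susp C x y"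
    and Susp_Unit: "x \<in> Obj C \<Longrightarrow>
        Shift_arr C (Runit C x) \<cdot> Susp C x \<one>\<^sub>t = Runit C (Shift C x)"
    and Susp_Assoc: "x \<in> Obj C \<Longrightarrow> y \<in> Obj C \<Longrightarrow> z \<in> Obj C \<Longrightarrow>
        Susp C x (y \<boxtimes> z) \<cdot> Assoc C (Shift C x) y z =
        Shift_arr C (Assoc C x y z) \<cdot> Susp C (x \<boxtimes> y) z \<cdot> (Susp C x y \<boxtimes>\<^sub>a Ident C z)"
    and Tens_exact: "dist_triangle C x y z f g h \<Longrightarrow> w \<in> Obj C \<Longrightarrow>
        dist_triangle C (x \<boxtimes> w) (y \<boxtimes> w) (z \<boxtimes> w)
          (f \<boxtimes>\<^sub>a Ident C w) (g \<boxtimes>\<^sub>a Ident C w) (Susp C x w \<cdot> (h \<boxtimes>\<^sub>a Ident C w))"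
    and Braid_sign: "Braid C (Shift C \<one>\<^sub>t) (Shift C \<one>\<^sub>t) = neg C (Ident C (Shift C \<one>\<^sub>t \<boxtimes> Shift C \<one>\<^sub>t))"

definition dualizable :: "('o, 'm, 'z) tt_category_scheme \<Rightarrow> 'o \<Rightarrow> bool" where
  "dualizable C x \<longleftrightarrow> x \<in> Obj C \<and>
     (\<exists>y \<in> Obj C. \<exists>\<eta> \<in> Hom C \<one>\<^sub>t\<^bsub>C\<^esub> (x \<boxtimes>\<^bsub>C\<^esub> y). \<exists>\<epsilon> \<in> Hom C (y \<boxtimes>\<^bsub>C\<^esub> x) \<one>\<^sub>t\<^bsub>C\<^esub>.
        Runit C x \<cdot>\<^bsub>C\<^esub> (Ident C x \<boxtimes>\<^sub>a\<^bsub>C\<^esub> \<epsilon>) \<cdot>\<^bsub>C\<^esub> Assoc C x y x \<cdot>\<^bsub>C\<^esub> (\<eta> \<boxtimes>\<^sub>a\<^bsub>C\<^esub> Ident C x) = Lunit C x \<and>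
        (\<exists>\<beta>. inverse_arrows C (Assoc C y x y) \<beta> \<and>
           Lunit C y \<cdot>\<^bsub>C\<^esub> (\<epsilon> \<boxtimes>\<^sub>a\<^bsub>C\<^esub> Ident C y) \<cdot>\<^bsub>C\<^esub> \<beta> \<cdot>\<^bsub>C\<^esub> (Ident C y \<boxtimes>\<^sub>a\<^bsub>C\<^esub> \<eta>) = Runit C y))"

definition invertible_object :: "('o, 'm, 'z) tt_category_scheme \<Rightarrow> 'o \<Rightarrow> bool" where
  "invertible_object C x \<longleftrightarrow> x \<in> Obj C \<and> (\<exists>y \<in> Obj C. isomorphic C (x \<boxtimes>\<^bsub>C\<^esub> y) \<one>\<^sub>t\<^bsub>C\<^esub>)"

text \<open>Elements of the Picard group are isomorphism classes, represented as sets of objects.\<close>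

definition Pic :: "('o, 'm, 'z) tt_category_scheme \<Rightarrow> 'o set monoid" where
  "Pic C = \<lparr>
     carrier = iso_class C ` {x. invertible_object C x},
     mult = (\<lambda>A B. {z \<in> Obj C. \<exists>a\<in>A. \<exists>b\<in>B. isomorphic C (a \<boxtimes>\<^bsub>C\<^esub> b) z}),
     one = iso_class C \<one>\<^sub>t\<^bsub>C\<^esub>\<rparr>"

locale rigidly_compactly_generated = smallness small + closed_tt_category C
  for small :: "'i set \<Rightarrow> bool" and C :: "('o, 'm, 'z) tt_category_scheme" (structure) +
  assumes small_coproducts: "small I \<Longrightarrow> (\<And>k. k \<in> I \<Longrightarrow> x k \<in> Obj C) \<Longrightarrow>
        \<exists>s \<iota>. is_coproduct C I x s \<iota>"
    and generated: "compactly_generated small C"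
    and compact_iff_dualizable: "compact_object small C c \<longleftrightarrow> dualizable C c"

definition compact_part ::
  "('i set \<Rightarrow> bool) \<Rightarrow> ('o, 'm, 'z) triangulated_category_scheme \<Rightarrow> ('o, 'm, 'z) triangulated_category_scheme" where
  "compact_part small C = full_subcategory C {x. compact_object small C x}"

definition concentration ::
  "('i set \<Rightarrow> bool) \<Rightarrow> ('o, 'm, 'z) triangulated_category_scheme \<Rightarrow> 'o set \<Rightarrow> ('o, 'm, 'z) triangulated_category_scheme" where
  "concentration small C \<G> = full_subcategory C (Loc small C \<G>)"

text \<open>\<open>Pic_concentration small C H\<close> is the concentration at the invertible objects whose class lies
  in the set of isomorphism classes \<open>H\<close>.\<close>

definition Pic_concentration ::
  "('i set \<Rightarrow> bool) \<Rightarrow> ('o, 'm, 'z) triangulated_category_scheme \<Rightarrow> 'o set set \<Rightarrow> ('o, 'm, 'z) triangulated_category_scheme" where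
  "Pic_concentration small C H = concentration small C (\<Union>H)"


section \<open>The Balmer spectrum\<close>

definition thick_tensor_ideal :: "('o, 'm, 'z) tt_category_scheme \<Rightarrow> 'o set \<Rightarrow> bool" where
  "thick_tensor_ideal K P \<longleftrightarrow> thick_subcategory K P \<and>
     (\<forall>a \<in> Obj K. \<forall>b \<in> P. a \<boxtimes>\<^bsub>K\<^esub> b \<in> P)"

definition prime_ideals :: "('o, 'm, 'z) tt_category_scheme \<Rightarrow> 'o set set" where
  "prime_ideals K = {P. thick_tensor_ideal K P \<and> P \<noteq> Obj K \<and>
     (\<forall>a \<in> Obj K. \<forall>b \<in> Obj K. a \<boxtimes>\<^bsub>K\<^esub> b \<in> P \<longrightarrow> a \<in> P \<or> b \<in> P)}"

definition supp :: "('o, 'm, 'z) tt_category_scheme \<Rightarrow> 'o \<Rightarrow> 'o set set" where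
  "supp K a = {P \<in> prime_ideals K. a \<notin> P}"

text \<open>The complements of the supports cover the spectrum, since primes contain the zero objects.\<close>

definition Spc :: "('o, 'm, 'z) tt_category_scheme \<Rightarrow> 'o set topology" where
  "Spc K = topology_generated_by {prime_ideals K - supp K a |a. a \<in> Obj K}"

text \<open>The map \<open>Spc L \<rightarrow> Spc K\<close> induced by a tensor-triangulated functor \<open>K \<rightarrow> L\<close>, which enters only
  through its action \<open>F\<close> on objects.\<close>

definition Spc_map :: "('o, 'm, 'z) tt_category_scheme \<Rightarrow> ('o \<Rightarrow> 'p) \<Rightarrow> 'p set \<Rightarrow> 'o set" where
  "Spc_map K F P = {a \<in> Obj K. F a \<in> P}"


section \<open>Limits of topological spaces\<close>

definition directed_by_inclusion :: "'a set set \<Rightarrow> bool" where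
  "directed_by_inclusion \<H> \<longleftrightarrow> \<H> \<noteq> {} \<and> (\<forall>H\<in>\<H>. \<forall>H'\<in>\<H>. \<exists>H''\<in>\<H>. H \<subseteq> H'' \<and> H' \<subseteq> H'')"

text \<open>Limit of spaces \<open>X i\<close>, \<open>i \<in> I\<close>, along maps \<open>r i j : X j \<rightarrow> X i\<close> for \<open>leq i j\<close>.\<close>

definition limit_topology ::
  "'i set \<Rightarrow> ('i \<Rightarrow> 'i \<Rightarrow> bool) \<Rightarrow> ('i \<Rightarrow> 'a topology) \<Rightarrow> ('i \<Rightarrow> 'i \<Rightarrow> 'a \<Rightarrow> 'a) \<Rightarrow> ('i \<Rightarrow> 'a) topology" where
  "limit_topology I leq X r = subtopology (product_topology X I)
     {p. \<forall>i\<in>I. \<forall>j\<in>I. leq i j \<longrightarrow> r i j (p j) = p i}"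

end

theory Submission
  imports Defs
begin

text \<open>
  The key point is a form of Neeman's theorem: the compact objects of \<open>Loc \<G>\<close>, for a set \<open>\<G>\<close> of
  compact objects, are exactly the summands of objects of the triangulated hull of \<open>\<G>\<close>. As hom-sets
  need not be small, cellular towers are not available. Instead, the objects \<open>y\<close> such that each map
  from a compact object of \<open>Loc \<G>\<close> to \<open>y\<close> factors through the hull form a localizing subcategory, hence
  contain all of \<open>Loc \<G>\<close>; for a compact \<open>y\<close> apply this to the identity of \<open>y\<close>. Since triangulated hulls
  commute with directed unions, so do the compact parts of the concentrations, as full subcategories,
  and primes of a directed union of subcategories are compatible families of primes.
\<close>

text \<open>What shapes the proof is the choice of compactness notion. Compact objects of a
  concentration are tested only on coproducts inside \<open>Loc\<close>, so a priori they need not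
  be compact in the ambient category; \<open>relatively_compact\<close> records this while still
  using coproducts of the ambient category. Injectivity of the canonical map in the definition of
  compactness is automatic, so compactness only says that a map into a coproduct is a finite sum of
  maps through the inclusions, and \<open>finite_sum\<close> makes this accessible to induction.
  Among the closure properties behind the factorization argument, the one for cones is delicate: a
  factorization has to be corrected before it lifts along the triangle. Two further facts feed the
  result. Invertible objects are compact, by transport from the unit along the equivalence
  \<open>- \<boxtimes> y\<close>. And \<open>Loc\<close> contains the summands of its objects, by an
  Eilenberg swindle. The spectrum sees the tensor product only on objects, so primes of a full
  subcategory can be described entirely in the ambient category.\<close>

lemma product_topology_cong:
  assumes "\<And>i. i \<in> I \<Longrightarrow> X i = Y i"
  shows "product_topology X I = product_topology Y I"
proof -
  have "(\<lambda>F. \<exists>i U. F = {f. f i \<in> U} \<and> i \<in> I \<and> openin (X i) U) =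
      (\<lambda>F. \<exists>i U. F = {f. f i \<in> U} \<and> i \<in> I \<and> openin (Y i) U)"
    using assms by (intro ext) metis
  moreover have "(\<Pi>\<^sub>E i\<in>I. topspace (X i)) = (\<Pi>\<^sub>E i\<in>I. topspace (Y i))"
    using assms by (intro PiE_cong) simp
  ultimately show ?thesis unfolding product_topology by simp
qed

lemma subgroup_directed_Union:
  assumes dir: "directed_by_inclusion \<H>" and H: "\<And>H. H \<in> \<H> \<Longrightarrow> subgroup H G"
  shows "subgroup (\<Union>\<H>) G"
proof
  show "\<Union>\<H> \<subseteq> carrier G" using subgroup.subset[OF H] by blast
  show "\<one>\<^bsub>G\<^esub> \<in> \<Union>\<H>" using dir subgroup.one_closed[OF H] unfolding directed_by_inclusion_def by auto
  show "inv\<^bsub>G\<^esub> x \<in> \<Union>\<H>" if "x \<in> \<Union>\<H>" for x using that subgroup.m_inv_closed[OF H] by blast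
  show "x \<otimes>\<^bsub>G\<^esub> y \<in> \<Union>\<H>" if x: "x \<in> \<Union>\<H>" and y: "y \<in> \<Union>\<H>" for x y
  proof -
    obtain K where "K \<in> \<H>" "x \<in> K" "y \<in> K"
      using dir x y unfolding directed_by_inclusion_def by blast
    then show ?thesis using subgroup.m_closed[OF H] by blast
  qed
qed

section \<open>Additive and triangulated categories\<close>

context category
begin

text \<open>As a simp rule this turns composability into equations between \<open>Dom\<close> and
  \<open>Cod\<close>, which the simplifier propagates through composites. Proofs that must keep
  hom-sets opaque delete it locally.\<close>

lemma in_Hom [simp]: "f \<in> Hom C x y \<longleftrightarrow> f \<in> Arr C \<and> Dom C f = x \<and> Cod C f = y"
  by (simp add: Hom_def)

lemma arr_Obj [simp]: "f \<in> Arr C \<Longrightarrow> Dom C f \<in> Obj C" "f \<in> Arr C \<Longrightarrow> Cod C f \<in> Obj C"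
  by (rule Dom_Obj Cod_Obj; assumption)+

lemma Hom_Obj: "f \<in> Hom C x y \<Longrightarrow> x \<in> Obj C \<and> y \<in> Obj C"
  using Dom_Obj Cod_Obj by auto

lemma Ident_simps [simp]:
  assumes "x \<in> Obj C"
  shows "Ident C x \<in> Arr C" "Dom C (Ident C x) = x" "Cod C (Ident C x) = x"
  using Ident_Hom[OF assms] by auto

lemma Comp_simps [simp]:
  assumes "f \<in> Arr C" "g \<in> Arr C" "Dom C g = Cod C f"
  shows "g \<cdot> f \<in> Arr C" "Dom C (g \<cdot> f) = Dom C f" "Cod C (g \<cdot> f) = Cod C g"
  using Comp_Hom[of f "Dom C f" "Cod C f" g "Cod C g"] assms by auto

lemma Comp_Ident [simp]:
  assumes "f \<in> Arr C"
  shows "Dom C f = x \<Longrightarrow> f \<cdot> Ident C x = f" "Cod C f = y \<Longrightarrow> Ident C y \<cdot> f = f"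
  using Ident_left[of f "Dom C f" "Cod C f"] Ident_right[of f "Dom C f" "Cod C f"] assms by auto

lemma Comp_assoc_arr [simp]:
  assumes "f \<in> Arr C" "g \<in> Arr C" "h \<in> Arr C" "Dom C g = Cod C f" "Dom C h = Cod C g"
  shows "(h \<cdot> g) \<cdot> f = h \<cdot> (g \<cdot> f)"
  using Comp_assoc[of f "Dom C f" "Cod C f" g "Cod C g" h "Cod C h"] assms by auto

text \<open>Composites are normalized to the right, which hides a known product
  \<open>h \<cdot> g\<close> inside \<open>h \<cdot> (g \<cdot> f)\<close>. Instantiated with an
  equation for \<open>h \<cdot> g\<close>, this rule rewrites it there.\<close>

lemma Comp_reassoc:
  assumes "h \<cdot> g = k" "f \<in> Arr C" "g \<in> Arr C" "h \<in> Arr C" "Dom C g = Cod C f" "Dom C h = Cod C g"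
  shows "h \<cdot> (g \<cdot> f) = k \<cdot> f"
  using assms by auto

lemma is_isoE:
  assumes "is_iso C f"
  obtains g where "f \<in> Arr C" "g \<in> Arr C" "Dom C g = Cod C f" "Cod C g = Dom C f"
    "g \<cdot> f = Ident C (Dom C f)" "f \<cdot> g = Ident C (Cod C f)" "is_iso C g"
proof -
  obtain g where "inverse_arrows C f g" using assms unfolding is_iso_def by blast
  then show ?thesis
    using that[of g] unfolding is_iso_def inverse_arrows_def by auto
qed

lemma is_isoI:
  assumes "f \<in> Hom C x y" "g \<in> Hom C y x" "g \<cdot> f = Ident C x" "f \<cdot> g = Ident C y"
  shows "is_iso C f"
  using assms unfolding is_iso_def inverse_arrows_def by auto

lemma is_iso_Ident: "x \<in> Obj C \<Longrightarrow> is_iso C (Ident C x)"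
  by (rule is_isoI[of _ x x "Ident C x"]) auto

lemma is_iso_Comp:
  assumes "is_iso C f" "is_iso C g" "Dom C g = Cod C f"
  shows "is_iso C (g \<cdot> f)"
proof -
  obtain f' where f': "f \<in> Arr C" "f' \<in> Arr C" "Dom C f' = Cod C f" "Cod C f' = Dom C f"
    "f' \<cdot> f = Ident C (Dom C f)" "f \<cdot> f' = Ident C (Cod C f)" using assms is_isoE by metis
  obtain g' where g': "g \<in> Arr C" "g' \<in> Arr C" "Dom C g' = Cod C g" "Cod C g' = Dom C g"
    "g' \<cdot> g = Ident C (Dom C g)" "g \<cdot> g' = Ident C (Cod C g)" using assms is_isoE by metis
  show ?thesis
    by (rule is_isoI[of _ "Dom C f" "Cod C g" "f' \<cdot> g'"])
      (use f' g' assms in \<open>auto simp: Comp_reassoc[OF f'(6)] Comp_reassoc[OF g'(5)]\<close>)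
qed

lemma isomorphicE:
  assumes "isomorphic C x y"
  obtains f g where "f \<in> Arr C" "Dom C f = x" "Cod C f = y" "g \<in> Arr C" "Dom C g = y" "Cod C g = x"
    "g \<cdot> f = Ident C x" "f \<cdot> g = Ident C y" "is_iso C f" "is_iso C g"
proof -
  obtain f where f: "f \<in> Hom C x y" "is_iso C f" using assms unfolding isomorphic_def by blast
  from f(2) show ?thesis
  proof (rule is_isoE)
    fix g assume "g \<in> Arr C" "Dom C g = Cod C f" "Cod C g = Dom C f"
      "g \<cdot> f = Ident C (Dom C f)" "f \<cdot> g = Ident C (Cod C f)" "is_iso C g"
    then show ?thesis using f by (intro that[of f g]) auto
  qed
qed

lemma isomorphicI:
  "is_iso C f \<Longrightarrow> f \<in> Hom C x y \<Longrightarrow> isomorphic C x y"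
  unfolding isomorphic_def by blast

lemma isomorphic_refl: "x \<in> Obj C \<Longrightarrow> isomorphic C x x"
  using is_iso_Ident by (rule isomorphicI) auto

lemma isomorphic_sym: "isomorphic C x y \<Longrightarrow> isomorphic C y x"
  by (erule isomorphicE) (rule isomorphicI, auto)

lemma isomorphic_trans: "isomorphic C x y \<Longrightarrow> isomorphic C y z \<Longrightarrow> isomorphic C x z"
  unfolding isomorphic_def by (metis in_Hom is_iso_Comp Comp_simps)

lemma isomorphic_Obj: "isomorphic C x y \<Longrightarrow> x \<in> Obj C \<and> y \<in> Obj C"
  unfolding isomorphic_def using Hom_Obj by blast

lemma iso_cancel:
  assumes "is_iso C f" "g \<in> Arr C" "h \<in> Arr C" "Dom C g = Cod C f" "Dom C h = Cod C f"
    "g \<cdot> f = h \<cdot> f"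
  shows "g = h"
proof -
  obtain f' where f': "f \<in> Arr C" "f' \<in> Arr C" "Dom C f' = Cod C f" "Cod C f' = Dom C f"
    "f' \<cdot> f = Ident C (Dom C f)" "f \<cdot> f' = Ident C (Cod C f)" using assms is_isoE by metis
  have "(g \<cdot> f) \<cdot> f' = (h \<cdot> f) \<cdot> f'" using assms by simp
  then show ?thesis using f' assms(2-5) by simp
qed

lemma iso_cancel_left:
  assumes "is_iso C f" "g \<in> Arr C" "h \<in> Arr C" "Cod C g = Dom C f" "Cod C h = Dom C f"
    "f \<cdot> g = f \<cdot> h"
  shows "g = h"
proof -
  obtain f' where f': "f \<in> Arr C" "f' \<in> Arr C" "Dom C f' = Cod C f" "Cod C f' = Dom C f"
    "f' \<cdot> f = Ident C (Dom C f)" "f \<cdot> f' = Ident C (Cod C f)" using assms is_isoE by metis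
  have "f' \<cdot> (f \<cdot> g) = f' \<cdot> (f \<cdot> h)" using assms by simp
  then show ?thesis using f' assms(2-5) by (simp add: Comp_reassoc[OF f'(5)])
qed

text \<open>A retract with no complement chosen: this is what a factorization of an identity through
  \<open>t\<close> delivers.\<close>

definition summand :: "'o \<Rightarrow> 'o \<Rightarrow> bool" where
  "summand c t \<longleftrightarrow> (\<exists>i \<in> Hom C c t. \<exists>p \<in> Hom C t c. p \<cdot> i = Ident C c)"

lemma isomorphic_imp_summand: "isomorphic C x y \<Longrightarrow> summand y x"
  unfolding summand_def by (erule isomorphicE) fastforce

lemma summand_trans:
  assumes "summand a b" "summand b c"
  shows "summand a c"
proof -
  obtain i p where ip: "i \<in> Arr C" "Dom C i = a" "Cod C i = b" "p \<in> Arr C" "Dom C p = b" "Cod C p = a"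
    "p \<cdot> i = Ident C a" using assms(1) unfolding summand_def by auto
  obtain j q where jq: "j \<in> Arr C" "Dom C j = b" "Cod C j = c" "q \<in> Arr C" "Dom C q = c" "Cod C q = b"
    "q \<cdot> j = Ident C b" using assms(2) unfolding summand_def by auto
  show ?thesis
    unfolding summand_def
    by (intro bexI[of _ "j \<cdot> i"] bexI[of _ "p \<cdot> q"])
      (use ip jq in \<open>auto simp: Comp_reassoc[OF jq(7)]\<close>)
qed

definition factors_through :: "'m \<Rightarrow> 'o \<Rightarrow> bool" where
  "factors_through f t \<longleftrightarrow> (\<exists>a \<in> Hom C (Dom C f) t. \<exists>b \<in> Hom C t (Cod C f). f = b \<cdot> a)"

lemma factors_throughI:
  "a \<in> Hom C x t \<Longrightarrow> b \<in> Hom C t y \<Longrightarrow> factors_through (b \<cdot> a) t"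
  unfolding factors_through_def by (intro bexI[of _ a] bexI[of _ b]) auto

lemma factors_throughE:
  assumes "factors_through f t"
  obtains a b where "a \<in> Arr C" "Dom C a = Dom C f" "Cod C a = t" "b \<in> Arr C" "Dom C b = t"
    "Cod C b = Cod C f" "f = b \<cdot> a"
  using assms unfolding factors_through_def by auto

lemma factors_through_Comp:
  assumes "factors_through f t" "f \<in> Arr C"
  shows "u \<in> Arr C \<Longrightarrow> Dom C u = Cod C f \<Longrightarrow> factors_through (u \<cdot> f) t"
    and "u \<in> Arr C \<Longrightarrow> Cod C u = Dom C f \<Longrightarrow> factors_through (f \<cdot> u) t"
proof -
  obtain a b where ab: "a \<in> Arr C" "Dom C a = Dom C f" "Cod C a = t" "b \<in> Arr C" "Dom C b = t"
    "Cod C b = Cod C f" and f: "f = b \<cdot> a" using assms(1) by (rule factors_throughE) (rule that)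
  show "factors_through (u \<cdot> f) t" if "u \<in> Arr C" "Dom C u = Cod C f"
  proof -
    have "u \<cdot> f = (u \<cdot> b) \<cdot> a" unfolding f using ab that by simp
    then show ?thesis using ab that factors_throughI[of a "Dom C f" t "u \<cdot> b" "Cod C u"] by simp
  qed
  show "factors_through (f \<cdot> u) t" if "u \<in> Arr C" "Cod C u = Dom C f"
  proof -
    have "f \<cdot> u = b \<cdot> (a \<cdot> u)" unfolding f using ab that by simp
    then show ?thesis using ab that factors_throughI[of "a \<cdot> u" "Dom C u" t b "Cod C f"] by simp
  qed
qed

lemma factors_through_typedE:
  assumes "factors_through f t" "Dom C f = x" "Cod C f = y"
  obtains a b where "a \<in> Arr C" "Dom C a = x" "Cod C a = t" "b \<in> Arr C" "Dom C b = t"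
    "Cod C b = y" "f = b \<cdot> a"
  using factors_throughE[OF assms(1)] assms(2,3) that by metis

lemma coproductD:
  assumes "is_coproduct C I x s \<iota>"
  shows "s \<in> Obj C"
    and "k \<in> I \<Longrightarrow> \<iota> k \<in> Arr C"
    and "k \<in> I \<Longrightarrow> Dom C (\<iota> k) = x k"
    and "k \<in> I \<Longrightarrow> Cod C (\<iota> k) = s"
    and "k \<in> I \<Longrightarrow> x k \<in> Obj C"
  using assms Hom_Obj[of "\<iota> k"] unfolding is_coproduct_def by auto

lemma coproduct_map:
  assumes "is_coproduct C I x s \<iota>" "z \<in> Obj C" "\<And>k. k \<in> I \<Longrightarrow> f k \<in> Hom C (x k) z"
  obtains g where "g \<in> Arr C" "Dom C g = s" "Cod C g = z" "\<And>k. k \<in> I \<Longrightarrow> g \<cdot> \<iota> k = f k"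
  using assms unfolding is_coproduct_def by (metis in_Hom)

lemma coproduct_ext:
  assumes "is_coproduct C I x s \<iota>" "g \<in> Hom C s z" "h \<in> Hom C s z"
    "\<And>k. k \<in> I \<Longrightarrow> g \<cdot> \<iota> k = h \<cdot> \<iota> k"
  shows "g = h"
proof -
  have z: "z \<in> Obj C" using assms(2) Hom_Obj by blast
  have g: "g \<cdot> \<iota> k \<in> Hom C (x k) z" if "k \<in> I" for k
    using assms(2) that coproductD[OF assms(1)] by auto
  have "\<exists>!u. u \<in> Hom C s z \<and> (\<forall>k\<in>I. u \<cdot> \<iota> k = g \<cdot> \<iota> k)"
    by (rule assms(1)[unfolded is_coproduct_def, THEN conjunct2, THEN conjunct2, rule_format, OF z])
      (rule g)
  then show ?thesis using assms(2-4) by (elim ex1E) metis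
qed

lemma is_coproductI:
  assumes "s \<in> Obj C" "\<And>k. k \<in> I \<Longrightarrow> \<iota> k \<in> Hom C (x k) s"
    and "\<And>z f. z \<in> Obj C \<Longrightarrow> (\<And>k. k \<in> I \<Longrightarrow> f k \<in> Hom C (x k) z) \<Longrightarrow>
      \<exists>g \<in> Hom C s z. \<forall>k\<in>I. g \<cdot> \<iota> k = f k"
    and "\<And>z g h. g \<in> Hom C s z \<Longrightarrow> h \<in> Hom C s z \<Longrightarrow> (\<And>k. k \<in> I \<Longrightarrow> g \<cdot> \<iota> k = h \<cdot> \<iota> k) \<Longrightarrow> g = h"
  shows "is_coproduct C I x s \<iota>"
  unfolding is_coproduct_def
proof (intro conjI ballI allI impI)
  fix z f assume z: "z \<in> Obj C" and f: "\<forall>k\<in>I. f k \<in> Hom C (x k) z"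
  then obtain g where g: "g \<in> Hom C s z" "\<forall>k\<in>I. g \<cdot> \<iota> k = f k"
    using assms(3)[of z f] by blast
  show "\<exists>!g. g \<in> Hom C s z \<and> (\<forall>k\<in>I. g \<cdot> \<iota> k = f k)"
  proof (rule ex1I)
    show "g \<in> Hom C s z \<and> (\<forall>k\<in>I. g \<cdot> \<iota> k = f k)" using g by blast
  next
    fix h assume "h \<in> Hom C s z \<and> (\<forall>k\<in>I. h \<cdot> \<iota> k = f k)"
    then show "h = g" using g assms(4)[of h z g] by simp
  qed
qed (use assms in blast)+

end

section \<open>Sums, negatives and zero morphisms\<close>

context additive_category
begin

lemma hom_group_simps [simp]:
  "carrier (hom_group C x y) = Hom C x y" "mult (hom_group C x y) = Add C"
  "one (hom_group C x y) = Zero C x y"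
  unfolding hom_group_def by auto

lemma Zero_simps [simp]:
  assumes "x \<in> Obj C" "y \<in> Obj C"
  shows "Zero C x y \<in> Arr C" "Dom C (Zero C x y) = x" "Cod C (Zero C x y) = y"
proof -
  interpret comm_group "hom_group C x y" using hom_comm_group assms .
  show "Zero C x y \<in> Arr C" "Dom C (Zero C x y) = x" "Cod C (Zero C x y) = y"
    using one_closed by simp_all
qed

lemma Add_simps [simp]:
  assumes "f \<in> Arr C" "g \<in> Arr C" "Dom C g = Dom C f" "Cod C g = Cod C f"
  shows "f \<oplus>\<^sub>h g \<in> Arr C" "Dom C (f \<oplus>\<^sub>h g) = Dom C f" "Cod C (f \<oplus>\<^sub>h g) = Cod C f"
proof -
  interpret comm_group "hom_group C (Dom C f) (Cod C f)" using hom_comm_group assms by simp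
  show "f \<oplus>\<^sub>h g \<in> Arr C" "Dom C (f \<oplus>\<^sub>h g) = Dom C f" "Cod C (f \<oplus>\<^sub>h g) = Cod C f"
    using m_closed[of f g] assms by simp_all
qed

lemma neg_simps [simp]:
  assumes "f \<in> Arr C"
  shows "neg C f \<in> Arr C" "Dom C (neg C f) = Dom C f" "Cod C (neg C f) = Cod C f"
proof -
  interpret comm_group "hom_group C (Dom C f) (Cod C f)" using hom_comm_group assms by simp
  show "neg C f \<in> Arr C" "Dom C (neg C f) = Dom C f" "Cod C (neg C f) = Cod C f"
    using inv_closed[of f] assms by (simp_all add: neg_def)
qed

lemma Add_neg [simp]:
  assumes "f \<in> Arr C"
  shows "f \<oplus>\<^sub>h neg C f = Zero C (Dom C f) (Cod C f)" "neg C f \<oplus>\<^sub>h f = Zero C (Dom C f) (Cod C f)"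
proof -
  interpret comm_group "hom_group C (Dom C f) (Cod C f)" using hom_comm_group assms by simp
  show "f \<oplus>\<^sub>h neg C f = Zero C (Dom C f) (Cod C f)" "neg C f \<oplus>\<^sub>h f = Zero C (Dom C f) (Cod C f)"
    using r_inv[of f] l_inv[of f] assms by (simp_all add: neg_def)
qed

lemma Add_Zero [simp]:
  assumes "f \<in> Arr C" "Dom C f = x" "Cod C f = y"
  shows "f \<oplus>\<^sub>h Zero C x y = f" "Zero C x y \<oplus>\<^sub>h f = f"
proof -
  interpret comm_group "hom_group C x y" using hom_comm_group assms by auto
  show "f \<oplus>\<^sub>h Zero C x y = f" "Zero C x y \<oplus>\<^sub>h f = f"
    using r_one[of f] l_one[of f] assms by simp_all
qed

lemma Add_assoc:
  assumes "f \<in> Arr C" "g \<in> Arr C" "h \<in> Arr C" "Dom C g = Dom C f" "Cod C g = Cod C f"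
    "Dom C h = Dom C f" "Cod C h = Cod C f"
  shows "(f \<oplus>\<^sub>h g) \<oplus>\<^sub>h h = f \<oplus>\<^sub>h (g \<oplus>\<^sub>h h)"
proof -
  interpret comm_group "hom_group C (Dom C f) (Cod C f)" using hom_comm_group assms by simp
  show ?thesis using m_assoc[of f g h] assms by simp
qed

lemma Add_commute:
  assumes "f \<in> Arr C" "g \<in> Arr C" "Dom C g = Dom C f" "Cod C g = Cod C f"
  shows "f \<oplus>\<^sub>h g = g \<oplus>\<^sub>h f"
proof -
  interpret comm_group "hom_group C (Dom C f) (Cod C f)" using hom_comm_group assms by simp
  show ?thesis using m_comm[of f g] assms by simp
qed

lemma Add_right_commute:
  assumes "f \<in> Arr C" "g \<in> Arr C" "h \<in> Arr C" "Dom C g = Dom C f" "Cod C g = Cod C f"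
    "Dom C h = Dom C f" "Cod C h = Cod C f"
  shows "(f \<oplus>\<^sub>h g) \<oplus>\<^sub>h h = (f \<oplus>\<^sub>h h) \<oplus>\<^sub>h g"
  using Add_assoc[of f g h] Add_assoc[of f h g] Add_commute[of g h] assms by simp

lemma Add_right_cancel:
  assumes "f \<in> Arr C" "g \<in> Arr C" "h \<in> Arr C" "Dom C g = Dom C f" "Cod C g = Cod C f"
    "Dom C h = Dom C f" "Cod C h = Cod C f"
  shows "f \<oplus>\<^sub>h h = g \<oplus>\<^sub>h h \<longleftrightarrow> f = g"
proof -
  interpret comm_group "hom_group C (Dom C f) (Cod C f)" using hom_comm_group assms by simp
  show ?thesis using right_cancel[of h f g] assms by simp
qed

lemma neg_unique:
  assumes "f \<in> Arr C" "g \<in> Arr C" "Dom C g = Dom C f" "Cod C g = Cod C f"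
    "f \<oplus>\<^sub>h g = Zero C (Dom C f) (Cod C f)"
  shows "g = neg C f"
proof -
  have "g \<oplus>\<^sub>h f = neg C f \<oplus>\<^sub>h f" using assms Add_commute[of f g] by simp
  then show ?thesis by (rule Add_right_cancel[THEN iffD1, rotated -1]) (use assms in auto)
qed

lemma diff_zero_imp_eq:
  assumes "f \<in> Arr C" "g \<in> Arr C" "Dom C g = Dom C f" "Cod C g = Cod C f"
    "f \<oplus>\<^sub>h neg C g = Zero C (Dom C f) (Cod C f)"
  shows "f = g"
proof -
  have "f \<oplus>\<^sub>h neg C g = g \<oplus>\<^sub>h neg C g" using assms by simp
  then show ?thesis by (rule Add_right_cancel[THEN iffD1, rotated -1]) (use assms in auto)
qed

lemma diff_Add_cancel:
  assumes "f \<in> Arr C" "g \<in> Arr C" "Dom C g = Dom C f" "Cod C g = Cod C f"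
  shows "(f \<oplus>\<^sub>h neg C g) \<oplus>\<^sub>h g = f" "g \<oplus>\<^sub>h (f \<oplus>\<^sub>h neg C g) = f"
proof -
  show 1: "(f \<oplus>\<^sub>h neg C g) \<oplus>\<^sub>h g = f" using assms by (subst Add_assoc) auto
  show "g \<oplus>\<^sub>h (f \<oplus>\<^sub>h neg C g) = f" using assms 1 Add_commute[of g "f \<oplus>\<^sub>h neg C g"] by auto
qed

lemma neg_neg [simp]: "f \<in> Arr C \<Longrightarrow> neg C (neg C f) = f"
  using neg_unique[of "neg C f" f] by simp

lemma Comp_Add [simp]:
  assumes "f \<in> Arr C" "f' \<in> Arr C" "Dom C f' = Dom C f" "Cod C f' = Cod C f" "g \<in> Arr C"
  shows "Dom C g = Cod C f \<Longrightarrow> g \<cdot> (f \<oplus>\<^sub>h f') = (g \<cdot> f) \<oplus>\<^sub>h (g \<cdot> f')"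
    and "Cod C g = Dom C f \<Longrightarrow> (f \<oplus>\<^sub>h f') \<cdot> g = (f \<cdot> g) \<oplus>\<^sub>h (f' \<cdot> g)"
  using assms Comp_Add_right[of f "Dom C f" "Cod C f" f' g "Cod C g"]
    Comp_Add_left[of g "Dom C g" "Dom C f" f "Cod C f" f'] by auto

text \<open>In a group only the neutral element equals its own double. Composition, shift and tensor
  product are shown to respect zero morphisms through this.\<close>

lemma idem_Zero:
  assumes "f \<in> Arr C" "f \<oplus>\<^sub>h f = f" shows "f = Zero C (Dom C f) (Cod C f)"
  by (rule Add_right_cancel[of _ _ f, THEN iffD1]) (use assms in auto)

lemma Comp_Zero [simp]:
  assumes "g \<in> Arr C" "x \<in> Obj C"
  shows "Dom C g = y \<Longrightarrow> g \<cdot> Zero C x y = Zero C x (Cod C g)"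
    and "Cod C g = y \<Longrightarrow> Zero C y x \<cdot> g = Zero C (Dom C g) x"
proof -
  assume y: "Dom C g = y"
  then have z: "Zero C x y \<oplus>\<^sub>h Zero C x y = Zero C x y" using assms by auto
  have "(g \<cdot> Zero C x y) \<oplus>\<^sub>h (g \<cdot> Zero C x y) = g \<cdot> (Zero C x y \<oplus>\<^sub>h Zero C x y)"
    using y assms by (subst Comp_Add) auto
  then show "g \<cdot> Zero C x y = Zero C x (Cod C g)"
    using idem_Zero[of "g \<cdot> Zero C x y"] y z assms by auto
next
  assume y: "Cod C g = y"
  then have z: "Zero C y x \<oplus>\<^sub>h Zero C y x = Zero C y x" using assms by auto
  have "(Zero C y x \<cdot> g) \<oplus>\<^sub>h (Zero C y x \<cdot> g) = (Zero C y x \<oplus>\<^sub>h Zero C y x) \<cdot> g"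
    using y assms by (subst Comp_Add) auto
  then show "Zero C y x \<cdot> g = Zero C (Dom C g) x"
    using idem_Zero[of "Zero C y x \<cdot> g"] y z assms by auto
qed

lemma Comp_neg [simp]:
  assumes "f \<in> Arr C" "g \<in> Arr C" "Dom C g = Cod C f"
  shows "g \<cdot> neg C f = neg C (g \<cdot> f)" "neg C g \<cdot> f = neg C (g \<cdot> f)"
proof -
  have "(g \<cdot> f) \<oplus>\<^sub>h (g \<cdot> neg C f) = g \<cdot> (f \<oplus>\<^sub>h neg C f)" using assms by (subst Comp_Add) auto
  then show "g \<cdot> neg C f = neg C (g \<cdot> f)" using assms by (intro neg_unique) auto
  have "(g \<cdot> f) \<oplus>\<^sub>h (neg C g \<cdot> f) = (g \<oplus>\<^sub>h neg C g) \<cdot> f" using assms by (subst Comp_Add) auto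
  then show "neg C g \<cdot> f = neg C (g \<cdot> f)" using assms by (intro neg_unique) auto
qed

lemma neg_Zero [simp]: "x \<in> Obj C \<Longrightarrow> y \<in> Obj C \<Longrightarrow> neg C (Zero C x y) = Zero C x y"
  using neg_unique[of "Zero C x y" "Zero C x y"] by simp

lemma neg_eq_Zero_iff:
  "f \<in> Arr C \<Longrightarrow> Dom C f = x \<Longrightarrow> Cod C f = y \<Longrightarrow> neg C f = Zero C x y \<longleftrightarrow> f = Zero C x y"
  by (metis neg_neg neg_Zero arr_Obj)

text \<open>Every map into or out of \<open>z\<close> is a composite with \<open>Ident C z\<close>,
  so one equation replaces all uniqueness conditions. In this form an operation that respects
  identities and zero maps visibly respects zero objects.\<close>

lemma zero_object_iff: "is_zero_object C z \<longleftrightarrow> z \<in> Obj C \<and> Ident C z = Zero C z z"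
proof
  assume z: "is_zero_object C z"
  then have "\<exists>!f. f \<in> Hom C z z" unfolding is_zero_object_def by blast
  moreover have "Ident C z \<in> Hom C z z" "Zero C z z \<in> Hom C z z"
    using z unfolding is_zero_object_def by auto
  ultimately show "z \<in> Obj C \<and> Ident C z = Zero C z z"
    using z unfolding is_zero_object_def by blast
next
  assume z: "z \<in> Obj C \<and> Ident C z = Zero C z z"
  have "f = Zero C z x" if "f \<in> Hom C z x" for f x
  proof -
    have "f = f \<cdot> Ident C z" using that by simp
    also have "\<dots> = Zero C z x" using that z by auto
    finally show ?thesis .
  qed
  moreover have "f = Zero C x z" if "f \<in> Hom C x z" for f x
  proof -
    have "f = Ident C z \<cdot> f" using that by simp
    also have "\<dots> = Zero C x z" using that z by auto
    finally show ?thesis .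
  qed
  ultimately show "is_zero_object C z"
    unfolding is_zero_object_def using z Zero_simps by (metis in_Hom)
qed

lemma zero_object_Hom:
  assumes "is_zero_object C z" "f \<in> Arr C"
  shows "Dom C f = z \<Longrightarrow> f = Zero C z (Cod C f)" "Cod C f = z \<Longrightarrow> f = Zero C (Dom C f) z"
proof -
  assume d: "Dom C f = z"
  have "f = f \<cdot> Ident C z" using d assms(2) by simp
  also have "\<dots> = Zero C z (Cod C f)" using assms d by (auto simp: zero_object_iff)
  finally show "f = Zero C z (Cod C f)" .
next
  assume d: "Cod C f = z"
  have "f = Ident C z \<cdot> f" using d assms(2) by simp
  also have "\<dots> = Zero C (Dom C f) z" using assms d by (auto simp: zero_object_iff)
  finally show "f = Zero C (Dom C f) z" .
qed

lemma factors_through_Add: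
  assumes "factors_through f t" "factors_through g u" "f \<in> Hom C x y" "g \<in> Hom C x y"
    "is_biproduct C t u s"
  shows "factors_through (f \<oplus>\<^sub>h g) s"
proof -
  obtain a b where ab: "a \<in> Arr C" "Dom C a = Dom C f" "Cod C a = t" "b \<in> Arr C" "Dom C b = t"
    "Cod C b = Cod C f" "f = b \<cdot> a" using assms(1) by (rule factors_throughE)
  obtain c d where cd: "c \<in> Arr C" "Dom C c = Dom C g" "Cod C c = u" "d \<in> Arr C" "Dom C d = u"
    "Cod C d = Cod C g" "g = d \<cdot> c" using assms(2) by (rule factors_throughE)
  obtain i j p q where s: "i \<in> Arr C" "Dom C i = t" "Cod C i = s" "j \<in> Arr C" "Dom C j = u" "Cod C j = s"
    "p \<in> Arr C" "Dom C p = s" "Cod C p = t" "q \<in> Arr C" "Dom C q = s" "Cod C q = u"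
    and e: "p \<cdot> i = Ident C t" "q \<cdot> j = Ident C u" "p \<cdot> j = Zero C u t" "q \<cdot> i = Zero C t u"
    using assms(5) unfolding is_biproduct_def by auto
  have obj: "t \<in> Obj C" "u \<in> Obj C" using s by auto
  have xy: "x \<in> Obj C" "Dom C f = x" "Cod C f = y" "Dom C g = x" "Cod C g = y" using assms(3,4) by auto
  \<comment> \<open>The row \<open>(b, d)\<close> times the column \<open>(a, c)\<close> through the
    biproduct; the cross terms vanish because \<open>p \<cdot> j\<close> and
    \<open>q \<cdot> i\<close> are zero.\<close>
  have A: "((b \<cdot> p) \<oplus>\<^sub>h (d \<cdot> q)) \<cdot> ((i \<cdot> a) \<oplus>\<^sub>h (j \<cdot> c)) = (b \<cdot> a) \<oplus>\<^sub>h (d \<cdot> c)"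
    using ab(1-6) cd(1-6) s e xy obj
    by (simp add: Comp_reassoc[OF e(1)] Comp_reassoc[OF e(2)] Comp_reassoc[OF e(3)] Comp_reassoc[OF e(4)])
  show ?thesis unfolding ab(7) cd(7) A[symmetric]
    by (rule factors_throughI[of _ x _ _ y]) (use ab(1-6) cd(1-6) s xy in auto)
qed

lemma biproduct_summand:
  assumes "is_biproduct C x y s"
  shows "summand x s" "summand y s"
  using assms unfolding is_biproduct_def summand_def by blast+

end

section \<open>Exactness properties of distinguished triangles\<close>

context triangulated_category
begin

lemma Shift_arr_simps [simp]:
  assumes "f \<in> Arr C"
  shows "Shift_arr C f \<in> Arr C" "Dom C (Shift_arr C f) = Shift C (Dom C f)"
    "Cod C (Shift_arr C f) = Shift C (Cod C f)"
proof -
  have "Shift_arr C f \<in> Hom C (Shift C (Dom C f)) (Shift C (Cod C f))"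
    using Shift_fully_faithful[of "Dom C f" "Cod C f"] assms unfolding bij_betw_def by auto
  then show "Shift_arr C f \<in> Arr C" "Dom C (Shift_arr C f) = Shift C (Dom C f)"
    "Cod C (Shift_arr C f) = Shift C (Cod C f)" by auto
qed

declare Shift_Obj [simp] Shift_Ident [simp]

lemma Shift_arr_Comp [simp]:
  "f \<in> Arr C \<Longrightarrow> g \<in> Arr C \<Longrightarrow> Dom C g = Cod C f \<Longrightarrow>
    Shift_arr C (g \<cdot> f) = Shift_arr C g \<cdot> Shift_arr C f"
  using Shift_Comp[of f "Dom C f" "Cod C f" g "Cod C g"] by simp

lemma Shift_arr_Add [simp]:
  "f \<in> Arr C \<Longrightarrow> g \<in> Arr C \<Longrightarrow> Dom C g = Dom C f \<Longrightarrow> Cod C g = Cod C f \<Longrightarrow>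
    Shift_arr C (f \<oplus>\<^sub>h g) = Shift_arr C f \<oplus>\<^sub>h Shift_arr C g"
  using Shift_Add[of f "Dom C f" "Cod C f" g] by simp

lemma Shift_arr_Zero [simp]:
  assumes "x \<in> Obj C" "y \<in> Obj C"
  shows "Shift_arr C (Zero C x y) = Zero C (Shift C x) (Shift C y)"
proof -
  have "Zero C x y \<oplus>\<^sub>h Zero C x y = Zero C x y" using assms by simp
  then have "Shift_arr C (Zero C x y) \<oplus>\<^sub>h Shift_arr C (Zero C x y) = Shift_arr C (Zero C x y)"
    using assms by (subst Shift_arr_Add[symmetric]) auto
  then show ?thesis using idem_Zero[of "Shift_arr C (Zero C x y)"] assms by simp
qed

lemma Shift_arr_inject:
  assumes "f \<in> Arr C" "g \<in> Arr C" "Dom C g = Dom C f" "Cod C g = Cod C f"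
    "Shift_arr C f = Shift_arr C g"
  shows "f = g"
  using Shift_fully_faithful[of "Dom C f" "Cod C f"] assms unfolding bij_betw_def inj_on_def by auto

lemma Shift_arr_full:
  assumes "F \<in> Arr C" "Dom C F = Shift C x" "Cod C F = Shift C y" "x \<in> Obj C" "y \<in> Obj C"
  obtains f where "f \<in> Arr C" "Dom C f = x" "Cod C f = y" "F = Shift_arr C f"
proof -
  have "F \<in> Shift_arr C ` Hom C x y"
    using Shift_fully_faithful[of x y] assms unfolding bij_betw_def by auto
  then show ?thesis using that by auto
qed

text \<open>The shift is an equivalence but need not be bijective on objects, so desuspending an
  object costs a pair of inverse maps \<open>a\<close>, \<open>b\<close>, which later proofs carry
  along.\<close>

lemma Shift_ess_surjE:
  assumes "y \<in> Obj C"
  obtains x a b where "x \<in> Obj C" "a \<in> Arr C" "Dom C a = Shift C x" "Cod C a = y" "b \<in> Arr C"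
    "Dom C b = y" "Cod C b = Shift C x" "b \<cdot> a = Ident C (Shift C x)" "a \<cdot> b = Ident C y"
    "is_iso C a" "is_iso C b"
proof -
  obtain x where "x \<in> Obj C" "isomorphic C (Shift C x) y" using Shift_ess_surj assms by blast
  then show ?thesis using that by (elim isomorphicE) metis
qed

lemma zero_object_Shift: "is_zero_object C z \<Longrightarrow> is_zero_object C (Shift C z)"
  unfolding zero_object_iff by (metis Shift_Obj Shift_Ident Shift_arr_Zero)

lemma triangleD:
  assumes "dist_triangle C x y z f g h"
  shows "f \<in> Arr C" "Dom C f = x" "Cod C f = y" "g \<in> Arr C" "Dom C g = y" "Cod C g = z"
    "h \<in> Arr C" "Dom C h = z" "Cod C h = Shift C x" "x \<in> Obj C" "y \<in> Obj C" "z \<in> Obj C"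
  using assms unfolding dist_triangle_def is_triangle_def by auto

lemma rotate:
  "dist_triangle C x y z f g h \<Longrightarrow> dist_triangle C y z (Shift C x) g h (neg C (Shift_arr C f))"
  using TR2[of x y z f g h] unfolding dist_triangle_def by blast

text \<open>Comparison with the triangle \<open>x -> x -> 0\<close> on the identity of
  \<open>x\<close> makes \<open>g \<cdot> f\<close> factor through a zero object.\<close>

lemma triangle_Comp_zero:
  assumes "dist_triangle C x y z f g h"
  shows "g \<cdot> f = Zero C x z"
proof -
  note t = triangleD[OF assms]
  obtain o' where o: "is_zero_object C o'" using zero_object_exists by blast
  then have oo: "o' \<in> Obj C" by (simp add: zero_object_iff)
  obtain c where c: "c \<in> Hom C o' z" "c \<cdot> Zero C x o' = g \<cdot> f"
    using TR3[OF TR1_Ident[OF t(10) o] assms, of "Ident C x" f] t by auto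
  then show ?thesis using t oo by simp
qed

text \<open>Exactness of \<open>Hom(-, w)\<close> at \<open>y\<close>: the pair of the zero map and
  \<open>u\<close> is completed to a map into the triangle \<open>0 -> w -> w\<close>.\<close>

lemma triangle_extend:
  assumes "dist_triangle C x y z f g h" "u \<in> Hom C y w" "u \<cdot> f = Zero C x w"
  obtains v where "v \<in> Arr C" "Dom C v = z" "Cod C v = w" "v \<cdot> g = u"
proof -
  note t = triangleD[OF assms(1)]
  obtain o' where o: "is_zero_object C o'" using zero_object_exists by blast
  then have oo: "o' \<in> Obj C" by (simp add: zero_object_iff)
  have w: "w \<in> Obj C" using assms(2) by auto
  have "is_triangle C o' w w (Zero C o' w) (Ident C w) (Zero C w (Shift C o'))"
    unfolding is_triangle_def using oo w by simp
  \<comment> \<open>\<open>TR2\<close> read backwards: the rotated triangle is the identity triangle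
    of \<open>w\<close> whose third object is the zero object \<open>Shift C o'\<close>.\<close>
  then have "dist_triangle C o' w w (Zero C o' w) (Ident C w) (Zero C w (Shift C o'))"
    using TR2[of o' w w "Zero C o' w" "Ident C w" "Zero C w (Shift C o')"]
      TR1_Ident[OF w zero_object_Shift[OF o]] oo w by simp
  note t' = this
  have u: "u \<in> Arr C" "Dom C u = y" "Cod C u = w" using assms(2) by auto
  have "\<exists>c \<in> Hom C z w. c \<cdot> g = Ident C w \<cdot> u \<and>
      Shift_arr C (Zero C x o') \<cdot> h = Zero C w (Shift C o') \<cdot> c"
    by (rule TR3[OF assms(1) t']) (use t oo w u assms(3) in simp_all)
  then obtain c where "c \<in> Hom C z w" "c \<cdot> g = Ident C w \<cdot> u" by blast
  then show ?thesis using u by (intro that[of c]) simp_all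
qed

text \<open>Exactness of \<open>Hom(w, -)\<close> at \<open>y\<close>. \<open>TR3\<close> only
  produces a third map, so both triangles are rotated until the wanted map is the third one, from
  \<open>Shift C w\<close> to \<open>Shift C x\<close>; fullness of the shift then desuspends
  it.\<close>

lemma triangle_lift:
  assumes "dist_triangle C x y z f g h" "u \<in> Hom C w y" "g \<cdot> u = Zero C w z"
  obtains v where "v \<in> Arr C" "Dom C v = w" "Cod C v = x" "f \<cdot> v = u"
proof -
  note t = triangleD[OF assms(1)]
  obtain o' where o: "is_zero_object C o'" using zero_object_exists by blast
  then have oo: "o' \<in> Obj C" by (simp add: zero_object_iff)
  have w: "w \<in> Obj C" using assms(2) by auto
  have u: "u \<in> Arr C" "Dom C u = w" "Cod C u = y" using assms(2) by auto
  have "\<exists>c \<in> Hom C (Shift C w) (Shift C x). c \<cdot> Zero C o' (Shift C w) = h \<cdot> Zero C o' z \<and>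
      Shift_arr C u \<cdot> neg C (Shift_arr C (Ident C w)) = neg C (Shift_arr C f) \<cdot> c"
    by (rule TR3[OF rotate[OF TR1_Ident[OF w o]] rotate[OF assms(1)]])
      (use t oo w u assms(3) in simp_all)
  then obtain c where c: "c \<in> Arr C" "Dom C c = Shift C w" "Cod C c = Shift C x"
    "Shift_arr C u \<cdot> neg C (Shift_arr C (Ident C w)) = neg C (Shift_arr C f) \<cdot> c" by auto
  obtain v where v: "v \<in> Arr C" "Dom C v = w" "Cod C v = x" "c = Shift_arr C v"
    using Shift_arr_full[of c w x] c t w by auto
  have "neg C (Shift_arr C u) = neg C (Shift_arr C (f \<cdot> v))" using c(4) v t u w by simp
  then have "Shift_arr C u = Shift_arr C (f \<cdot> v)" by (metis neg_neg Shift_arr_simps(1) Comp_simps(1) u(1) v(1,3) t(1,2))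
  then have "f \<cdot> v = u" using Shift_arr_inject[of u "f \<cdot> v"] u v t by simp
  then show ?thesis using v that by blast
qed

text \<open>Rotating a cone triangle backwards requires a preimage of the cone under the shift. It
  exists only up to isomorphism, and \<open>TR1_iso\<close> moves the triangle onto it.\<close>

lemma fibre_exists:
  assumes "f \<in> Hom C y z"
  obtains x u h where "dist_triangle C x y z u f h"
proof -
  have f: "f \<in> Arr C" "Dom C f = y" "Cod C f = z" "y \<in> Obj C" "z \<in> Obj C" using assms by auto
  obtain w g d where t: "dist_triangle C y z w f g d" using TR1_cone[OF assms] by blast
  note td = triangleD[OF t]
  obtain x a b where x: "x \<in> Obj C" "a \<in> Arr C" "Dom C a = Shift C x" "Cod C a = w" "b \<in> Arr C"
    "Dom C b = w" "Cod C b = Shift C x" "b \<cdot> a = Ident C (Shift C x)" "a \<cdot> b = Ident C w"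
    "is_iso C a" "is_iso C b" using Shift_ess_surjE[OF td(12)] by metis
  \<comment> \<open>The sign prescribed by \<open>TR2\<close> is absorbed into
    \<open>u\<close>.\<close>
  obtain u where u: "u \<in> Arr C" "Dom C u = x" "Cod C u = y" "neg C (d \<cdot> a) = Shift_arr C u"
    using Shift_arr_full[of "neg C (d \<cdot> a)" x y] x td by auto
  have "dist_triangle C y z (Shift C x) f (b \<cdot> g) (neg C (Shift_arr C u))"
    by (rule TR1_iso[OF t, of _ _ _ _ _ _ "Ident C y" "Ident C z" b])
      (use f x td in \<open>auto simp: is_triangle_def is_iso_Ident simp flip: u(4)\<close>)
  moreover have "is_triangle C x y z u f (b \<cdot> g)"
    unfolding is_triangle_def using f x u td by auto
  ultimately show ?thesis using TR2 that by blast
qed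

text \<open>\<open>Shift_arr C f \<cdot> h\<close> vanishes up to sign as a composite of consecutive
  maps, and \<open>Shift_arr C p\<close> is a left inverse of \<open>Shift_arr C f\<close>.\<close>

lemma split_mono_triangle:
  assumes "dist_triangle C x y z f g h" "p \<in> Hom C y x" "p \<cdot> f = Ident C x"
  shows "h = Zero C z (Shift C x)"
proof -
  note t = triangleD[OF assms(1)]
  have "neg C (Shift_arr C f) \<cdot> h = Zero C z (Shift C y)"
    using triangle_Comp_zero[OF rotate[OF assms(1)]]
      triangle_Comp_zero[OF rotate[OF rotate[OF assms(1)]]] t by simp
  then have "Shift_arr C f \<cdot> h = Zero C z (Shift C y)"
    using t by (simp add: neg_eq_Zero_iff)
  then have "Shift_arr C p \<cdot> (Shift_arr C f \<cdot> h) = Zero C z (Shift C x)"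
    using t assms(2) by auto
  moreover have "Shift_arr C p \<cdot> Shift_arr C f = Ident C (Shift C x)"
    using t assms(2,3) by (simp flip: Shift_arr_Comp)
  ultimately show ?thesis
    using t assms(2) by (simp add: Comp_reassoc[of "Shift_arr C p" "Shift_arr C f"])
qed

text \<open>That split sequences are distinguished is not an axiom, so the cone \<open>z\<close> of
  the inclusion \<open>i\<close> is compared with \<open>y\<close>: the projection \<open>q\<close>
  extends to \<open>r : z -> y\<close>, and \<open>g \<cdot> j\<close> turns out to be its
  inverse.\<close>

lemma biproduct_triangle:
  assumes "is_biproduct C x y s"
  obtains i z g h where "dist_triangle C x s z i g h" "isomorphic C z y"
proof -
  obtain i j p q where s: "i \<in> Arr C" "Dom C i = x" "Cod C i = s" "j \<in> Arr C" "Dom C j = y" "Cod C j = s"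
    "p \<in> Arr C" "Dom C p = s" "Cod C p = x" "q \<in> Arr C" "Dom C q = s" "Cod C q = y"
    and e: "p \<cdot> i = Ident C x" "q \<cdot> j = Ident C y" "p \<cdot> j = Zero C y x" "q \<cdot> i = Zero C x y"
    "(i \<cdot> p) \<oplus>\<^sub>h (j \<cdot> q) = Ident C s"
    using assms unfolding is_biproduct_def by auto
  have obj: "x \<in> Obj C" "y \<in> Obj C" "s \<in> Obj C" using s by auto
  obtain z g h where t: "dist_triangle C x s z i g h" using TR1_cone[of i x s] s by auto
  note td = triangleD[OF t]
  have gi: "g \<cdot> i = Zero C x z" using triangle_Comp_zero[OF t] .
  obtain r where r: "r \<in> Arr C" "Dom C r = z" "Cod C r = y" "r \<cdot> g = q"
    using triangle_extend[OF t, of q y] s e by auto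
  have 1: "r \<cdot> (g \<cdot> j) = Ident C y"
    using Comp_reassoc[OF r(4), of j] r td s e by simp
  have "g = g \<cdot> ((i \<cdot> p) \<oplus>\<^sub>h (j \<cdot> q))" using e td by simp
  also have "\<dots> = (g \<cdot> (i \<cdot> p)) \<oplus>\<^sub>h (g \<cdot> (j \<cdot> q))" using s td by simp
  also have "\<dots> = g \<cdot> (j \<cdot> q)" using s td obj by (simp add: Comp_reassoc[OF gi])
  finally have 2: "g \<cdot> (j \<cdot> q) = g" by simp
  \<comment> \<open>Equality after composing with \<open>g\<close> gives only a factorization of the
    difference over \<open>h\<close>; but \<open>h\<close> is zero because \<open>i\<close>
    splits.\<close>
  have "(g \<cdot> (j \<cdot> r) \<oplus>\<^sub>h neg C (Ident C z)) \<cdot> g = Zero C s z"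
    using s td r 2 by simp
  with triangle_extend[OF rotate[OF t], of "g \<cdot> (j \<cdot> r) \<oplus>\<^sub>h neg C (Ident C z)" z]
  obtain v where v: "v \<in> Arr C" "Dom C v = Shift C x" "Cod C v = z"
    "v \<cdot> h = g \<cdot> (j \<cdot> r) \<oplus>\<^sub>h neg C (Ident C z)" using s td r by auto
  have "v \<cdot> h = Zero C z z" using split_mono_triangle[OF t, of p] s e v td by simp
  then have d: "g \<cdot> (j \<cdot> r) \<oplus>\<^sub>h neg C (Ident C z) = Zero C z z" using v(4) by simp
  have 3: "g \<cdot> (j \<cdot> r) = Ident C z"
    by (rule diff_zero_imp_eq) (use d s td(1-9,12) r(1-3) in simp_all)
  have "is_iso C r" by (rule is_isoI[of _ z y "g \<cdot> j"]) (use r td s 1 3 in auto)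
  then show ?thesis using that[OF t] r isomorphicI[of r z y] by simp
qed

section \<open>Triangulated subcategories and triangulated hulls\<close>

lemma triangulated_subcategoryD:
  assumes "triangulated_subcategory C S"
  shows "S \<subseteq> Obj C" "is_zero_object C z \<Longrightarrow> z \<in> S" "isomorphic C x y \<Longrightarrow> x \<in> S \<Longrightarrow> y \<in> S"
    "x \<in> Obj C \<Longrightarrow> Shift C x \<in> S \<longleftrightarrow> x \<in> S"
    "dist_triangle C x y z f g h \<Longrightarrow> x \<in> S \<Longrightarrow> y \<in> S \<Longrightarrow> z \<in> S"
  using assms unfolding triangulated_subcategory_def by blast+

lemma triangulated_subcategory_first:
  assumes "triangulated_subcategory C S" "dist_triangle C x y z f g h" "y \<in> S" "z \<in> S"
  shows "x \<in> S"
  using triangulated_subcategoryD(4)[OF assms(1)] triangulated_subcategoryD(5)[OF assms(1) rotate]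
    assms triangleD(10) by blast

lemma triangulated_subcategory_middle:
  assumes "triangulated_subcategory C S" "dist_triangle C x y z f g h" "x \<in> S" "z \<in> S"
  shows "y \<in> S"
  using triangulated_subcategoryD(4)[OF assms(1)] triangulated_subcategory_first[OF assms(1) rotate]
    assms triangleD(10) by blast

text \<open>Both parts are two-out-of-three for the split triangle. The second one is weaker than
  closure under summands, since \<open>x\<close> is already known to lie in \<open>S\<close>; it is
  the form that the swindle uses.\<close>

lemma triangulated_subcategory_biproduct:
  assumes "triangulated_subcategory C S" "is_biproduct C x y s"
  shows "x \<in> S \<Longrightarrow> y \<in> S \<Longrightarrow> s \<in> S" and "x \<in> S \<Longrightarrow> s \<in> S \<Longrightarrow> y \<in> S"
proof -
  obtain i z g h where t: "dist_triangle C x s z i g h" "isomorphic C z y"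
    by (rule biproduct_triangle[OF assms(2)])
  show "s \<in> S" if "x \<in> S" "y \<in> S"
    by (rule triangulated_subcategory_middle[OF assms(1) t(1) that(1)
          triangulated_subcategoryD(3)[OF assms(1) isomorphic_sym[OF t(2)] that(2)]])
  show "y \<in> S" if "x \<in> S" "s \<in> S"
    by (rule triangulated_subcategoryD(3)[OF assms(1) t(2)
          triangulated_subcategoryD(5)[OF assms(1) t(1) that]])
qed

lemma triangulated_subcategory_Obj: "triangulated_subcategory C (Obj C)"
  unfolding triangulated_subcategory_def
  using isomorphic_Obj triangleD(12) by (auto simp: zero_object_iff)

lemma triangulated_subcategory_Inter:
  assumes "\<S> \<noteq> {}" "\<And>S. S \<in> \<S> \<Longrightarrow> triangulated_subcategory C S"
  shows "triangulated_subcategory C (\<Inter>\<S>)"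
proof -
  note D = triangulated_subcategoryD[OF assms(2)]
  show ?thesis
    unfolding triangulated_subcategory_def
  proof (intro conjI allI impI ballI)
    show "\<Inter>\<S> \<subseteq> Obj C" using D(1) assms(1) by blast
    show "Shift C x \<in> \<Inter>\<S> \<longleftrightarrow> x \<in> \<Inter>\<S>" if "x \<in> Obj C" for x using D(4) that by simp
  qed (use D(2,3,5) in blast)+
qed

text \<open>Closure under summands is left out on purpose and added back in one stroke, by passing
  to retracts of objects of the hull.\<close>

definition triangulated_hull :: "'o set \<Rightarrow> 'o set" where
  "triangulated_hull \<G> = \<Inter>{S. triangulated_subcategory C S \<and> \<G> \<subseteq> S}"

lemma triangulated_hull_triangulated:
  "\<G> \<subseteq> Obj C \<Longrightarrow> triangulated_subcategory C (triangulated_hull \<G>)"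
  unfolding triangulated_hull_def
  by (rule triangulated_subcategory_Inter) (use triangulated_subcategory_Obj in blast)+

lemma triangulated_hull_superset: "\<G> \<subseteq> triangulated_hull \<G>"
  unfolding triangulated_hull_def by blast

lemma triangulated_hull_subset:
  "triangulated_subcategory C S \<Longrightarrow> \<G> \<subseteq> S \<Longrightarrow> triangulated_hull \<G> \<subseteq> S"
  unfolding triangulated_hull_def by blast

lemma triangulated_hull_mono: "\<G> \<subseteq> \<H> \<Longrightarrow> triangulated_hull \<G> \<subseteq> triangulated_hull \<H>"
  unfolding triangulated_hull_def by blast

text \<open>Only the cone condition involves two given objects, and directedness puts them into one
  \<open>X H\<close>. It serves both for hulls and for compatible families of primes.\<close>

lemma triangulated_subcategory_directed_Union:
  assumes dir: "directed_by_inclusion \<H>"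
    and X: "\<And>H. H \<in> \<H> \<Longrightarrow> triangulated_subcategory C (X H)"
    and mono: "\<And>H H'. H \<in> \<H> \<Longrightarrow> H' \<in> \<H> \<Longrightarrow> H \<subseteq> H' \<Longrightarrow> X H \<subseteq> X H'"
  shows "triangulated_subcategory C (\<Union>H\<in>\<H>. X H)"
  unfolding triangulated_subcategory_def
proof (intro conjI allI impI ballI; (elim conjE)?)
  let ?U = "\<Union>H\<in>\<H>. X H"
  have ne: "\<exists>H. H \<in> \<H>" using dir unfolding directed_by_inclusion_def by auto
  show "?U \<subseteq> Obj C" using triangulated_subcategoryD(1)[OF X] by blast
  show "z \<in> ?U" if "is_zero_object C z" for z using triangulated_subcategoryD(2)[OF X that] ne by blast
  show "y \<in> ?U" if "x \<in> ?U" "isomorphic C x y" for x y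
    using triangulated_subcategoryD(3)[OF X that(2)] that(1) by blast
  show "Shift C x \<in> ?U \<longleftrightarrow> x \<in> ?U" if "x \<in> Obj C" for x
    using triangulated_subcategoryD(4)[OF X that] by blast
  show "z \<in> ?U" if t: "dist_triangle C x y z f g h" and x: "x \<in> ?U" and y: "y \<in> ?U" for x y z f g h
  proof -
    obtain H H' where H: "H \<in> \<H>" "x \<in> X H" "H' \<in> \<H>" "y \<in> X H'" using x y by blast
    obtain H'' where H'': "H'' \<in> \<H>" "H \<subseteq> H''" "H' \<subseteq> H''"
      using dir H(1,3) unfolding directed_by_inclusion_def by blast
    then have "x \<in> X H''" "y \<in> X H''" using mono[OF H(1)] mono[OF H(3)] H(2,4) by blast+
    then show ?thesis using triangulated_subcategoryD(5)[OF X[OF H''(1)] t] H''(1) by blast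
  qed
qed

lemma factors_through_Shift:
  assumes "factors_through f t"
  shows "factors_through (Shift_arr C f) (Shift C t)"
proof -
  obtain a b where ab: "a \<in> Arr C" "Dom C a = Dom C f" "Cod C a = t" "b \<in> Arr C" "Dom C b = t"
    "Cod C b = Cod C f" and f: "f = b \<cdot> a" using assms(1) by (rule factors_throughE) (rule that)
  have "Shift_arr C f = Shift_arr C b \<cdot> Shift_arr C a" unfolding f using ab by simp
  then show ?thesis
    using ab factors_throughI[of "Shift_arr C a" "Shift C (Dom C f)" "Shift C t" "Shift_arr C b"
        "Shift C (Cod C f)"] by simp
qed

lemma factors_through_Add_closed:
  assumes X: "triangulated_subcategory C X" and "t \<in> X" "u \<in> X" "factors_through f t" "factors_through g u"
    and "f \<in> Hom C x y" "g \<in> Hom C x y"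
  shows "\<exists>s\<in>X. factors_through (f \<oplus>\<^sub>h g) s"
proof -
  obtain s where s: "is_biproduct C t u s"
    using biproduct_exists[of t u] assms(2,3) triangulated_subcategoryD(1)[OF X] by blast
  then show ?thesis
    using factors_through_Add[OF assms(4-7) s] triangulated_subcategory_biproduct(1)[OF X s assms(2,3)]
    by blast
qed

end

section \<open>Coproducts and compactness\<close>

context additive_category
begin

text \<open>The image of the canonical map from the direct sum of the groups
  \<open>Hom(c, x k)\<close>, built one term at a time. Indices may repeat, so no supports have to
  be tracked.\<close>

inductive finite_sum :: "'i set \<Rightarrow> ('i \<Rightarrow> 'o) \<Rightarrow> ('i \<Rightarrow> 'm) \<Rightarrow> 'o \<Rightarrow> 'o \<Rightarrow> 'm \<Rightarrow> bool"
  for I x \<iota> c s where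
  zero: "finite_sum I x \<iota> c s (Zero C c s)"
| add: "finite_sum I x \<iota> c s f \<Longrightarrow> k \<in> I \<Longrightarrow> \<phi> \<in> Hom C c (x k) \<Longrightarrow>
    finite_sum I x \<iota> c s (f \<oplus>\<^sub>h (\<iota> k \<cdot> \<phi>))"

lemma finite_sum_Hom:
  assumes "is_coproduct C I x s \<iota>" "c \<in> Obj C" "finite_sum I x \<iota> c s f"
  shows "f \<in> Arr C" "Dom C f = c" "Cod C f = s"
proof -
  note cp = coproductD[OF assms(1)]
  have "f \<in> Hom C c s"
    using assms(3)
  proof induction
    case zero then show ?case using cp(1) assms(2) by simp
  next
    case (add f k \<phi>) then show ?case using cp(2-4)[of k] by simp
  qed
  then show "f \<in> Arr C" "Dom C f = c" "Cod C f = s" by auto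
qed

lemma finite_sum_single:
  assumes "is_coproduct C I x s \<iota>" "k \<in> I" "\<phi> \<in> Hom C c (x k)"
  shows "finite_sum I x \<iota> c s (\<iota> k \<cdot> \<phi>)"
proof -
  have "Zero C c s \<oplus>\<^sub>h (\<iota> k \<cdot> \<phi>) = \<iota> k \<cdot> \<phi>"
    using coproductD[OF assms(1)] assms by simp
  then show ?thesis using finite_sum.add[of I x \<iota> c s "Zero C c s" k \<phi>, OF finite_sum.zero assms(2,3)] by simp
qed

lemma finite_sum_Add:
  assumes "is_coproduct C I x s \<iota>" "c \<in> Obj C" "finite_sum I x \<iota> c s f" "finite_sum I x \<iota> c s g"
  shows "finite_sum I x \<iota> c s (f \<oplus>\<^sub>h g)"
  using assms(4)
proof induction
  case zero then show ?case using assms finite_sum_Hom[OF assms(1-3)] by simp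
next
  case (add g k \<phi>)
  have "f \<oplus>\<^sub>h (g \<oplus>\<^sub>h (\<iota> k \<cdot> \<phi>)) = (f \<oplus>\<^sub>h g) \<oplus>\<^sub>h (\<iota> k \<cdot> \<phi>)"
    using finite_sum_Hom[OF assms(1-3)] finite_sum_Hom[OF assms(1,2) add(1)]
      coproductD(2-4)[OF assms(1) add(2)] add(3) by (subst Add_assoc) auto
  then show ?case using finite_sum.add[of I x \<iota> c s "f \<oplus>\<^sub>h g" k \<phi>, OF add(4,2,3)] by simp
qed

lemma finite_sum_Comp:
  assumes "is_coproduct C I x s \<iota>" "c \<in> Obj C" "finite_sum I x \<iota> c s f" "u \<in> Hom C b c"
  shows "finite_sum I x \<iota> b s (f \<cdot> u)"
  using assms(3)
proof induction
  case zero
  have "Zero C c s \<cdot> u = Zero C b s" using assms(4) coproductD(1)[OF assms(1)] by auto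
  then show ?case using finite_sum.zero by simp
next
  case (add f k \<phi>)
  have "(f \<oplus>\<^sub>h (\<iota> k \<cdot> \<phi>)) \<cdot> u = (f \<cdot> u) \<oplus>\<^sub>h (\<iota> k \<cdot> (\<phi> \<cdot> u))"
    using finite_sum_Hom[OF assms(1,2) add(1)] coproductD(2-4)[OF assms(1) add(2)] add(3) assms(4)
    by simp
  then show ?case using finite_sum.add[of I x \<iota> b s "f \<cdot> u" k "\<phi> \<cdot> u", OF add(4,2)] add(3) assms(4) by simp
qed

lemma coproduct_truncation:
  assumes "is_coproduct C I x s \<iota>"
  obtains e where "e \<in> Arr C" "Dom C e = s" "Cod C e = s"
    "\<And>k. k \<in> I \<Longrightarrow> e \<cdot> \<iota> k = (if k \<in> J then \<iota> k else Zero C (x k) s)"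
proof -
  note cp = coproductD[OF assms(1)]
  show ?thesis
    by (rule coproduct_map[OF assms cp(1), of "\<lambda>k. if k \<in> J then \<iota> k else Zero C (x k) s"])
      (use cp that in auto)
qed

lemma coproduct_projection:
  assumes "is_coproduct C I x s \<iota>" "j \<in> I"
  obtains \<pi> where "\<pi> \<in> Arr C" "Dom C \<pi> = s" "Cod C \<pi> = x j"
    "\<pi> \<cdot> \<iota> j = Ident C (x j)" "\<And>k. k \<in> I \<Longrightarrow> k \<noteq> j \<Longrightarrow> \<pi> \<cdot> \<iota> k = Zero C (x k) (x j)"
proof -
  note cp = coproductD[OF assms(1)]
  show ?thesis
    by (rule coproduct_map[OF assms(1) cp(5)[OF assms(2)],
          of "\<lambda>k. if k = j then Ident C (x k) else Zero C (x k) (x j)"])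
      (use cp that assms(2) in auto)
qed

text \<open>For finite \<open>J\<close> the truncation is the sum of the endomorphisms
  \<open>\<iota> j \<cdot> \<pi>\<close> over \<open>j \<in> J\<close>, with \<open>\<pi>\<close>
  the projection to \<open>x j\<close>.\<close>

lemma finite_sum_truncation:
  assumes cp: "is_coproduct C I x s \<iota>" and "finite J" "J \<subseteq> I" "e \<in> Hom C s s"
    and "\<And>k. k \<in> I \<Longrightarrow> e \<cdot> \<iota> k = (if k \<in> J then \<iota> k else Zero C (x k) s)"
  shows "finite_sum I x \<iota> s s e"
  using assms(2-)
proof (induction J arbitrary: e)
  case empty
  have "e = Zero C s s"
    by (rule coproduct_ext[OF cp]) (use empty coproductD[OF cp] in auto)
  then show ?case using finite_sum.zero by simp
next
  case (insert j J)
  obtain d where d: "d \<in> Arr C" "Dom C d = s" "Cod C d = s"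
    "\<And>k. k \<in> I \<Longrightarrow> d \<cdot> \<iota> k = (if k \<in> J then \<iota> k else Zero C (x k) s)"
    by (rule coproduct_truncation[OF cp, of J]) (rule that)
  have j: "j \<in> I" using insert by blast
  obtain \<pi> where \<pi>: "\<pi> \<in> Arr C" "Dom C \<pi> = s" "Cod C \<pi> = x j"
    "\<pi> \<cdot> \<iota> j = Ident C (x j)" "\<And>k. k \<in> I \<Longrightarrow> k \<noteq> j \<Longrightarrow> \<pi> \<cdot> \<iota> k = Zero C (x k) (x j)"
    by (rule coproduct_projection[OF cp j]) (rule that)
  note D = coproductD[OF cp]
  \<comment> \<open>\<open>d\<close> vanishes on the new index \<open>j\<close>, since
    \<open>j \<notin> J\<close>, and the added term is supported exactly there.\<close>
  have "e = d \<oplus>\<^sub>h (\<iota> j \<cdot> \<pi>)"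
  proof (rule coproduct_ext[OF cp])
    fix k assume k: "k \<in> I"
    show "e \<cdot> \<iota> k = (d \<oplus>\<^sub>h (\<iota> j \<cdot> \<pi>)) \<cdot> \<iota> k"
      using insert.prems(2) k j insert.hyps(2) d \<pi> D(1) D(2-5)[OF k] D(2-5)[OF j]
        insert.prems(3)[OF k] by (cases "k = j") auto
  qed (use insert.prems d \<pi> D(1) D(2-5)[OF j] in auto)
  moreover have "finite_sum I x \<iota> s s d"
    by (rule insert.IH) (use insert.prems d in auto)
  ultimately show ?case using finite_sum.add[of I x \<iota> s s d j \<pi>] j \<pi> by simp
qed

text \<open>This replaces the statement that \<open>f\<close> lands in a finite part of the
  coproduct. The point is that \<open>e\<close> is itself a finite sum, so
  \<open>e \<cdot> k\<close> is one for every \<open>k\<close> into \<open>s\<close>; the closure of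
  compact objects under cones rests on it.\<close>

lemma finite_sum_fixed:
  assumes cp: "is_coproduct C I x s \<iota>" and c: "c \<in> Obj C" and "finite_sum I x \<iota> c s f"
  obtains e where "e \<in> Arr C" "Dom C e = s" "Cod C e = s" "finite_sum I x \<iota> s s e" "e \<cdot> f = f"
proof -
  note D = coproductD[OF cp]
  \<comment> \<open>The claim covers every \<open>e\<close> that truncates to \<open>J\<close>,
    because the induction step applies it to the truncation \<open>d\<close> for the smaller index
    set.\<close>
  have "\<exists>J. finite J \<and> J \<subseteq> I \<and> (\<forall>e \<in> Hom C s s.
      (\<forall>k\<in>I. e \<cdot> \<iota> k = (if k \<in> J then \<iota> k else Zero C (x k) s)) \<longrightarrow> e \<cdot> f = f)"
    using assms(3)
  proof induction
    case zero then show ?case using c D(1) by (intro exI[of _ "{}"]) auto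
  next
    case (add f k \<phi>)
    then obtain J where J: "finite J" "J \<subseteq> I" and fix_f: "\<And>e. e \<in> Hom C s s \<Longrightarrow>
        \<forall>k\<in>I. e \<cdot> \<iota> k = (if k \<in> J then \<iota> k else Zero C (x k) s) \<Longrightarrow> e \<cdot> f = f" by metis
    obtain d where d: "d \<in> Arr C" "Dom C d = s" "Cod C d = s"
      "\<And>k. k \<in> I \<Longrightarrow> d \<cdot> \<iota> k = (if k \<in> J then \<iota> k else Zero C (x k) s)"
      by (rule coproduct_truncation[OF cp, of J]) (rule that)
    have df: "d \<cdot> f = f" using fix_f d by simp
    note f = finite_sum_Hom[OF cp c add(1)]
    have "e \<cdot> (f \<oplus>\<^sub>h (\<iota> k \<cdot> \<phi>)) = f \<oplus>\<^sub>h (\<iota> k \<cdot> \<phi>)"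
      if e: "e \<in> Hom C s s"
        and e': "\<forall>l\<in>I. e \<cdot> \<iota> l = (if l \<in> insert k J then \<iota> l else Zero C (x l) s)" for e
    proof -
      have ea: "e \<in> Arr C" "Dom C e = s" "Cod C e = s" using e by auto
      \<comment> \<open>Truncating to \<open>J\<close> and then to the larger set changes nothing,
        so \<open>e\<close> fixes \<open>f = d \<cdot> f\<close>.\<close>
      have "e \<cdot> d = d"
      proof (rule coproduct_ext[OF cp])
        fix l assume l: "l \<in> I"
        show "(e \<cdot> d) \<cdot> \<iota> l = d \<cdot> \<iota> l"
          using d(1-3) d(4)[OF l] ea D(1) D(2-5)[OF l] e' l by auto
      qed (use d ea in auto)
      then have "e \<cdot> f = f" using Comp_reassoc[of e d d f] df ea d f by simp
      moreover have "e \<cdot> (\<iota> k \<cdot> \<phi>) = \<iota> k \<cdot> \<phi>"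
        using Comp_reassoc[of e "\<iota> k" "\<iota> k" \<phi>] e' ea D(2-4)[OF add(2)] add(2,3) by simp
      ultimately show ?thesis using ea f D(2-4)[OF add(2)] add(3) by simp
    qed
    then show ?case using J add(2) by (intro exI[of _ "insert k J"]) blast
  qed
  then obtain J where J: "finite J" "J \<subseteq> I" and fix_f: "\<And>e. e \<in> Hom C s s \<Longrightarrow>
      \<forall>k\<in>I. e \<cdot> \<iota> k = (if k \<in> J then \<iota> k else Zero C (x k) s) \<Longrightarrow> e \<cdot> f = f" by metis
  obtain e where e: "e \<in> Arr C" "Dom C e = s" "Cod C e = s"
    "\<And>k. k \<in> I \<Longrightarrow> e \<cdot> \<iota> k = (if k \<in> J then \<iota> k else Zero C (x k) s)"
    by (rule coproduct_truncation[OF cp, of J]) (rule that)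
  show ?thesis
    by (rule that[OF e(1-3)]) (use finite_sum_truncation[OF cp J, of e] fix_f[of e] e in auto)
qed

lemma finite_sum_finprod:
  assumes cp: "is_coproduct C I x s \<iota>" and c: "c \<in> Obj C" and "finite J" "J \<subseteq> I"
    and \<phi>: "\<And>k. k \<in> I \<Longrightarrow> \<phi> k \<in> Hom C c (x k)"
  shows "finite_sum I x \<iota> c s (finprod (hom_group C c s) (\<lambda>k. \<iota> k \<cdot> \<phi> k) J)"
  using assms(3,4)
proof (induction J)
  case empty
  interpret comm_group "hom_group C c s" using hom_comm_group c coproductD(1)[OF cp] .
  show ?case using finite_sum.zero by simp
next
  case (insert j J)
  interpret comm_group "hom_group C c s" using hom_comm_group c coproductD(1)[OF cp] .
  let ?g = "\<lambda>k. \<iota> k \<cdot> \<phi> k"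
  have g: "?g k \<in> Hom C c s" if "k \<in> I" for k using that coproductD(2-4)[OF cp that] \<phi>[OF that] by simp
  then have "finprod (hom_group C c s) ?g (insert j J) =
      ?g j \<oplus>\<^sub>h finprod (hom_group C c s) ?g J"
    using insert by (subst finprod_insert) auto
  then show ?case
    using finite_sum_Add[OF cp c finite_sum_single[OF cp _ \<phi>] insert.IH] insert.prems by simp
qed

lemma projection_finprod:
  assumes cp: "is_coproduct C I x s \<iota>" and c: "c \<in> Obj C" and "finite J" "J \<subseteq> I"
    and \<phi>: "\<And>k. k \<in> I \<Longrightarrow> \<phi> k \<in> Hom C c (x k)"
    and \<pi>: "\<pi> \<in> Hom C s (x j)" "\<pi> \<cdot> \<iota> j = Ident C (x j)"
      "\<And>k. k \<in> I \<Longrightarrow> k \<noteq> j \<Longrightarrow> \<pi> \<cdot> \<iota> k = Zero C (x k) (x j)"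
  shows "\<pi> \<cdot> finprod (hom_group C c s) (\<lambda>k. \<iota> k \<cdot> \<phi> k) J = (if j \<in> J then \<phi> j else Zero C c (x j))"
  using assms(3,4)
proof (induction J)
  case empty
  interpret comm_group "hom_group C c s" using hom_comm_group c coproductD(1)[OF cp] .
  show ?case using \<pi>(1) c by simp
next
  case (insert l J)
  interpret comm_group "hom_group C c s" using hom_comm_group c coproductD(1)[OF cp] .
  let ?g = "\<lambda>k. \<iota> k \<cdot> \<phi> k"
  let ?S = "finprod (hom_group C c s) ?g"
  have \<pi>': "\<pi> \<in> Arr C" "Dom C \<pi> = s" "Cod C \<pi> = x j" "x j \<in> Obj C"
    using \<pi>(1) Hom_Obj[OF \<pi>(1)] by auto
  have l: "l \<in> I" using insert by blast
  note ls = coproductD(2-5)[OF cp l]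
  have \<phi>l: "\<phi> l \<in> Arr C" "Dom C (\<phi> l) = c" "Cod C (\<phi> l) = x l" using \<phi>[OF l] by auto
  have g: "?g k \<in> Hom C c s" if "k \<in> I" for k using that coproductD(2-4)[OF cp that] \<phi>[OF that] by simp
  have e: "?S (insert l J) = ?g l \<oplus>\<^sub>h ?S J" using insert g by (subst finprod_insert) auto
  have S: "?S J \<in> Arr C" "Dom C (?S J) = c" "Cod C (?S J) = s"
    using finite_sum_Hom[OF cp c finite_sum_finprod[OF cp c _ _ \<phi>]] insert by auto
  have IH: "\<pi> \<cdot> ?S J = (if j \<in> J then \<phi> j else Zero C c (x j))" using insert by simp
  have 1: "\<pi> \<cdot> ?S (insert l J) = (\<pi> \<cdot> \<iota> l) \<cdot> \<phi> l \<oplus>\<^sub>h \<pi> \<cdot> ?S J"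
    unfolding e using \<pi>' ls \<phi>l S by simp
  show ?case
  proof (cases "l = j")
    case True
    then show ?thesis unfolding 1 IH using insert.hyps \<pi>(2) \<phi>l c \<pi>' by auto
  next
    case False
    have "(\<pi> \<cdot> \<iota> l) \<cdot> \<phi> l = Zero C c (x j)" using \<pi>(3)[OF l False] \<phi>l \<pi>' ls by simp
    moreover have "j \<in> J \<Longrightarrow> \<phi> j \<in> Arr C \<and> Dom C (\<phi> j) = c \<and> Cod C (\<phi> j) = x j"
      using \<phi>[of j] insert.prems by auto
    ultimately show ?thesis unfolding 1 IH using False c \<pi>' by auto
  qed
qed

text \<open>Injectivity always holds, because coproduct projections recover the coordinates of a
  family. Bijectivity therefore reduces to surjectivity, which is the right-hand side.\<close>

lemma bij_finprod_iff_finite_sum: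
  assumes cp: "is_coproduct C I x s \<iota>" and c: "c \<in> Obj C"
  shows "bij_betw
      (\<lambda>\<phi>. finprod (hom_group C c s) (\<lambda>k. \<iota> k \<cdot> \<phi> k) {k \<in> I. \<phi> k \<noteq> Zero C c (x k)})
      {\<phi> \<in> \<Pi>\<^sub>E k\<in>I. Hom C c (x k). finite {k \<in> I. \<phi> k \<noteq> Zero C c (x k)}}
      (Hom C c s) \<longleftrightarrow> (\<forall>f \<in> Hom C c s. finite_sum I x \<iota> c s f)" (is "bij_betw ?F ?D _ \<longleftrightarrow> _")
proof -
  note D = coproductD[OF cp]
  interpret comm_group "hom_group C c s" using hom_comm_group c D(1) .
  let ?S = "finprod (hom_group C c s)"
  have F: "finite_sum I x \<iota> c s (?F \<phi>)" if "\<phi> \<in> ?D" for \<phi>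
    using that by (intro finite_sum_finprod[OF cp c]) (auto simp: PiE_iff)
  have inj: "inj_on ?F ?D"
  proof (rule inj_onI)
    fix \<phi> \<psi> assume \<phi>: "\<phi> \<in> ?D" and \<psi>: "\<psi> \<in> ?D" and eq: "?F \<phi> = ?F \<psi>"
    have *: "\<pi> \<cdot> ?F \<phi> = \<phi> j"
      if "\<phi> \<in> ?D" "j \<in> I" and \<pi>: "\<pi> \<in> Hom C s (x j)" "\<pi> \<cdot> \<iota> j = Ident C (x j)"
        "\<And>k. k \<in> I \<Longrightarrow> k \<noteq> j \<Longrightarrow> \<pi> \<cdot> \<iota> k = Zero C (x k) (x j)" for \<phi> \<pi> j
      by (subst projection_finprod[OF cp c _ _ _ \<pi>]) (use that(1,2) in \<open>auto simp: PiE_iff\<close>)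
    have "\<phi> j = \<psi> j" if j: "j \<in> I" for j
    proof -
      obtain \<pi> where \<pi>: "\<pi> \<in> Arr C" "Dom C \<pi> = s" "Cod C \<pi> = x j"
        "\<pi> \<cdot> \<iota> j = Ident C (x j)" "\<And>k. k \<in> I \<Longrightarrow> k \<noteq> j \<Longrightarrow> \<pi> \<cdot> \<iota> k = Zero C (x k) (x j)"
        by (rule coproduct_projection[OF cp j]) (rule that)
      then have p: "\<pi> \<in> Hom C s (x j)" by simp
      have "\<phi> j = \<pi> \<cdot> ?F \<phi>" by (rule *[OF \<phi> j p \<pi>(4,5), symmetric])
      also have "\<dots> = \<pi> \<cdot> ?F \<psi>" by (rule arg_cong[OF eq])
      also have "\<dots> = \<psi> j" by (rule *[OF \<psi> j p \<pi>(4,5)])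
      finally show ?thesis .
    qed
    then show "\<phi> = \<psi>" using \<phi> \<psi> by (intro PiE_ext[of \<phi> I "\<lambda>k. Hom C c (x k)" \<psi>]) auto
  qed
  have surj: "f \<in> ?F ` ?D" if "finite_sum I x \<iota> c s f" for f
    using that
  proof induction
    case zero
    let ?z = "\<lambda>k\<in>I. Zero C c (x k)"
    have "?z \<in> ?D" using D(5) c by auto
    moreover have "?F ?z = Zero C c s"
    proof -
      have e: "{k \<in> I. ?z k \<noteq> Zero C c (x k)} = {}" by auto
      show ?thesis unfolding e by simp
    qed
    ultimately show ?case by (intro image_eqI[of _ _ ?z]) simp_all
  next
    case (add f k \<psi>)
    then obtain \<phi> where \<phi>: "\<phi> \<in> ?D" "f = ?F \<phi>" by blast
    have \<phi>h: "\<phi> l \<in> Arr C" "Dom C (\<phi> l) = c" "Cod C (\<phi> l) = x l" if "l \<in> I" for l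
      using \<phi>(1) that by (auto simp: PiE_iff)
    have \<psi>: "\<psi> \<in> Arr C" "Dom C \<psi> = c" "Cod C \<psi> = x k" using add by auto
    define \<phi>' where "\<phi>' = \<phi>(k := \<phi> k \<oplus>\<^sub>h \<psi>)"
    \<comment> \<open>Adding \<open>\<psi>\<close> can create or cancel the coordinate at
      \<open>k\<close>. Both products are therefore taken over the old support enlarged by
      \<open>k\<close>, where the extra factors are neutral.\<close>
    let ?J = "insert k {l \<in> I. \<phi> l \<noteq> Zero C c (x l)}"
    let ?A = "{l \<in> I. \<phi> l \<noteq> Zero C c (x l)} - {k}"
    have fin: "finite ?J" using \<phi>(1) by simp
    have \<phi>'h: "\<phi>' l \<in> Arr C" "Dom C (\<phi>' l) = c" "Cod C (\<phi>' l) = x l" if "l \<in> I" for l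
      using that \<phi>h[OF that] \<psi> by (auto simp: \<phi>'_def)
    have supp': "{l \<in> I. \<phi>' l \<noteq> Zero C c (x l)} \<subseteq> ?J" by (auto simp: \<phi>'_def)
    have "\<phi>' \<in> ?D"
      using \<phi>'h finite_subset[OF supp' fin] \<phi>(1) add(2) by (auto simp: PiE_iff \<phi>'_def extensional_def)
    moreover have "?F \<phi>' = f \<oplus>\<^sub>h (\<iota> k \<cdot> \<psi>)"
    proof -
      have J: "?J = insert k ?A" by blast
      have gh: "\<iota> l \<cdot> \<phi> l \<in> Hom C c s" "\<iota> l \<cdot> \<phi>' l \<in> Hom C c s" if "l \<in> I" for l
        using that D(2-4)[OF that] \<phi>h[OF that] \<phi>'h[OF that] by auto
      have "?F \<phi>' = ?S (\<lambda>l. \<iota> l \<cdot> \<phi>' l) ?J"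
        by (rule finprod_mono_neutral_cong_left[OF fin supp'])
          (use gh add(2) D(2-4) c in auto)
      also have "\<dots> = (\<iota> k \<cdot> \<phi>' k) \<oplus>\<^sub>h ?S (\<lambda>l. \<iota> l \<cdot> \<phi>' l) ?A"
        unfolding J using fin gh add(2) by (subst finprod_insert) auto
      also have "?S (\<lambda>l. \<iota> l \<cdot> \<phi>' l) ?A = ?S (\<lambda>l. \<iota> l \<cdot> \<phi> l) ?A"
        by (rule finprod_cong') (use gh in \<open>auto simp: \<phi>'_def\<close>)
      finally have 1: "?F \<phi>' = (\<iota> k \<cdot> \<phi>' k) \<oplus>\<^sub>h ?S (\<lambda>l. \<iota> l \<cdot> \<phi> l) ?A" .
      have "f = ?S (\<lambda>l. \<iota> l \<cdot> \<phi> l) ?J"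
        unfolding \<phi>(2)
        by (rule finprod_mono_neutral_cong_left[OF fin])
          (use gh add(2) D(2-4) c in auto)
      also have "\<dots> = (\<iota> k \<cdot> \<phi> k) \<oplus>\<^sub>h ?S (\<lambda>l. \<iota> l \<cdot> \<phi> l) ?A"
        unfolding J using fin gh add(2) by (subst finprod_insert) auto
      finally have 2: "f = (\<iota> k \<cdot> \<phi> k) \<oplus>\<^sub>h ?S (\<lambda>l. \<iota> l \<cdot> \<phi> l) ?A" .
      have A: "?S (\<lambda>l. \<iota> l \<cdot> \<phi> l) ?A \<in> Hom C c s"
        using finprod_closed[of "\<lambda>l. \<iota> l \<cdot> \<phi> l" ?A] gh by auto
      note k = D(2-4)[OF add(2)] \<phi>h[OF add(2)] \<psi>
      have "\<iota> k \<cdot> \<phi>' k = (\<iota> k \<cdot> \<phi> k) \<oplus>\<^sub>h (\<iota> k \<cdot> \<psi>)"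
        using k by (simp add: \<phi>'_def)
      then show ?thesis
        unfolding 1 2 using k A by (simp add: Add_right_commute)
    qed
    ultimately show ?case by (intro image_eqI[of _ _ \<phi>']) simp_all
  qed
  have sub: "?F ` ?D \<subseteq> Hom C c s"
  proof (rule image_subsetI)
    fix \<phi> assume "\<phi> \<in> ?D"
    then show "?F \<phi> \<in> Hom C c s" using finite_sum_Hom[OF cp c F] unfolding in_Hom by blast
  qed
  show ?thesis
  proof
    assume "bij_betw ?F ?D (Hom C c s)"
    then have im: "?F ` ?D = Hom C c s" by (rule bij_betw_imp_surj_on)
    show "\<forall>f \<in> Hom C c s. finite_sum I x \<iota> c s f"
    proof
      fix f assume "f \<in> Hom C c s"
      then have "f \<in> ?F ` ?D" unfolding im .
      then obtain \<phi> where "\<phi> \<in> ?D" "f = ?F \<phi>" by (rule imageE)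
      then show "finite_sum I x \<iota> c s f" using F[of \<phi>] by simp
    qed
  next
    assume all: "\<forall>f \<in> Hom C c s. finite_sum I x \<iota> c s f"
    have "Hom C c s \<subseteq> ?F ` ?D" using surj all by (intro subsetI) (rule surj, blast)
    then show "bij_betw ?F ?D (Hom C c s)"
      using inj sub unfolding bij_betw_def by (intro conjI equalityI)
  qed
qed

end

section \<open>Objects compact relative to a subcategory\<close>

locale triangulated_category_with_coproducts = smallness small + triangulated_category C
  for small :: "'i set \<Rightarrow> bool" and C :: "('o, 'm, 'z) triangulated_category_scheme" (structure) +
  assumes coproduct_exists: "small I \<Longrightarrow> (\<And>k. k \<in> I \<Longrightarrow> x k \<in> Obj C) \<Longrightarrow>
    \<exists>s \<iota>. is_coproduct C I x s \<iota>"
begin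

text \<open>An equivalence preserves coproducts. As an inverse of the shift is available only object
  by object, each target \<open>z\<close> is replaced by some \<open>Shift C w\<close> isomorphic to
  it and the maps are desuspended.\<close>

lemma coproduct_Shift:
  assumes cp: "is_coproduct C I x s \<iota>"
  shows "is_coproduct C I (\<lambda>k. Shift C (x k)) (Shift C s) (\<lambda>k. Shift_arr C (\<iota> k))"
proof (rule is_coproductI)
  note D = coproductD[OF cp]
  show "Shift C s \<in> Obj C" using D(1) by simp
  show "Shift_arr C (\<iota> k) \<in> Hom C (Shift C (x k)) (Shift C s)" if "k \<in> I" for k
    using D(2-4)[OF that] by simp
  show "\<exists>g \<in> Hom C (Shift C s) z. \<forall>k\<in>I. g \<cdot> Shift_arr C (\<iota> k) = f k"
    if z: "z \<in> Obj C" and f: "\<And>k. k \<in> I \<Longrightarrow> f k \<in> Hom C (Shift C (x k)) z" for z f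
  proof -
    obtain w a b where w: "w \<in> Obj C" "a \<in> Arr C" "Dom C a = Shift C w" "Cod C a = z" "b \<in> Arr C"
      "Dom C b = z" "Cod C b = Shift C w" "b \<cdot> a = Ident C (Shift C w)" "a \<cdot> b = Ident C z"
      "is_iso C a" "is_iso C b" by (rule Shift_ess_surjE[OF z]) (rule that)
    have "\<exists>f'. f' \<in> Hom C (x k) w \<and> b \<cdot> f k = Shift_arr C f'" if k: "k \<in> I" for k
      by (rule Shift_arr_full[of "b \<cdot> f k" "x k" w]) (use w f[OF k] D(5)[OF k] in auto)
    then obtain f' where f': "\<And>k. k \<in> I \<Longrightarrow> f' k \<in> Hom C (x k) w"
      "\<And>k. k \<in> I \<Longrightarrow> b \<cdot> f k = Shift_arr C (f' k)" by metis
    obtain g where g: "g \<in> Arr C" "Dom C g = s" "Cod C g = w" "\<And>k. k \<in> I \<Longrightarrow> g \<cdot> \<iota> k = f' k"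
      by (rule coproduct_map[OF cp w(1) f'(1)]) (use that in auto)
    have "(a \<cdot> Shift_arr C g) \<cdot> Shift_arr C (\<iota> k) = f k" if k: "k \<in> I" for k
    proof -
      have "(a \<cdot> Shift_arr C g) \<cdot> Shift_arr C (\<iota> k) = a \<cdot> Shift_arr C (g \<cdot> \<iota> k)"
        using g(1-3) w(1-4) D(2-4)[OF k] by simp
      also have "\<dots> = a \<cdot> (b \<cdot> f k)" using g(4)[OF k] f'(2)[OF k] by simp
      also have "\<dots> = f k" using w f[OF k] by (simp add: Comp_reassoc[OF w(9)])
      finally show ?thesis .
    qed
    then show ?thesis using g w by (intro bexI[of _ "a \<cdot> Shift_arr C g"]) auto
  qed
  show "g = h"
    if g: "g \<in> Hom C (Shift C s) z" and h: "h \<in> Hom C (Shift C s) z"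
      and eq: "\<And>k. k \<in> I \<Longrightarrow> g \<cdot> Shift_arr C (\<iota> k) = h \<cdot> Shift_arr C (\<iota> k)" for z g h
  proof -
    have z: "z \<in> Obj C" using Hom_Obj[OF g] by blast
    obtain w a b where w: "w \<in> Obj C" "a \<in> Arr C" "Dom C a = Shift C w" "Cod C a = z" "b \<in> Arr C"
      "Dom C b = z" "Cod C b = Shift C w" "b \<cdot> a = Ident C (Shift C w)" "a \<cdot> b = Ident C z"
      "is_iso C a" "is_iso C b" by (rule Shift_ess_surjE[OF z]) (rule that)
    note gh = g[unfolded in_Hom] h[unfolded in_Hom]
    obtain g' where g': "g' \<in> Arr C" "Dom C g' = s" "Cod C g' = w" "b \<cdot> g = Shift_arr C g'"
      by (rule Shift_arr_full[of "b \<cdot> g" s w]) (use w gh D(1) in auto)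
    obtain h' where h': "h' \<in> Arr C" "Dom C h' = s" "Cod C h' = w" "b \<cdot> h = Shift_arr C h'"
      by (rule Shift_arr_full[of "b \<cdot> h" s w]) (use w gh D(1) in auto)
    have "g' = h'"
    proof (rule coproduct_ext[OF cp])
      fix k assume k: "k \<in> I"
      note i = D(2-4)[OF k]
      have "Shift_arr C (g' \<cdot> \<iota> k) = b \<cdot> (g \<cdot> Shift_arr C (\<iota> k))"
        using g'(1-3) g'(4)[symmetric] i w gh by simp
      also have "\<dots> = b \<cdot> (h \<cdot> Shift_arr C (\<iota> k))" using eq[OF k] by simp
      also have "\<dots> = Shift_arr C (h' \<cdot> \<iota> k)"
        using h'(1-3) h'(4)[symmetric] i w gh by simp
      finally show "g' \<cdot> \<iota> k = h' \<cdot> \<iota> k"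
        by (rule Shift_arr_inject[rotated -1]) (use g' h' i in auto)
    qed (use g' h' in auto)
    then have "b \<cdot> g = b \<cdot> h" using g'(4) h'(4) by simp
    then show "g = h" by (rule iso_cancel_left[OF w(11), rotated -1]) (use gh w in auto)
  qed
qed

text \<open>Only coproducts of objects of \<open>L\<close> are tested, but they are coproducts of
  the ambient category. For localizing \<open>L\<close> this is compactness in the full subcategory
  on \<open>L\<close>; for \<open>L = Obj C\<close> it is ordinary compactness.\<close>

definition relatively_compact :: "'o set \<Rightarrow> 'o \<Rightarrow> bool" where
  "relatively_compact L c \<longleftrightarrow> c \<in> L \<and>
     (\<forall>I x s \<iota>. small I \<and> (\<forall>k\<in>I. x k \<in> L) \<and> is_coproduct C I x s \<iota> \<longrightarrow>
        (\<forall>f \<in> Hom C c s. finite_sum I x \<iota> c s f))"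

lemma relatively_compactD:
  assumes "relatively_compact L c" "small I" "\<And>k. k \<in> I \<Longrightarrow> x k \<in> L" "is_coproduct C I x s \<iota>"
    "f \<in> Hom C c s"
  shows "finite_sum I x \<iota> c s f"
  using assms unfolding relatively_compact_def by blast

lemma relatively_compactI:
  assumes "c \<in> L" "\<And>I x s \<iota> f. small I \<Longrightarrow> (\<And>k. k \<in> I \<Longrightarrow> x k \<in> L) \<Longrightarrow> is_coproduct C I x s \<iota> \<Longrightarrow>
    f \<in> Hom C c s \<Longrightarrow> finite_sum I x \<iota> c s f"
  shows "relatively_compact L c"
  using assms unfolding relatively_compact_def by blast

lemma localizing_subcategoryD:
  assumes "localizing_subcategory small C L"
  shows "triangulated_subcategory C L"
    and "small I \<Longrightarrow> (\<And>k. k \<in> I \<Longrightarrow> x k \<in> L) \<Longrightarrow> is_coproduct C I x s \<iota> \<Longrightarrow> s \<in> L"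
  using assms unfolding localizing_subcategory_def by blast+

lemma relatively_compact_summand:
  assumes "L \<subseteq> Obj C" "relatively_compact L c" "summand b c" "b \<in> L"
  shows "relatively_compact L b"
proof (rule relatively_compactI[OF assms(4)])
  fix I x s \<iota> f
  assume I: "small I" "\<And>k. k \<in> I \<Longrightarrow> x k \<in> L" and cp: "is_coproduct C I x s \<iota>" and f: "f \<in> Hom C b s"
  obtain i p where ip: "i \<in> Arr C" "Dom C i = b" "Cod C i = c" "p \<in> Arr C" "Dom C p = c" "Cod C p = b"
    "p \<cdot> i = Ident C b" using assms(3) unfolding summand_def by auto
  have c: "c \<in> Obj C" using ip by auto
  have "finite_sum I x \<iota> c s (f \<cdot> p)"
    by (rule relatively_compactD[OF assms(2) I cp]) (use f ip in auto)
  then have "finite_sum I x \<iota> b s ((f \<cdot> p) \<cdot> i)"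
    by (rule finite_sum_Comp[OF cp c]) (use ip in auto)
  then show "finite_sum I x \<iota> b s f" using ip f by simp
qed

lemma relatively_compact_Shift:
  assumes L: "triangulated_subcategory C L" and c: "c \<in> Obj C"
  shows "relatively_compact L (Shift C c) \<longleftrightarrow> relatively_compact L c"
proof
  assume a: "relatively_compact L (Shift C c)"
  have cL: "c \<in> L" using a triangulated_subcategoryD(4)[OF L c] unfolding relatively_compact_def by blast
  show "relatively_compact L c"
  proof (rule relatively_compactI[OF cL])
    fix I x s \<iota> f
    assume I: "small I" "\<And>k. k \<in> I \<Longrightarrow> x k \<in> L" and cp: "is_coproduct C I x s \<iota>" and f: "f \<in> Hom C c s"
    note D = coproductD[OF cp]
    note cpS = coproduct_Shift[OF cp]
    have Sf: "finite_sum I (\<lambda>k. Shift C (x k)) (\<lambda>k. Shift_arr C (\<iota> k)) (Shift C c) (Shift C s) (Shift_arr C f)"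
      by (rule relatively_compactD[OF a I(1) _ cpS])
        (use triangulated_subcategoryD(4)[OF L] D(5) I(2) f in auto)
    \<comment> \<open>By fullness of the shift, a finite sum over the shifted coproduct desuspends
      term by term.\<close>
    have "\<exists>g. finite_sum I x \<iota> c s g \<and> F = Shift_arr C g"
      if "finite_sum I (\<lambda>k. Shift C (x k)) (\<lambda>k. Shift_arr C (\<iota> k)) (Shift C c) (Shift C s) F" for F
      using that
    proof induction
      case zero
      then show ?case using finite_sum.zero[of I x \<iota> c s] c D(1) by (intro exI[of _ "Zero C c s"]) simp
    next
      case (add F k \<Phi>)
      then obtain g where g: "finite_sum I x \<iota> c s g" "F = Shift_arr C g" by blast
      obtain \<phi> where \<phi>: "\<phi> \<in> Arr C" "Dom C \<phi> = c" "Cod C \<phi> = x k" "\<Phi> = Shift_arr C \<phi>"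
        by (rule Shift_arr_full[of \<Phi> c "x k"]) (use add D(5) c in auto)
      have "finite_sum I x \<iota> c s (g \<oplus>\<^sub>h (\<iota> k \<cdot> \<phi>))"
        by (rule finite_sum.add[OF g(1) add(2)]) (use \<phi> in simp)
      moreover have "F \<oplus>\<^sub>h Shift_arr C (\<iota> k) \<cdot> \<Phi> = Shift_arr C (g \<oplus>\<^sub>h (\<iota> k \<cdot> \<phi>))"
        using g \<phi> D(2-4)[OF add(2)] finite_sum_Hom[OF cp c g(1)] by simp
      ultimately show ?case by blast
    qed
    from this[OF Sf] obtain g where g: "finite_sum I x \<iota> c s g" "Shift_arr C f = Shift_arr C g" by blast
    have "f = g"
      by (rule Shift_arr_inject[OF _ _ _ _ g(2)]) (use f finite_sum_Hom[OF cp c g(1)] in auto)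
    then show "finite_sum I x \<iota> c s f" using g by simp
  qed
next
  assume a: "relatively_compact L c"
  have ScL: "Shift C c \<in> L"
    using a triangulated_subcategoryD(4)[OF L c] unfolding relatively_compact_def by blast
  show "relatively_compact L (Shift C c)"
  proof (rule relatively_compactI[OF ScL])
    fix I x s \<iota> f
    assume I: "small I" "\<And>k. k \<in> I \<Longrightarrow> x k \<in> L" and cp: "is_coproduct C I x s \<iota>"
      and f: "f \<in> Hom C (Shift C c) s"
    note D = coproductD[OF cp]
    \<comment> \<open>For this direction the family \<open>x\<close> itself must be desuspended:
      compactness of \<open>c\<close> is applied to a coproduct \<open>t\<close> of the
      \<open>y k\<close>, and \<open>s\<close> is compared with \<open>Shift C t\<close>.\<close>
    have "\<exists>y a b. y \<in> L \<and> a \<in> Hom C (Shift C y) (x k) \<and> b \<in> Hom C (x k) (Shift C y) \<and>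
        a \<cdot> b = Ident C (x k)" if k: "k \<in> I" for k
    proof -
      obtain y a b where y: "y \<in> Obj C" "a \<in> Arr C" "Dom C a = Shift C y" "Cod C a = x k" "b \<in> Arr C"
        "Dom C b = x k" "Cod C b = Shift C y" "b \<cdot> a = Ident C (Shift C y)" "a \<cdot> b = Ident C (x k)"
        "is_iso C a" "is_iso C b" by (rule Shift_ess_surjE[OF D(5)[OF k]]) (rule that)
      have "isomorphic C (x k) (Shift C y)" using y isomorphicI[of b "x k" "Shift C y"] by simp
      then have "y \<in> L" using triangulated_subcategoryD(3,4)[OF L] I(2)[OF k] y(1) by blast
      then show ?thesis using y by (intro exI[of _ y] exI[of _ a] exI[of _ b]) simp
    qed
    then obtain y a b where y: "\<And>k. k \<in> I \<Longrightarrow> y k \<in> L"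
      and a: "\<And>k. k \<in> I \<Longrightarrow> a k \<in> Hom C (Shift C (y k)) (x k)"
      and b: "\<And>k. k \<in> I \<Longrightarrow> b k \<in> Hom C (x k) (Shift C (y k))"
      and ab: "\<And>k. k \<in> I \<Longrightarrow> a k \<cdot> b k = Ident C (x k)" by metis
    have yO: "y k \<in> Obj C" if "k \<in> I" for k using y[OF that] triangulated_subcategoryD(1)[OF L] by blast
    obtain t j where cpt: "is_coproduct C I y t j" using coproduct_exists[OF I(1), of y] yO by blast
    note T = coproductD[OF cpt]
    obtain v where v: "v \<in> Arr C" "Dom C v = s" "Cod C v = Shift C t"
      "\<And>k. k \<in> I \<Longrightarrow> v \<cdot> \<iota> k = Shift_arr C (j k) \<cdot> b k"
      by (rule coproduct_map[OF cp, of "Shift C t" "\<lambda>k. Shift_arr C (j k) \<cdot> b k"])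
        (use T b that in auto)
    obtain u where u: "u \<in> Arr C" "Dom C u = Shift C t" "Cod C u = s"
      "\<And>k. k \<in> I \<Longrightarrow> u \<cdot> Shift_arr C (j k) = \<iota> k \<cdot> a k"
      by (rule coproduct_map[OF coproduct_Shift[OF cpt], of s "\<lambda>k. \<iota> k \<cdot> a k"])
        (use D a that in auto)
    \<comment> \<open>With \<open>s\<close> a retract of \<open>Shift C t\<close>, the expansion of
      \<open>v \<cdot> f\<close> over the shifted coproduct is carried back by
      \<open>u\<close>.\<close>
    have uv: "u \<cdot> v = Ident C s"
    proof (rule coproduct_ext[OF cp])
      fix k assume k: "k \<in> I"
      have "(u \<cdot> v) \<cdot> \<iota> k = u \<cdot> (Shift_arr C (j k) \<cdot> b k)"
        using v(1-3) u(1-3) v(4)[OF k] D(2-4)[OF k] by simp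
      also have "\<dots> = \<iota> k \<cdot> (a k \<cdot> b k)"
        using u(1-3) T(2-4)[OF k] D(2-4)[OF k] a[OF k] b[OF k]
        by (simp add: Comp_reassoc[OF u(4)[OF k]])
      also have "\<dots> = Ident C s \<cdot> \<iota> k" using ab[OF k] D(2-4)[OF k] by simp
      finally show "(u \<cdot> v) \<cdot> \<iota> k = Ident C s \<cdot> \<iota> k" .
    qed (use u v D in auto)
    have fa: "f \<in> Arr C" "Dom C f = Shift C c" "Cod C f = s" using f by auto
    obtain g where g: "g \<in> Arr C" "Dom C g = c" "Cod C g = t" "v \<cdot> f = Shift_arr C g"
      by (rule Shift_arr_full[of "v \<cdot> f" c t]) (use v fa c T(1) in auto)
    have "finite_sum I y j c t g"
      by (rule relatively_compactD[OF \<open>relatively_compact L c\<close> I(1) y cpt]) (use g in auto)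
    then have "finite_sum I x \<iota> (Shift C c) s (u \<cdot> Shift_arr C g)"
    proof induction
      case zero
      then show ?case using finite_sum.zero[of I x \<iota> "Shift C c" s] c T(1) u by simp
    next
      case (add g k \<phi>)
      note k = T(2-4)[OF add(2)] D(2-4)[OF add(2)] finite_sum_Hom[OF cpt c add(1)]
        a[OF add(2), unfolded in_Hom] add(3)[unfolded in_Hom] u(1-3)
      have "u \<cdot> Shift_arr C (g \<oplus>\<^sub>h j k \<cdot> \<phi>) =
          (u \<cdot> Shift_arr C g) \<oplus>\<^sub>h (\<iota> k \<cdot> (a k \<cdot> Shift_arr C \<phi>))"
        using k by (simp add: Comp_reassoc[OF u(4)[OF add(2)]])
      then show ?case
        using finite_sum.add[of I x \<iota> "Shift C c" s "u \<cdot> Shift_arr C g" k "a k \<cdot> Shift_arr C \<phi>"] add k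
        by simp
    qed
    then show "finite_sum I x \<iota> (Shift C c) s f"
      using g(4) fa u v Comp_reassoc[OF uv, of f] by simp
  qed
qed

text \<open>A five-lemma argument by hand. As \<open>y\<close> is compact, a finite-sum endomorphism
  \<open>e\<close> fixes \<open>k \<cdot> g\<close>. Then \<open>k - e \<cdot> k\<close> kills
  \<open>g\<close> and so factors over \<open>h\<close> through the compact object
  \<open>Shift C x\<close>, while \<open>e \<cdot> k\<close> is a finite sum because
  \<open>e\<close> is one.\<close>

lemma relatively_compact_cone:
  assumes L: "triangulated_subcategory C L" and t: "dist_triangle C x y z f g h"
    and x: "relatively_compact L x" and y: "relatively_compact L y"
  shows "relatively_compact L z"
proof -
  note td = triangleD[OF t]
  have zL: "z \<in> L"
    using triangulated_subcategoryD(5)[OF L t] x y unfolding relatively_compact_def by blast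
  show ?thesis
  proof (rule relatively_compactI[OF zL])
    fix I X s \<iota> k
    assume I: "small I" "\<And>k. k \<in> I \<Longrightarrow> X k \<in> L" and cp: "is_coproduct C I X s \<iota>"
      and k: "k \<in> Hom C z s"
    note D = coproductD[OF cp]
    have ka: "k \<in> Arr C" "Dom C k = z" "Cod C k = s" using k by auto
    have "finite_sum I X \<iota> y s (k \<cdot> g)"
      by (rule relatively_compactD[OF y I cp]) (use ka td in auto)
    then obtain e where e: "e \<in> Arr C" "Dom C e = s" "Cod C e = s" "finite_sum I X \<iota> s s e"
      "e \<cdot> (k \<cdot> g) = k \<cdot> g" by (rule finite_sum_fixed[OF cp td(11)]) (rule that)
    have "(k \<oplus>\<^sub>h neg C (e \<cdot> k)) \<cdot> g = Zero C y s"
      using ka td e by simp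
    then obtain v where v: "v \<in> Arr C" "Dom C v = Shift C x" "Cod C v = s"
      "v \<cdot> h = k \<oplus>\<^sub>h neg C (e \<cdot> k)"
      by (rule triangle_extend[OF rotate[OF t], rotated]) (use ka e td that in auto)
    have "finite_sum I X \<iota> (Shift C x) s v"
      by (rule relatively_compactD[OF _ I cp])
        (use relatively_compact_Shift[OF L td(10)] x v in auto)
    then have "finite_sum I X \<iota> z s (v \<cdot> h)"
      by (rule finite_sum_Comp[OF cp Shift_Obj[OF td(10)]]) (use td in auto)
    moreover have "finite_sum I X \<iota> z s (e \<cdot> k)"
      by (rule finite_sum_Comp[OF cp D(1) e(4) k])
    ultimately have "finite_sum I X \<iota> z s ((v \<cdot> h) \<oplus>\<^sub>h (e \<cdot> k))"
      by (rule finite_sum_Add[OF cp td(12)])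
    moreover have "(v \<cdot> h) \<oplus>\<^sub>h (e \<cdot> k) = k"
      unfolding v(4) by (rule diff_Add_cancel) (use ka e in auto)
    ultimately show "finite_sum I X \<iota> z s k" by simp
  qed
qed

lemma relatively_compact_triangulated:
  assumes L: "triangulated_subcategory C L"
  shows "triangulated_subcategory C {c. relatively_compact L c}"
proof -
  note LD = triangulated_subcategoryD[OF L]
  have memL: "c \<in> L" if "relatively_compact L c" for c using that unfolding relatively_compact_def by blast
  show ?thesis
    unfolding triangulated_subcategory_def
  proof (intro conjI allI impI ballI; (elim conjE)?)
    show "{c. relatively_compact L c} \<subseteq> Obj C" using memL LD(1) by blast
  next
    fix z assume z: "is_zero_object C z"
    have "relatively_compact L z"
    proof (rule relatively_compactI[OF LD(2)[OF z]])
      fix I x s \<iota> f assume "f \<in> Hom C z s"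
      then have "f = Zero C z s" using zero_object_Hom(1)[OF z] by auto
      then show "finite_sum I x \<iota> z s f" using finite_sum.zero by simp
    qed
    then show "z \<in> {c. relatively_compact L c}" by simp
  next
    fix x y assume "x \<in> {c. relatively_compact L c}" "isomorphic C x y"
    then show "y \<in> {c. relatively_compact L c}"
      using relatively_compact_summand[OF LD(1) _ isomorphic_imp_summand LD(3)] memL by blast
  next
    fix x assume "x \<in> Obj C"
    then show "Shift C x \<in> {c. relatively_compact L c} \<longleftrightarrow> x \<in> {c. relatively_compact L c}"
      using relatively_compact_Shift[OF L] by simp
  next
    fix x y z f g h assume "dist_triangle C x y z f g h" "x \<in> {c. relatively_compact L c}"
      "y \<in> {c. relatively_compact L c}"
    then show "z \<in> {c. relatively_compact L c}" using relatively_compact_cone[OF L] by blast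
  qed
qed

end

lemma full_subcategory_simps [simp]:
  "Obj (full_subcategory C S) = S" "Dom (full_subcategory C S) = Dom C"
  "Cod (full_subcategory C S) = Cod C" "Ident (full_subcategory C S) = Ident C"
  "Comp (full_subcategory C S) = Comp C" "Add (full_subcategory C S) = Add C"
  "Zero (full_subcategory C S) = Zero C" "Shift (full_subcategory C S) = Shift C"
  "Shift_arr (full_subcategory C S) = Shift_arr C"
  unfolding full_subcategory_def by simp_all

lemma Hom_full_subcategory:
  "Hom (full_subcategory C S) x y = (if x \<in> S \<and> y \<in> S then Hom C x y else {})"
  unfolding full_subcategory_def Hom_def by auto

lemma full_subcategory_full_subcategory:
  "S \<subseteq> L \<Longrightarrow> full_subcategory (full_subcategory C L) S = full_subcategory C S"
  unfolding full_subcategory_def by (auto intro!: triangulated_category.equality)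

section \<open>Localizing subcategories, their summands and their compact objects\<close>

context triangulated_category_with_coproducts
begin

lemma localizing_subcategory_Obj: "localizing_subcategory small C (Obj C)"
  unfolding localizing_subcategory_def
  using triangulated_subcategory_Obj coproductD(1) by blast

lemma Loc_localizing:
  assumes "\<G> \<subseteq> Obj C"
  shows "localizing_subcategory small C (Loc small C \<G>)"
  unfolding localizing_subcategory_def
proof (intro conjI allI impI; (elim conjE)?)
  show "triangulated_subcategory C (Loc small C \<G>)"
    unfolding Loc_def
    by (rule triangulated_subcategory_Inter)
      (use localizing_subcategory_Obj localizing_subcategoryD(1) assms in blast)+
next
  fix I x s \<iota> assume "small I" "\<forall>k\<in>I. x k \<in> Loc small C \<G>" "is_coproduct C I x s \<iota>"
  then show "s \<in> Loc small C \<G>"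
    unfolding Loc_def using localizing_subcategoryD(2)[of _ I x s \<iota>] by blast
qed

lemma Loc_superset: "\<G> \<subseteq> Loc small C \<G>"
  unfolding Loc_def by blast

lemma Loc_subset: "localizing_subcategory small C S \<Longrightarrow> \<G> \<subseteq> S \<Longrightarrow> Loc small C \<G> \<subseteq> S"
  unfolding Loc_def by blast

text \<open>Small index sets live in the type \<open>'i\<close>, so the copower is formed over the
  image of an injection of the naturals into an infinite small set, and its universal property is
  restated over \<open>nat\<close>.\<close>

lemma countable_copower:
  assumes L: "localizing_subcategory small C L" and t: "t \<in> L"
  shows "\<exists>s j. s \<in> L \<and> (\<forall>n :: nat. j n \<in> Hom C t s) \<and>
    (\<forall>z \<in> Obj C. \<forall>g. (\<forall>n. g n \<in> Hom C t z) \<longrightarrow> (\<exists>u \<in> Hom C s z. \<forall>n. u \<cdot> j n = g n)) \<and>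
    (\<forall>z. \<forall>u \<in> Hom C s z. \<forall>v \<in> Hom C s z. (\<forall>n. u \<cdot> j n = v \<cdot> j n) \<longrightarrow> u = v)"
proof -
  obtain I where "small I" "infinite I" using infinite_small by blast
  then obtain f :: "nat \<Rightarrow> 'i" where f: "inj f" "range f \<subseteq> I" using infinite_countable_subset by metis
  have sm: "small (range f)" using small_subset[OF \<open>small I\<close> f(2)] .
  have tO: "t \<in> Obj C"
    using t triangulated_subcategoryD(1)[OF localizing_subcategoryD(1)[OF L]] by blast
  obtain s \<iota> where cp: "is_coproduct C (range f) (\<lambda>_. t) s \<iota>"
    using coproduct_exists[OF sm, of "\<lambda>_. t"] tO by blast
  show ?thesis
  proof (rule exI[of _ s], rule exI[of _ "\<lambda>n. \<iota> (f n)"], intro conjI allI ballI impI)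
    show "s \<in> L" using localizing_subcategoryD(2)[OF L sm _ cp] t by blast
    show "\<iota> (f n) \<in> Hom C t s" for n using coproductD(2-4)[OF cp, of "f n"] by simp
    show "\<exists>u \<in> Hom C s z. \<forall>n. u \<cdot> \<iota> (f n) = g n"
      if z: "z \<in> Obj C" and g: "\<forall>n. g n \<in> Hom C t z" for z g
    proof -
      obtain u where "u \<in> Arr C" "Dom C u = s" "Cod C u = z"
        "\<And>k. k \<in> range f \<Longrightarrow> u \<cdot> \<iota> k = g (inv_into UNIV f k)"
        by (rule coproduct_map[OF cp z, of "\<lambda>k. g (inv_into UNIV f k)"]) (use g that in auto)
      then show ?thesis using f(1) by (intro bexI[of _ u]) auto
    qed
    show "u = v" if "u \<in> Hom C s z" "v \<in> Hom C s z" "\<forall>n. u \<cdot> \<iota> (f n) = v \<cdot> \<iota> (f n)" for z u v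
      by (rule coproduct_ext[OF cp that(1,2)]) (use that(3) in blast)
  qed
qed

text \<open>Eilenberg swindle: if \<open>c\<close> is a summand of \<open>t\<close> and \<open>s\<close> is the sum of countably many copies of
  \<open>t\<close>, then \<open>s \<oplus> c \<cong> s\<close>. With the idempotent \<open>e\<close> of \<open>t\<close> belonging to \<open>c\<close>, the inclusion of \<open>s\<close> is the
  identity on the complement of \<open>c\<close> in each copy of \<open>t\<close> and moves \<open>c\<close> one copy further.\<close>

lemma localizing_subcategory_summand:
  assumes L: "localizing_subcategory small C L" and t: "t \<in> L" and ct: "summand c t"
  shows "c \<in> L"
proof -
  note tri = localizing_subcategoryD(1)[OF L]
  have tO: "t \<in> Obj C" using t triangulated_subcategoryD(1)[OF tri] by blast
  obtain i p where ip: "i \<in> Arr C" "Dom C i = c" "Cod C i = t" "p \<in> Arr C" "Dom C p = t" "Cod C p = c"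
    and pi: "p \<cdot> i = Ident C c" using ct unfolding summand_def by auto
  have cO: "c \<in> Obj C" using ip by auto
  define e where "e = i \<cdot> p"
  define d where "d = Ident C t \<oplus>\<^sub>h neg C e"
  have e: "e \<in> Arr C" "Dom C e = t" "Cod C e = t" unfolding e_def using ip by auto
  have d: "d \<in> Arr C" "Dom C d = t" "Cod C d = t" unfolding d_def using e tO by auto
  have ee: "e \<cdot> e = e" unfolding e_def using ip cO by (simp add: Comp_reassoc[OF pi])
  have ed: "e \<cdot> d = Zero C t t" unfolding d_def using e tO ee by simp
  have de: "d \<cdot> e = Zero C t t" unfolding d_def using e tO ee by simp
  have dd: "d \<cdot> d = d"
  proof -
    have "d \<cdot> d = d \<cdot> (Ident C t \<oplus>\<^sub>h neg C e)" by (simp add: d_def)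
    also have "\<dots> = d" using d e tO de by simp
    finally show ?thesis .
  qed
  have sum: "d \<oplus>\<^sub>h e = Ident C t" unfolding d_def by (rule diff_Add_cancel) (use e tO in auto)
  have pd: "p \<cdot> d = Zero C t c" unfolding d_def e_def using ip tO cO by (simp add: Comp_reassoc[OF pi])
  have pe: "p \<cdot> e = p" unfolding e_def using ip cO by (simp add: Comp_reassoc[OF pi])
  have di: "d \<cdot> i = Zero C c t" unfolding d_def e_def using ip tO cO pi by simp
  obtain s j where s: "s \<in> L" and j: "\<And>n :: nat. j n \<in> Hom C t s"
    and ex: "\<And>z g. z \<in> Obj C \<Longrightarrow> (\<And>n. g n \<in> Hom C t z) \<Longrightarrow> \<exists>u \<in> Hom C s z. \<forall>n. u \<cdot> j n = g n"
    and ext: "\<And>z u v. u \<in> Hom C s z \<Longrightarrow> v \<in> Hom C s z \<Longrightarrow> (\<And>n. u \<cdot> j n = v \<cdot> j n) \<Longrightarrow> u = v"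
    using countable_copower[OF L t] by blast
  have sO: "s \<in> Obj C" using s triangulated_subcategoryD(1)[OF tri] by blast
  have ja: "j n \<in> Arr C" "Dom C (j n) = t" "Cod C (j n) = s" for n using j[of n] by auto
  obtain F where F: "F \<in> Arr C" "Dom C F = s" "Cod C F = s"
    and Fj: "\<And>n. F \<cdot> j n = (j n \<cdot> d) \<oplus>\<^sub>h (j (Suc n) \<cdot> e)"
    using ex[OF sO, of "\<lambda>n. (j n \<cdot> d) \<oplus>\<^sub>h (j (Suc n) \<cdot> e)"] ja d e by auto
  \<comment> \<open>\<open>R\<close> is to undo \<open>F\<close>: it keeps the \<open>d\<close> part
    and moves the \<open>e\<close> part one copy back. Copy 0 has no predecessor, hence the value
    zero there.\<close>
  define X where "X n = (case n of 0 \<Rightarrow> Zero C t s | Suc m \<Rightarrow> j m \<cdot> e)" for n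
  have X: "X n \<in> Arr C" "Dom C (X n) = t" "Cod C (X n) = s" for n
    unfolding X_def using ja e tO sO by (auto split: nat.split)
  have Xd: "X n \<cdot> d = Zero C t s" for n
    unfolding X_def using ja e d ed tO sO by (auto split: nat.split)
  obtain R where R: "R \<in> Arr C" "Dom C R = s" "Cod C R = s" and Rj: "\<And>n. R \<cdot> j n = (j n \<cdot> d) \<oplus>\<^sub>h X n"
    using ex[OF sO, of "\<lambda>n. (j n \<cdot> d) \<oplus>\<^sub>h X n"] ja d X by auto
  \<comment> \<open>\<open>Q\<close> reads off the \<open>c\<close> in copy 0, the one place that
    \<open>F\<close> leaves free.\<close>
  define Y where "Y n = (case n of 0 \<Rightarrow> p | Suc m \<Rightarrow> Zero C t c)" for n :: nat
  have Y: "Y n \<in> Arr C" "Dom C (Y n) = t" "Cod C (Y n) = c" for n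
    unfolding Y_def using ip tO cO by (auto split: nat.split)
  have Yd: "Y n \<cdot> d = Zero C t c" for n
    unfolding Y_def using pd d tO cO by (auto split: nat.split)
  obtain Q where Q: "Q \<in> Arr C" "Dom C Q = s" "Cod C Q = c" and Qj: "\<And>n. Q \<cdot> j n = Y n"
    using ex[OF cO, of Y] Y by auto
  have RF: "R \<cdot> F = Ident C s"
  proof (rule ext)
    fix n
    have "(R \<cdot> F) \<cdot> j n = R \<cdot> ((j n \<cdot> d) \<oplus>\<^sub>h (j (Suc n) \<cdot> e))"
      using R F ja by (simp add: Fj)
    also have "\<dots> = ((j n \<cdot> d) \<oplus>\<^sub>h X n) \<cdot> d \<oplus>\<^sub>h ((j (Suc n) \<cdot> d) \<oplus>\<^sub>h X (Suc n)) \<cdot> e"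
      using R ja d e X by (simp add: Comp_reassoc[OF Rj])
    also have "\<dots> = (j n \<cdot> d) \<oplus>\<^sub>h (j n \<cdot> e)"
      using ja d e X[of n] tO sO dd de ee Xd[of n] by (simp add: X_def)
    also have "\<dots> = j n \<cdot> (d \<oplus>\<^sub>h e)" using ja d e by simp
    also have "\<dots> = Ident C s \<cdot> j n" unfolding sum using ja sO tO by simp
    finally show "(R \<cdot> F) \<cdot> j n = Ident C s \<cdot> j n" .
  qed (use R F sO in auto)
  have QF: "Q \<cdot> F = Zero C s c"
  proof (rule ext)
    fix n
    have "(Q \<cdot> F) \<cdot> j n = Q \<cdot> ((j n \<cdot> d) \<oplus>\<^sub>h (j (Suc n) \<cdot> e))"
      using Q F ja by (simp add: Fj)
    also have "\<dots> = (Y n \<cdot> d) \<oplus>\<^sub>h (Y (Suc n) \<cdot> e)"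
      using Q ja d e Y by (simp add: Comp_reassoc[OF Qj])
    also have "\<dots> = Zero C t c" unfolding Yd using e tO cO by (simp add: Y_def)
    also have "\<dots> = Zero C s c \<cdot> j n" using ja cO by simp
    finally show "(Q \<cdot> F) \<cdot> j n = Zero C s c \<cdot> j n" .
  qed (use Q F sO cO in auto)
  have FR: "(F \<cdot> R) \<oplus>\<^sub>h ((j 0 \<cdot> i) \<cdot> Q) = Ident C s"
  proof (rule ext)
    fix n
    have "((F \<cdot> R) \<oplus>\<^sub>h ((j 0 \<cdot> i) \<cdot> Q)) \<cdot> j n = (F \<cdot> ((j n \<cdot> d) \<oplus>\<^sub>h X n)) \<oplus>\<^sub>h (j 0 \<cdot> (i \<cdot> Y n))"
      using R F Q ja ip by (simp add: Rj Qj)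
    also have "\<dots> = j n"
    proof (cases n)
      case 0
      have "(F \<cdot> ((j 0 \<cdot> d) \<oplus>\<^sub>h X 0)) \<oplus>\<^sub>h (j 0 \<cdot> (i \<cdot> Y 0)) =
          (((j 0 \<cdot> d) \<oplus>\<^sub>h (j (Suc 0) \<cdot> e)) \<cdot> d) \<oplus>\<^sub>h (j 0 \<cdot> e)"
        using F ja d e tO sO by (simp add: X_def Y_def e_def[symmetric] Comp_reassoc[OF Fj])
      also have "\<dots> = (j 0 \<cdot> d) \<oplus>\<^sub>h (j 0 \<cdot> e)" using ja d e ed dd tO sO by simp
      also have "\<dots> = j 0 \<cdot> (d \<oplus>\<^sub>h e)" using ja d e by simp
      finally show ?thesis unfolding sum 0 using ja by simp
    next
      case (Suc m)
      have "(F \<cdot> ((j n \<cdot> d) \<oplus>\<^sub>h X n)) \<oplus>\<^sub>h (j 0 \<cdot> (i \<cdot> Y n)) =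
          (((j n \<cdot> d) \<oplus>\<^sub>h (j (Suc n) \<cdot> e)) \<cdot> d) \<oplus>\<^sub>h (((j m \<cdot> d) \<oplus>\<^sub>h (j n \<cdot> e)) \<cdot> e)"
        using F ja d e tO sO cO ip by (simp add: X_def Y_def Suc Comp_reassoc[OF Fj])
      also have "\<dots> = (j n \<cdot> d) \<oplus>\<^sub>h (j n \<cdot> e)" using ja d e ed dd de ee tO sO by simp
      also have "\<dots> = j n \<cdot> (d \<oplus>\<^sub>h e)" using ja d e by simp
      finally show ?thesis unfolding sum using ja by simp
    qed
    also have "\<dots> = Ident C s \<cdot> j n" using ja by simp
    finally show "((F \<cdot> R) \<oplus>\<^sub>h ((j 0 \<cdot> i) \<cdot> Q)) \<cdot> j n = Ident C s \<cdot> j n" .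
  qed (use Q R F sO ja ip in auto)
  have QJ: "Q \<cdot> (j 0 \<cdot> i) = Ident C c"
    using Q ja ip pi by (simp add: Comp_reassoc[OF Qj] Y_def)
  have RJ: "R \<cdot> (j 0 \<cdot> i) = Zero C c s"
    using R ja ip di d X tO sO cO by (simp add: Comp_reassoc[OF Rj] X_def)
  have "is_biproduct C s c s"
    unfolding is_biproduct_def
    by (rule bexI[of _ F], rule bexI[of _ "j 0 \<cdot> i"], rule bexI[of _ R], rule bexI[of _ Q])
      (use RF QF FR QJ RJ F Q R ja ip in simp_all)
  \<comment> \<open>Two-out-of-three, with \<open>s\<close> both as one summand and as the
    sum.\<close>
  then show ?thesis by (rule triangulated_subcategory_biproduct(2)[OF tri _ s s])
qed

lemma compact_imp_relatively_compact:
  assumes "compact_object small C c" "c \<in> L"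
  shows "relatively_compact L c"
proof (rule relatively_compactI[OF assms(2)])
  fix I x s \<iota> f
  assume "small I" "is_coproduct C I x s \<iota>" "f \<in> Hom C c s"
  then show "finite_sum I x \<iota> c s f"
    using assms(1) bij_finprod_iff_finite_sum[of I x s \<iota> c] unfolding compact_object_def by blast
qed

lemma relatively_compact_imp_compact:
  assumes "relatively_compact (Obj C) c"
  shows "compact_object small C c"
  unfolding compact_object_def
proof (intro conjI allI impI; (elim conjE)?)
  show c: "c \<in> Obj C" using assms unfolding relatively_compact_def by blast
  fix I x s \<iota>
  assume "small I" and cp: "is_coproduct C I x s \<iota>"
  then have "\<forall>f \<in> Hom C c s. finite_sum I x \<iota> c s f"
    using assms coproductD(5)[OF cp] unfolding relatively_compact_def by blast
  then show "bij_betw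
          (\<lambda>\<phi>. finprod (hom_group C c s) (\<lambda>k. \<iota> k \<cdot> \<phi> k) {k \<in> I. \<phi> k \<noteq> Zero C c (x k)})
          {\<phi> \<in> \<Pi>\<^sub>E k\<in>I. Hom C c (x k). finite {k \<in> I. \<phi> k \<noteq> Zero C c (x k)}} (Hom C c s)"
    using bij_finprod_iff_finite_sum[OF cp c] by blast
qed

text \<open>A coproduct of the subcategory is universal only against objects of \<open>L\<close>. It
  is compared with an ambient coproduct \<open>t\<close>, which lies in \<open>L\<close> because
  \<open>L\<close> is localizing; \<open>s\<close> becomes a retract of \<open>t\<close> compatibly
  with the inclusions, and the ambient universal property passes to it.\<close>

lemma is_coproduct_full_subcategory:
  assumes L: "localizing_subcategory small C L" and I: "small I"
  shows "is_coproduct (full_subcategory C L) I x s \<iota> \<longleftrightarrow>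
    is_coproduct C I x s \<iota> \<and> s \<in> L \<and> (\<forall>k\<in>I. x k \<in> L)"
proof
  let ?D = "full_subcategory C L"
  have LO: "L \<subseteq> Obj C" using triangulated_subcategoryD(1)[OF localizing_subcategoryD(1)[OF L]] .
  assume a: "is_coproduct ?D I x s \<iota>"
  then have s: "s \<in> L" and \<iota>D: "\<forall>k\<in>I. \<iota> k \<in> Hom ?D (x k) s"
    unfolding is_coproduct_def by auto
  then have xL: "x k \<in> L" and \<iota>: "\<iota> k \<in> Hom C (x k) s" if "k \<in> I" for k
    using that by (auto simp: Hom_full_subcategory split: if_splits)
  have univ: "\<exists>!g. g \<in> Hom C s z \<and> (\<forall>k\<in>I. g \<cdot> \<iota> k = f k)"
    if z: "z \<in> L" and "\<And>k. k \<in> I \<Longrightarrow> f k \<in> Hom C (x k) z" for z f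
  proof -
    have "\<forall>k\<in>I. f k \<in> Hom ?D (x k) z" using that xL by (simp add: Hom_full_subcategory)
    then have "\<exists>!g. g \<in> Hom ?D s z \<and> (\<forall>k\<in>I. g \<cdot>\<^bsub>?D\<^esub> \<iota> k = f k)"
      using a z unfolding is_coproduct_def by (metis full_subcategory_simps(1))
    then show ?thesis using s z by (simp add: Hom_full_subcategory)
  qed
  obtain t j where cp: "is_coproduct C I x t j"
    using coproduct_exists[OF I, of x] xL LO by blast
  note T = coproductD[OF cp]
  have tL: "t \<in> L" by (rule localizing_subcategoryD(2)[OF L I xL cp])
  have jh: "j k \<in> Hom C (x k) t" if "k \<in> I" for k using T that by simp
  have sO: "s \<in> Obj C" using s LO by blast
  obtain u where u: "u \<in> Arr C" "Dom C u = t" "Cod C u = s" "\<And>k. k \<in> I \<Longrightarrow> u \<cdot> j k = \<iota> k"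
    by (rule coproduct_map[OF cp sO \<iota>]) (use that in auto)
  obtain v where v: "v \<in> Arr C" "Dom C v = s" "Cod C v = t" "\<And>k. k \<in> I \<Longrightarrow> v \<cdot> \<iota> k = j k"
    using univ[OF tL jh] by auto
  have uv: "u \<cdot> v = Ident C s"
  proof -
    have "(u \<cdot> v) \<in> Hom C s s \<and> (\<forall>k\<in>I. (u \<cdot> v) \<cdot> \<iota> k = \<iota> k)" using u v \<iota> by auto
    moreover have "Ident C s \<in> Hom C s s \<and> (\<forall>k\<in>I. Ident C s \<cdot> \<iota> k = \<iota> k)" using sO \<iota> by auto
    ultimately show ?thesis using univ[OF s \<iota>] by blast
  qed
  have "is_coproduct C I x s \<iota>"
  proof (rule is_coproductI[OF sO \<iota>])
    fix z f assume z: "z \<in> Obj C" and f: "\<And>k. k \<in> I \<Longrightarrow> f k \<in> Hom C (x k) z"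
    obtain g where g: "g \<in> Arr C" "Dom C g = t" "Cod C g = z" "\<And>k. k \<in> I \<Longrightarrow> g \<cdot> j k = f k"
      by (rule coproduct_map[OF cp z f]) (use that in auto)
    have "(g \<cdot> v) \<cdot> \<iota> k = f k" if k: "k \<in> I" for k
      using g(1-3) g(4)[OF k] v(1-3) v(4)[OF k] \<iota>[OF k] by simp
    then show "\<exists>g \<in> Hom C s z. \<forall>k\<in>I. g \<cdot> \<iota> k = f k" using g v by (intro bexI[of _ "g \<cdot> v"]) auto
  next
    fix z g h assume g: "g \<in> Hom C s z" and h: "h \<in> Hom C s z"
      and eq: "\<And>k. k \<in> I \<Longrightarrow> g \<cdot> \<iota> k = h \<cdot> \<iota> k"
    have "g \<cdot> u = h \<cdot> u"
    proof (rule coproduct_ext[OF cp])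
      fix k assume k: "k \<in> I"
      show "(g \<cdot> u) \<cdot> j k = (h \<cdot> u) \<cdot> j k"
        using g h u(1-3) u(4)[OF k] T(2-4)[OF k] eq[OF k] by simp
    qed (use g h u in auto)
    then have "(g \<cdot> u) \<cdot> v = (h \<cdot> u) \<cdot> v" by simp
    then show "g = h" using g h u v uv by simp
  qed
  then show "is_coproduct C I x s \<iota> \<and> s \<in> L \<and> (\<forall>k\<in>I. x k \<in> L)" using s xL by blast
next
  let ?D = "full_subcategory C L"
  have LO: "L \<subseteq> Obj C" using triangulated_subcategoryD(1)[OF localizing_subcategoryD(1)[OF L]] .
  assume "is_coproduct C I x s \<iota> \<and> s \<in> L \<and> (\<forall>k\<in>I. x k \<in> L)"
  then show "is_coproduct ?D I x s \<iota>"
    using LO unfolding is_coproduct_def by (auto simp: Hom_full_subcategory subset_iff simp del: in_Hom)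
qed

text \<open>Small coproducts of the subcategory are ambient ones, and its hom-groups agree with
  those of \<open>C\<close> by fullness, so both sides test the same families.\<close>

lemma compact_object_full_subcategory:
  assumes L: "localizing_subcategory small C L"
  shows "compact_object small (full_subcategory C L) c \<longleftrightarrow> relatively_compact L c"
proof -
  let ?D = "full_subcategory C L"
  have LO: "L \<subseteq> Obj C" using triangulated_subcategoryD(1)[OF localizing_subcategoryD(1)[OF L]] .
  have eq: "bij_betw
          (\<lambda>\<phi>. finprod (hom_group ?D c s) (\<lambda>k. \<iota> k \<cdot>\<^bsub>?D\<^esub> \<phi> k) {k \<in> I. \<phi> k \<noteq> Zero ?D c (x k)})
          {\<phi> \<in> \<Pi>\<^sub>E k\<in>I. Hom ?D c (x k). finite {k \<in> I. \<phi> k \<noteq> Zero ?D c (x k)}} (Hom ?D c s)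
      \<longleftrightarrow> (\<forall>f \<in> Hom C c s. finite_sum I x \<iota> c s f)"
    if "c \<in> L" "s \<in> L" "\<forall>k\<in>I. x k \<in> L" "is_coproduct C I x s \<iota>" for I x s \<iota>
  proof -
    have "hom_group ?D c s = hom_group C c s" using that
      by (simp add: hom_group_def Hom_full_subcategory)
    moreover have "(\<Pi>\<^sub>E k\<in>I. Hom ?D c (x k)) = (\<Pi>\<^sub>E k\<in>I. Hom C c (x k))" using that
      by (intro PiE_cong) (simp add: Hom_full_subcategory)
    moreover have "Hom ?D c s = Hom C c s" using that by (simp add: Hom_full_subcategory)
    ultimately show ?thesis
      using bij_finprod_iff_finite_sum[OF that(4), of c] that(1) LO by auto
  qed
  show ?thesis
  proof
    assume a: "compact_object small ?D c"
    then have c: "c \<in> L" unfolding compact_object_def by simp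
    show "relatively_compact L c"
    proof (rule relatively_compactI[OF c])
      fix I x s \<iota> f
      assume I: "small I" "\<And>k. k \<in> I \<Longrightarrow> x k \<in> L" and cp: "is_coproduct C I x s \<iota>" and f: "f \<in> Hom C c s"
      have s: "s \<in> L" by (rule localizing_subcategoryD(2)[OF L I cp])
      then have "is_coproduct ?D I x s \<iota>"
        using is_coproduct_full_subcategory[OF L I(1)] cp I(2) by blast
      then show "finite_sum I x \<iota> c s f"
        using a eq[OF c s _ cp] I f unfolding compact_object_def by blast
    qed
  next
    assume a: "relatively_compact L c"
    then have c: "c \<in> L" unfolding relatively_compact_def by simp
    show "compact_object small ?D c"
      unfolding compact_object_def
    proof (intro conjI allI impI; (elim conjE)?)
      show "c \<in> Obj ?D" using c by simp
      fix I x s \<iota> assume I: "small I" and "is_coproduct ?D I x s \<iota>"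
      then have cp: "is_coproduct C I x s \<iota>" "s \<in> L" "\<forall>k\<in>I. x k \<in> L"
        using is_coproduct_full_subcategory[OF L I] by blast+
      show "bij_betw
          (\<lambda>\<phi>. finprod (hom_group ?D c s) (\<lambda>k. \<iota> k \<cdot>\<^bsub>?D\<^esub> \<phi> k) {k \<in> I. \<phi> k \<noteq> Zero ?D c (x k)})
          {\<phi> \<in> \<Pi>\<^sub>E k\<in>I. Hom ?D c (x k). finite {k \<in> I. \<phi> k \<noteq> Zero ?D c (x k)}} (Hom ?D c s)"
        unfolding eq[OF c cp(2,3,1)]
        using a I cp unfolding relatively_compact_def by blast
    qed
  qed
qed

text \<open>The test objects range over everything compact relative to \<open>L\<close>, not just
  over \<open>X\<close>: the cone argument tests a cone of a map \<open>c -> t\<close>, and in the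
  end a compact object is tested against its own identity.\<close>

definition locally_factors :: "'o set \<Rightarrow> 'o set \<Rightarrow> 'o \<Rightarrow> bool" where
  "locally_factors L X y \<longleftrightarrow> y \<in> L \<and>
     (\<forall>c. relatively_compact L c \<longrightarrow> (\<forall>f \<in> Hom C c y. \<exists>t\<in>X. factors_through f t))"

lemma locally_factorsD:
  assumes "locally_factors L X y" "relatively_compact L c" "f \<in> Hom C c y"
  obtains t where "t \<in> X" "factors_through f t"
  using assms unfolding locally_factors_def by blast

lemma locally_factorsI:
  assumes "y \<in> L" "\<And>c f. relatively_compact L c \<Longrightarrow> f \<in> Arr C \<Longrightarrow> Dom C f = c \<Longrightarrow> Cod C f = y \<Longrightarrow>
    \<exists>t\<in>X. factors_through f t"
  shows "locally_factors L X y"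
  using assms unfolding locally_factors_def by simp

section \<open>Closure properties of factorization through a triangulated subcategory\<close>

context
  fixes L X
  assumes L: "localizing_subcategory small C L"
    and X: "triangulated_subcategory C X" and XK: "\<And>t. t \<in> X \<Longrightarrow> relatively_compact L t"
begin

text \<open>Each direction needs one desuspension: of the intermediate object \<open>t\<close> when
  descending from \<open>Shift C x\<close> to \<open>x\<close>, and of the source \<open>c\<close>
  when ascending.\<close>

lemma locally_factors_Shift:
  assumes x: "x \<in> Obj C"
  shows "locally_factors L X (Shift C x) \<longleftrightarrow> locally_factors L X x"
proof
  note tri = localizing_subcategoryD(1)[OF L]
  assume a: "locally_factors L X (Shift C x)"
  have xL: "x \<in> L" using a triangulated_subcategoryD(4)[OF tri x] unfolding locally_factors_def by blast
  show "locally_factors L X x"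
  proof (rule locally_factorsI[OF xL])
    fix c f assume c: "relatively_compact L c" and f: "f \<in> Arr C" "Dom C f = c" "Cod C f = x"
    have cO: "c \<in> Obj C" using f by auto
    have Sc: "relatively_compact L (Shift C c)" using relatively_compact_Shift[OF tri cO] c by simp
    obtain t where t: "t \<in> X" "factors_through (Shift_arr C f) t"
      by (rule locally_factorsD[OF a Sc, of "Shift_arr C f"]) (use f that in auto)
    obtain p q where pq: "p \<in> Arr C" "Dom C p = Shift C c" "Cod C p = t" "q \<in> Arr C" "Dom C q = t"
      "Cod C q = Shift C x" and e: "Shift_arr C f = q \<cdot> p"
      by (rule factors_through_typedE[OF t(2), of "Shift C c" "Shift C x"]) (simp add: f, simp add: f, rule that)
    have tO: "t \<in> Obj C" using pq by auto
    obtain w a b where w: "w \<in> Obj C" "a \<in> Arr C" "Dom C a = Shift C w" "Cod C a = t" "b \<in> Arr C"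
      "Dom C b = t" "Cod C b = Shift C w" "b \<cdot> a = Ident C (Shift C w)" "a \<cdot> b = Ident C t"
      "is_iso C a" "is_iso C b" by (rule Shift_ess_surjE[OF tO]) (rule that)
    have "isomorphic C t (Shift C w)" using w isomorphicI[of b t "Shift C w"] by simp
    then have wX: "w \<in> X" using triangulated_subcategoryD(3,4)[OF X] w(1) t(1) by blast
    obtain p' where p': "p' \<in> Arr C" "Dom C p' = c" "Cod C p' = w" "b \<cdot> p = Shift_arr C p'"
      by (rule Shift_arr_full[of "b \<cdot> p" c w]) (use w pq cO in auto)
    obtain q' where q': "q' \<in> Arr C" "Dom C q' = w" "Cod C q' = x" "q \<cdot> a = Shift_arr C q'"
      by (rule Shift_arr_full[of "q \<cdot> a" w x]) (use w pq x in auto)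
    have "Shift_arr C (q' \<cdot> p') = (q \<cdot> a) \<cdot> (b \<cdot> p)" using p'(1-3) q'(1-3) by (simp add: p'(4) q'(4))
    also have "\<dots> = Shift_arr C f" unfolding e using w(1-8) pq by (simp add: Comp_reassoc[OF w(9)])
    finally have "Shift_arr C (q' \<cdot> p') = Shift_arr C f" .
    then have "q' \<cdot> p' = f" by (rule Shift_arr_inject[rotated -1]) (use f p' q' in auto)
    then show "\<exists>t\<in>X. factors_through f t"
      using factors_throughI[of p' c w q' x] p' q' wX by auto
  qed
next
  note tri = localizing_subcategoryD(1)[OF L]
  note K = relatively_compact_triangulated[OF tri]
  assume a: "locally_factors L X x"
  have SL: "Shift C x \<in> L" using a triangulated_subcategoryD(4)[OF tri x] unfolding locally_factors_def by blast
  show "locally_factors L X (Shift C x)"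
  proof (rule locally_factorsI[OF SL])
    fix c f assume c: "relatively_compact L c" and f: "f \<in> Arr C" "Dom C f = c" "Cod C f = Shift C x"
    have cO: "c \<in> Obj C" using f by auto
    obtain w a b where w: "w \<in> Obj C" "a \<in> Arr C" "Dom C a = Shift C w" "Cod C a = c" "b \<in> Arr C"
      "Dom C b = c" "Cod C b = Shift C w" "b \<cdot> a = Ident C (Shift C w)" "a \<cdot> b = Ident C c"
      "is_iso C a" "is_iso C b" by (rule Shift_ess_surjE[OF cO]) (rule that)
    have "isomorphic C c (Shift C w)" using w isomorphicI[of b c "Shift C w"] by simp
    then have wK: "relatively_compact L w"
      using triangulated_subcategoryD(3,4)[OF K] w(1) c by blast
    obtain g where g: "g \<in> Arr C" "Dom C g = w" "Cod C g = x" "f \<cdot> a = Shift_arr C g"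
      by (rule Shift_arr_full[of "f \<cdot> a" w x]) (use w f x in auto)
    obtain t where t: "t \<in> X" "factors_through g t"
      by (rule locally_factorsD[OF \<open>locally_factors L X x\<close> wK, of g]) (use g that in auto)
    have "factors_through (Shift_arr C g \<cdot> b) (Shift C t)"
      by (rule factors_through_Comp(2)[OF factors_through_Shift[OF t(2)]]) (use g w in auto)
    moreover have "Shift_arr C g \<cdot> b = f" using g(4)[symmetric] f w by simp
    moreover have "Shift C t \<in> X"
      using t(1) triangulated_subcategoryD(1)[OF X] triangulated_subcategoryD(4)[OF X, of t] by blast
    ultimately show "\<exists>t\<in>X. factors_through f t" by auto
  qed
qed

text \<open>The idea: subtracting from \<open>u : c \<rightarrow> z\<close> a map through an object \<open>v\<close> of \<open>X\<close> makes it lift along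
  \<open>g : y \<rightarrow> z\<close>. Factoring \<open>h \<cdot> u\<close> through \<open>t \<in> X\<close> is not enough, since \<open>t \<rightarrow> Shift x \<rightarrow> Shift y\<close> need not
  vanish; \<open>v\<close> is the fibre of a map out of \<open>t\<close> that makes it vanish.\<close>

lemma locally_factors_cone:
  assumes D: "dist_triangle C x y z f g h" and x: "locally_factors L X x" and y: "locally_factors L X y"
  shows "locally_factors L X z"
proof -
  note tri = localizing_subcategoryD(1)[OF L]
  note K = relatively_compact_triangulated[OF tri]
  note d = triangleD[OF D]
  have Sx: "locally_factors L X (Shift C x)" using locally_factors_Shift[OF d(10)] x by simp
  have Sy: "locally_factors L X (Shift C y)" using locally_factors_Shift[OF d(11)] y by simp
  have zL: "z \<in> L"
    using triangulated_subcategoryD(5)[OF tri D] x y unfolding locally_factors_def by blast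
  show ?thesis
  proof (rule locally_factorsI[OF zL])
    fix c u assume c: "relatively_compact L c" and u: "u \<in> Arr C" "Dom C u = c" "Cod C u = z"
    have cO: "c \<in> Obj C" using u by auto
    obtain t where t: "t \<in> X" "factors_through (h \<cdot> u) t"
      by (rule locally_factorsD[OF Sx c, of "h \<cdot> u"]) (use u d that in auto)
    obtain a b where ab: "a \<in> Arr C" "Dom C a = c" "Cod C a = t" "b \<in> Arr C" "Dom C b = t"
      "Cod C b = Shift C x" and hu: "h \<cdot> u = b \<cdot> a"
      by (rule factors_through_typedE[OF t(2), of c "Shift C x"]) (simp add: u d, simp add: u d, rule that)
    have tO: "t \<in> Obj C" using ab by auto
    \<comment> \<open>The obstruction \<open>Shift_arr C f \<cdot> b\<close> kills \<open>a\<close>,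
      so it descends to a map \<open>k\<close> on the cone \<open>e\<close> of \<open>a\<close>.
      This cone is again compact relative to \<open>L\<close>, hence \<open>k\<close> factors
      through \<open>X\<close> as well.\<close>
    obtain e a2 a3 where E: "dist_triangle C c t e a a2 a3" using TR1_cone[of a c t] ab by auto
    note ed = triangleD[OF E]
    have eK: "relatively_compact L e" using triangulated_subcategoryD(5)[OF K E] c XK[OF t(1)] by simp
    have fh: "Shift_arr C f \<cdot> h = Zero C z (Shift C y)"
      using triangle_Comp_zero[OF rotate[OF rotate[OF D]]] d by (simp add: neg_eq_Zero_iff)
    have "(Shift_arr C f \<cdot> b) \<cdot> a = Shift_arr C f \<cdot> (h \<cdot> u)" unfolding hu using ab d by simp
    also have "\<dots> = Zero C c (Shift C y)" using u d by (simp add: Comp_reassoc[OF fh])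
    finally have "(Shift_arr C f \<cdot> b) \<cdot> a = Zero C c (Shift C y)" .
    then obtain k where k: "k \<in> Arr C" "Dom C k = e" "Cod C k = Shift C y" "k \<cdot> a2 = Shift_arr C f \<cdot> b"
      by (rule triangle_extend[OF E, rotated]) (use ab d that in auto)
    obtain t' where t': "t' \<in> X" "factors_through k t'"
      by (rule locally_factorsD[OF Sy eK, of k]) (use k that in auto)
    obtain k1 k2 where kk: "k1 \<in> Arr C" "Dom C k1 = e" "Cod C k1 = t'" "k2 \<in> Arr C" "Dom C k2 = t'"
      "Cod C k2 = Shift C y" and k12: "k = k2 \<cdot> k1"
      by (rule factors_through_typedE[OF t'(2) k(2,3)]) (rule that)
    \<comment> \<open>The fibre of \<open>t -> e -> t'\<close> stays in \<open>X\<close>. The map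
      \<open>a\<close> lifts to it because \<open>a2 \<cdot> a\<close> is zero, and on it the
      obstruction vanishes because it factors over \<open>k1 \<cdot> a2\<close>.\<close>
    have mh: "k1 \<cdot> a2 \<in> Hom C t t'" using kk ed by simp
    obtain v w w3 where V: "dist_triangle C v t t' w (k1 \<cdot> a2) w3"
      by (rule fibre_exists[OF mh]) (rule that)
    note vd = triangleD[OF V]
    have vX: "v \<in> X" by (rule triangulated_subcategory_first[OF X V t(1) t'(1)])
    have "(k1 \<cdot> a2) \<cdot> a = Zero C c t'"
      using kk ed triangle_Comp_zero[OF E] by simp
    then obtain a' where a': "a' \<in> Arr C" "Dom C a' = c" "Cod C a' = v" "w \<cdot> a' = a"
      by (rule triangle_lift[OF V, rotated]) (use ab that in auto)
    have mw: "(k1 \<cdot> a2) \<cdot> w = Zero C v t'" by (rule triangle_Comp_zero[OF V])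
    have "Shift_arr C f \<cdot> (b \<cdot> w) = (k \<cdot> a2) \<cdot> w" unfolding k(4) using ab vd d by simp
    also have "\<dots> = k2 \<cdot> ((k1 \<cdot> a2) \<cdot> w)" unfolding k12 using kk ed vd by simp
    also have "\<dots> = Zero C v (Shift C y)" unfolding mw using kk vd by simp
    finally have "neg C (Shift_arr C f) \<cdot> (b \<cdot> w) = Zero C v (Shift C y)"
      using ab vd d by simp
    then obtain q where q: "q \<in> Arr C" "Dom C q = v" "Cod C q = z" "h \<cdot> q = b \<cdot> w"
      by (rule triangle_lift[OF rotate[OF rotate[OF D]], rotated]) (use ab vd that in auto)
    \<comment> \<open>\<open>q \<cdot> a'\<close> is the correction: it factors through
      \<open>v\<close> and agrees with \<open>u\<close> after \<open>h\<close>, so the difference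
      lifts along \<open>g\<close> to a map into \<open>y\<close>.\<close>
    have hq: "h \<cdot> (q \<cdot> a') = h \<cdot> u"
      using Comp_reassoc[OF q(4), of a'] q(1-3) a' d ab(1-6) vd hu by simp
    have "h \<cdot> (u \<oplus>\<^sub>h neg C (q \<cdot> a')) = Zero C c (Shift C x)"
    proof -
      have "h \<cdot> (u \<oplus>\<^sub>h neg C (q \<cdot> a')) = (h \<cdot> u) \<oplus>\<^sub>h neg C (h \<cdot> (q \<cdot> a'))"
        using u q(1-3) a'(1-3) d by simp
      also have "\<dots> = Zero C c (Shift C x)" unfolding hq using u d by simp
      finally show ?thesis .
    qed
    then obtain r where r: "r \<in> Arr C" "Dom C r = c" "Cod C r = y" "g \<cdot> r = u \<oplus>\<^sub>h neg C (q \<cdot> a')"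
      by (rule triangle_lift[OF rotate[OF D], rotated]) (use u q a' that in auto)
    obtain s where s: "s \<in> X" "factors_through r s"
      by (rule locally_factorsD[OF y c, of r]) (use r that in auto)
    have "factors_through (g \<cdot> r) s"
      by (rule factors_through_Comp(1)[OF s(2)]) (use r d in auto)
    moreover have "factors_through (q \<cdot> a') v"
      by (rule factors_throughI[of _ c _ _ z]) (use q a' in auto)
    ultimately have "\<exists>s\<in>X. factors_through ((g \<cdot> r) \<oplus>\<^sub>h (q \<cdot> a')) s"
      by (rule factors_through_Add_closed[OF X s(1) vX, of _ _ c z]) (use r(1-3) d q a' in auto)
    moreover have "(g \<cdot> r) \<oplus>\<^sub>h (q \<cdot> a') = u"
      unfolding r(4) by (rule diff_Add_cancel) (use u q a' in auto)
    ultimately show "\<exists>t\<in>X. factors_through u t" by simp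
  qed
qed

text \<open>Compactness of the source breaks a map into finitely many terms, each through one
  \<open>x k\<close> and hence through \<open>X\<close>; a sum of two factorizations passes through
  a biproduct in \<open>X\<close>.\<close>

lemma locally_factors_coproduct:
  assumes I: "small I" and x: "\<And>k. k \<in> I \<Longrightarrow> locally_factors L X (x k)" and cp: "is_coproduct C I x s \<iota>"
  shows "locally_factors L X s"
proof -
  have xL: "x k \<in> L" if "k \<in> I" for k using x[OF that] unfolding locally_factors_def by blast
  note D = coproductD[OF cp]
  obtain z where z: "is_zero_object C z" using zero_object_exists by blast
  then have zO: "z \<in> Obj C" by (simp add: zero_object_iff)
  show ?thesis
  proof (rule locally_factorsI)
    show "s \<in> L" by (rule localizing_subcategoryD(2)[OF L I xL cp])
    fix c f assume c: "relatively_compact L c" and f: "f \<in> Arr C" "Dom C f = c" "Cod C f = s"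
    have cO: "c \<in> Obj C" using f by auto
    have "finite_sum I x \<iota> c s f"
      by (rule relatively_compactD[OF c I xL cp]) (use f in auto)
    then show "\<exists>t\<in>X. factors_through f t"
    proof induction
      case zero
      have "Zero C c s = Zero C z s \<cdot> Zero C c z" using zO cO D(1) by simp
      then have "factors_through (Zero C c s) z"
        using factors_throughI[of "Zero C c z" c z "Zero C z s" s] zO cO D(1) by simp
      then show ?case using triangulated_subcategoryD(2)[OF X z] by blast
    next
      case (add f k \<phi>)
      obtain t where t: "t \<in> X" "factors_through f t" using add.IH by blast
      obtain u where u: "u \<in> X" "factors_through \<phi> u"
        by (rule locally_factorsD[OF x[OF add(2)] c add(3)]) (rule that)
      have "factors_through (\<iota> k \<cdot> \<phi>) u"
        by (rule factors_through_Comp(1)[OF u(2)]) (use add(3) D(2-4)[OF add(2)] in auto)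
      then show ?case
        by (rule factors_through_Add_closed[OF X t(1) u(1) t(2), of _ c s])
          (use finite_sum_Hom[OF cp cO add(1)] add(3) D(2-4)[OF add(2)] in auto)
    qed
  qed
qed

lemma locally_factors_localizing:
  "localizing_subcategory small C {y. locally_factors L X y}"
proof -
  note tri = localizing_subcategoryD(1)[OF L]
  note LD = triangulated_subcategoryD[OF tri]
  have memL: "y \<in> L" if "locally_factors L X y" for y using that unfolding locally_factors_def by blast
  show ?thesis
    unfolding localizing_subcategory_def triangulated_subcategory_def
  proof (intro conjI allI impI ballI; (elim conjE)?)
    show "{y. locally_factors L X y} \<subseteq> Obj C" using memL LD(1) by blast
  next
    fix z assume z: "is_zero_object C z"
    have "locally_factors L X z"
    proof (rule locally_factorsI[OF LD(2)[OF z]])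
      fix c f assume f: "f \<in> Arr C" "Dom C f = c" "Cod C f = z"
      then have "factors_through (Ident C z \<cdot> f) z"
        by (intro factors_throughI[of _ c _ _ z]) auto
      then show "\<exists>t\<in>X. factors_through f t" using f triangulated_subcategoryD(2)[OF X z] by auto
    qed
    then show "z \<in> {y. locally_factors L X y}" by simp
  next
    fix x y assume x: "x \<in> {y. locally_factors L X y}" and "isomorphic C x y"
    from this(2) obtain a b where ab: "a \<in> Arr C" "Dom C a = x" "Cod C a = y" "b \<in> Arr C" "Dom C b = y"
      "Cod C b = x" "b \<cdot> a = Ident C x" "a \<cdot> b = Ident C y" "is_iso C a" "is_iso C b"
      by (rule isomorphicE) (rule that)
    have "locally_factors L X y"
    proof (rule locally_factorsI)
      show "y \<in> L" using memL x LD(3)[OF \<open>isomorphic C x y\<close>] by blast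
      fix c f assume c: "relatively_compact L c" and f: "f \<in> Arr C" "Dom C f = c" "Cod C f = y"
      obtain t where t: "t \<in> X" "factors_through (b \<cdot> f) t"
        by (rule locally_factorsD[OF _ c, of X x "b \<cdot> f"]) (use x f ab that in auto)
      have "factors_through (a \<cdot> (b \<cdot> f)) t"
        by (rule factors_through_Comp(1)[OF t(2)]) (use f ab in auto)
      then show "\<exists>t\<in>X. factors_through f t"
        using t(1) f ab(1-7) Comp_reassoc[OF ab(8), of f] by auto
    qed
    then show "y \<in> {y. locally_factors L X y}" by simp
  next
    fix x assume "x \<in> Obj C"
    then show "Shift C x \<in> {y. locally_factors L X y} \<longleftrightarrow> x \<in> {y. locally_factors L X y}"
      using locally_factors_Shift by simp
  next
    fix x y z f g h assume "dist_triangle C x y z f g h" "x \<in> {y. locally_factors L X y}"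
      "y \<in> {y. locally_factors L X y}"
    then show "z \<in> {y. locally_factors L X y}" using locally_factors_cone by simp
  next
    fix I x s \<iota> assume "small I" "\<forall>k\<in>I. x k \<in> {y. locally_factors L X y}" "is_coproduct C I x s \<iota>"
    then show "s \<in> {y. locally_factors L X y}" using locally_factors_coproduct[of I x s \<iota>] by simp
  qed
qed

end

theorem relatively_compact_Loc_iff:
  assumes GO: "\<G> \<subseteq> Obj C" and G: "\<And>c. c \<in> \<G> \<Longrightarrow> compact_object small C c"
  shows "relatively_compact (Loc small C \<G>) c \<longleftrightarrow> (\<exists>t \<in> triangulated_hull \<G>. summand c t)"
proof
  let ?L = "Loc small C \<G>" and ?X = "triangulated_hull \<G>"
  note L = Loc_localizing[OF GO]
  note tri = localizing_subcategoryD(1)[OF L]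
  note LO = triangulated_subcategoryD(1)[OF tri]
  note X = triangulated_hull_triangulated[OF GO]
  have "\<G> \<subseteq> {c. relatively_compact ?L c}"
    using compact_imp_relatively_compact G Loc_superset by blast
  then have XK: "?X \<subseteq> {c. relatively_compact ?L c}"
    by (rule triangulated_hull_subset[OF relatively_compact_triangulated[OF tri]])
  {
    assume c: "relatively_compact ?L c"
    then have cL: "c \<in> ?L" unfolding relatively_compact_def by blast
    then have cO: "c \<in> Obj C" using LO by blast
    have "localizing_subcategory small C {y. locally_factors ?L ?X y}"
      by (rule locally_factors_localizing[OF L X]) (use XK in blast)
    moreover have "\<G> \<subseteq> {y. locally_factors ?L ?X y}"
    proof
      fix y assume y: "y \<in> \<G>"
      then have yX: "y \<in> ?X" using triangulated_hull_superset by blast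
      have "locally_factors ?L ?X y"
      proof (rule locally_factorsI)
        show "y \<in> ?L" using y Loc_superset by blast
        fix c f assume f: "f \<in> Arr C" "Dom C f = c" "Cod C f = y"
        then have "factors_through (Ident C y \<cdot> f) y"
          by (intro factors_throughI[of _ c _ _ y]) auto
        then show "\<exists>t\<in>?X. factors_through f t" using f yX by auto
      qed
      then show "y \<in> {y. locally_factors ?L ?X y}" by simp
    qed
    ultimately have "?L \<subseteq> {y. locally_factors ?L ?X y}" by (rule Loc_subset)
    then have cf: "locally_factors ?L ?X c" using cL by blast
    obtain t where t: "t \<in> ?X" "factors_through (Ident C c) t"
      by (rule locally_factorsD[OF cf c, of "Ident C c"]) (use cO that in auto)
    obtain i p where ip: "i \<in> Arr C" "Dom C i = c" "Cod C i = t" "p \<in> Arr C" "Dom C p = t"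
      "Cod C p = c" and e: "Ident C c = p \<cdot> i"
      by (rule factors_through_typedE[OF t(2), of c c]) (simp add: cO, simp add: cO, rule that)
    have "summand c t" unfolding summand_def using ip e by (intro bexI[of _ i] bexI[of _ p]) auto
    then show "\<exists>t \<in> ?X. summand c t" using t(1) by blast
  next
    assume "\<exists>t \<in> ?X. summand c t"
    then obtain t where t: "t \<in> ?X" "summand c t" by blast
    have tK: "relatively_compact ?L t" using XK t(1) by blast
    then have "t \<in> ?L" unfolding relatively_compact_def by blast
    \<comment> \<open>Here the swindle enters: localizing subcategories are not assumed to contain
      the summands of their objects.\<close>
    then have "c \<in> ?L" using localizing_subcategory_summand[OF L _ t(2)] by blast
    then show "relatively_compact ?L c" by (rule relatively_compact_summand[OF LO tK t(2)])
  }
qed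

end

section \<open>Invertible objects\<close>

context symmetric_monoidal_category
begin

declare Tens_Obj [simp] Unit_Obj [simp] Tens_Ident [simp] Assoc_iso [simp] Lunit_iso [simp] Runit_iso [simp]

lemma Tens_arr_simps [simp]:
  assumes "f \<in> Arr C" "g \<in> Arr C"
  shows "f \<boxtimes>\<^sub>a g \<in> Arr C" "Dom C (f \<boxtimes>\<^sub>a g) = Dom C f \<boxtimes> Dom C g" "Cod C (f \<boxtimes>\<^sub>a g) = Cod C f \<boxtimes> Cod C g"
  using Tens_arr_Hom[of f "Dom C f" "Cod C f" g "Dom C g" "Cod C g"] assms by auto

lemma Tens_Comp_arr:
  assumes "f \<in> Arr C" "f' \<in> Arr C" "g \<in> Arr C" "g' \<in> Arr C" "Dom C f' = Cod C f" "Dom C g' = Cod C g"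
  shows "(f' \<boxtimes>\<^sub>a g') \<cdot> (f \<boxtimes>\<^sub>a g) = (f' \<cdot> f) \<boxtimes>\<^sub>a (g' \<cdot> g)"
  using Tens_Comp[of f "Dom C f" "Cod C f" f' "Cod C f'" g "Dom C g" "Cod C g" g' "Cod C g'"] assms by auto

lemma unitor_simps [simp]:
  assumes "x \<in> Obj C"
  shows "Lunit C x \<in> Arr C" "Dom C (Lunit C x) = \<one>\<^sub>t \<boxtimes> x" "Cod C (Lunit C x) = x"
    "Runit C x \<in> Arr C" "Dom C (Runit C x) = x \<boxtimes> \<one>\<^sub>t" "Cod C (Runit C x) = x"
  using Lunit_Hom[of x] Runit_Hom[of x] assms by auto

lemma Braid_Assoc_simps [simp]:
  assumes "x \<in> Obj C" "y \<in> Obj C"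
  shows "Braid C x y \<in> Arr C" "Dom C (Braid C x y) = x \<boxtimes> y" "Cod C (Braid C x y) = y \<boxtimes> x"
    "z \<in> Obj C \<Longrightarrow> Assoc C x y z \<in> Arr C"
    "z \<in> Obj C \<Longrightarrow> Dom C (Assoc C x y z) = (x \<boxtimes> y) \<boxtimes> z"
    "z \<in> Obj C \<Longrightarrow> Cod C (Assoc C x y z) = x \<boxtimes> (y \<boxtimes> z)"
  using Braid_Hom[of x y] Assoc_Hom[of x y z] assms by auto

lemma is_iso_Tens:
  assumes "is_iso C f" "is_iso C g"
  shows "is_iso C (f \<boxtimes>\<^sub>a g)"
proof -
  obtain f' where f': "f \<in> Arr C" "f' \<in> Arr C" "Dom C f' = Cod C f" "Cod C f' = Dom C f"
    "f' \<cdot> f = Ident C (Dom C f)" "f \<cdot> f' = Ident C (Cod C f)" using assms is_isoE by metis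
  obtain g' where g': "g \<in> Arr C" "g' \<in> Arr C" "Dom C g' = Cod C g" "Cod C g' = Dom C g"
    "g' \<cdot> g = Ident C (Dom C g)" "g \<cdot> g' = Ident C (Cod C g)" using assms is_isoE by metis
  show ?thesis
    by (rule is_isoI[of _ "Dom C f \<boxtimes> Dom C g" "Cod C f \<boxtimes> Cod C g" "f' \<boxtimes>\<^sub>a g'"])
      (use f' g' in \<open>auto simp: Tens_Comp_arr\<close>)
qed

lemma isomorphic_Tens:
  "isomorphic C x x' \<Longrightarrow> isomorphic C y y' \<Longrightarrow> isomorphic C (x \<boxtimes> y) (x' \<boxtimes> y')"
  unfolding isomorphic_def using is_iso_Tens Tens_arr_Hom by metis

lemma isomorphic_Braid: "x \<in> Obj C \<Longrightarrow> y \<in> Obj C \<Longrightarrow> isomorphic C (x \<boxtimes> y) (y \<boxtimes> x)"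
  by (rule isomorphicI[of "Braid C x y"], rule is_isoI[of _ _ _ "Braid C y x"])
    (auto simp: Braid_symmetric)

text \<open>By \<open>Lunit\<close>, tensoring with the unit is naturally isomorphic to the
  identity. Coherence equations can thus be checked after one more tensor factor, where
  \<open>pentagon\<close> and \<open>triangle\<close> apply.\<close>

lemma Unit_Tens_faithful:
  assumes "f \<in> Hom C x y" "g \<in> Hom C x y" "Ident C \<one>\<^sub>t \<boxtimes>\<^sub>a f = Ident C \<one>\<^sub>t \<boxtimes>\<^sub>a g"
  shows "f = g"
proof -
  have o: "x \<in> Obj C" "y \<in> Obj C" using Hom_Obj[OF assms(1)] by auto
  have "f \<cdot> Lunit C x = g \<cdot> Lunit C x"
    using Lunit_natural[OF assms(1)] Lunit_natural[OF assms(2)] assms(3) by simp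
  then show ?thesis
    by (rule iso_cancel[OF Lunit_iso, rotated -1]) (use o assms in auto)
qed

lemma Tens_Unit_faithful:
  assumes "f \<in> Hom C x y" "g \<in> Hom C x y" "f \<boxtimes>\<^sub>a Ident C \<one>\<^sub>t = g \<boxtimes>\<^sub>a Ident C \<one>\<^sub>t"
  shows "f = g"
proof -
  have o: "x \<in> Obj C" "y \<in> Obj C" using Hom_Obj[OF assms(1)] by auto
  have "f \<cdot> Runit C x = g \<cdot> Runit C x"
    using Runit_natural[OF assms(1)] Runit_natural[OF assms(2)] assms(3) by simp
  then show ?thesis
    by (rule iso_cancel[OF Runit_iso, rotated -1]) (use o assms in auto)
qed

text \<open>Kelly's argument that the remaining unit coherences follow from \<open>pentagon\<close> and \<open>triangle\<close>.\<close>

lemma Lunit_Tens: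
  assumes x: "x \<in> Obj C" and y: "y \<in> Obj C"
  shows "Lunit C (x \<boxtimes> y) \<cdot> Assoc C \<one>\<^sub>t x y = Lunit C x \<boxtimes>\<^sub>a Ident C y"
proof (rule Unit_Tens_faithful)
  let ?I = "Ident C \<one>\<^sub>t" and ?A = "Assoc C \<one>\<^sub>t (\<one>\<^sub>t \<boxtimes> x) y" and ?B = "Assoc C \<one>\<^sub>t \<one>\<^sub>t x \<boxtimes>\<^sub>a Ident C y"
  have 1: "(?I \<boxtimes>\<^sub>a (Lunit C (x \<boxtimes> y) \<cdot> Assoc C \<one>\<^sub>t x y)) =
      (?I \<boxtimes>\<^sub>a Lunit C (x \<boxtimes> y)) \<cdot> (?I \<boxtimes>\<^sub>a Assoc C \<one>\<^sub>t x y)"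
    using x y by (simp add: Tens_Comp_arr)
  \<comment> \<open>\<open>?A \<cdot> ?B\<close> consists of two edges of the pentagon at unit,
    unit, \<open>x\<close>, \<open>y\<close>; as an isomorphism it can be cancelled at the
    end.\<close>
  have "(?I \<boxtimes>\<^sub>a (Lunit C (x \<boxtimes> y) \<cdot> Assoc C \<one>\<^sub>t x y)) \<cdot> (?A \<cdot> ?B) =
      (?I \<boxtimes>\<^sub>a Lunit C (x \<boxtimes> y)) \<cdot> ((?I \<boxtimes>\<^sub>a Assoc C \<one>\<^sub>t x y) \<cdot> (?A \<cdot> ?B))"
    unfolding 1 using x y by simp
  also have "\<dots> = (?I \<boxtimes>\<^sub>a Lunit C (x \<boxtimes> y)) \<cdot> (Assoc C \<one>\<^sub>t \<one>\<^sub>t (x \<boxtimes> y) \<cdot> Assoc C (\<one>\<^sub>t \<boxtimes> \<one>\<^sub>t) x y)"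
    using pentagon[of "\<one>\<^sub>t" "\<one>\<^sub>t" x y] x y by simp
  also have "\<dots> = (Runit C \<one>\<^sub>t \<boxtimes>\<^sub>a Ident C (x \<boxtimes> y)) \<cdot> Assoc C (\<one>\<^sub>t \<boxtimes> \<one>\<^sub>t) x y"
    using x y by (intro Comp_reassoc[OF triangle]) auto
  also have "\<dots> = Assoc C \<one>\<^sub>t x y \<cdot> ((Runit C \<one>\<^sub>t \<boxtimes>\<^sub>a Ident C x) \<boxtimes>\<^sub>a Ident C y)"
    using Assoc_natural[of "Runit C \<one>\<^sub>t" "\<one>\<^sub>t \<boxtimes> \<one>\<^sub>t" "\<one>\<^sub>t" "Ident C x" x x "Ident C y" y y] x y by simp
  also have "(Runit C \<one>\<^sub>t \<boxtimes>\<^sub>a Ident C x) \<boxtimes>\<^sub>a Ident C y = ((?I \<boxtimes>\<^sub>a Lunit C x) \<boxtimes>\<^sub>a Ident C y) \<cdot> ?B"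
    using x y by (simp add: Tens_Comp_arr triangle)
  also have "Assoc C \<one>\<^sub>t x y \<cdot> (((?I \<boxtimes>\<^sub>a Lunit C x) \<boxtimes>\<^sub>a Ident C y) \<cdot> ?B) =
      ((?I \<boxtimes>\<^sub>a (Lunit C x \<boxtimes>\<^sub>a Ident C y)) \<cdot> ?A) \<cdot> ?B"
    using Assoc_natural[of ?I "\<one>\<^sub>t" "\<one>\<^sub>t" "Lunit C x" "\<one>\<^sub>t \<boxtimes> x" x "Ident C y" y y] x y
    by (intro Comp_reassoc) auto
  also have "\<dots> = (?I \<boxtimes>\<^sub>a (Lunit C x \<boxtimes>\<^sub>a Ident C y)) \<cdot> (?A \<cdot> ?B)" using x y by simp
  finally have e: "(?I \<boxtimes>\<^sub>a (Lunit C (x \<boxtimes> y) \<cdot> Assoc C \<one>\<^sub>t x y)) \<cdot> (?A \<cdot> ?B) =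
      (?I \<boxtimes>\<^sub>a (Lunit C x \<boxtimes>\<^sub>a Ident C y)) \<cdot> (?A \<cdot> ?B)" .
  have "is_iso C (?A \<cdot> ?B)"
    by (intro is_iso_Comp is_iso_Tens) (use x y in \<open>auto intro: is_iso_Ident\<close>)
  then show "?I \<boxtimes>\<^sub>a (Lunit C (x \<boxtimes> y) \<cdot> Assoc C \<one>\<^sub>t x y) = ?I \<boxtimes>\<^sub>a (Lunit C x \<boxtimes>\<^sub>a Ident C y)"
    by (rule iso_cancel[OF _ _ _ _ _ e]) (use x y in auto)
qed (use x y in auto)

text \<open>Naturality of \<open>Lunit\<close> at its own component at the unit gives \<open>Ident C
  \<one>\<^sub>t \<boxtimes>\<^sub>a Lunit C \<one>\<^sub>t = Lunit C (\<one>\<^sub>t \<boxtimes>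
  \<one>\<^sub>t)\<close>. Then \<open>Lunit_Tens\<close> and \<open>triangle\<close> have the same
  left-hand side.\<close>

lemma Lunit_Unit_Runit: "Lunit C \<one>\<^sub>t = Runit C \<one>\<^sub>t"
proof (rule Tens_Unit_faithful)
  let ?I = "Ident C \<one>\<^sub>t"
  have "Lunit C \<one>\<^sub>t \<cdot> (?I \<boxtimes>\<^sub>a Lunit C \<one>\<^sub>t) = Lunit C \<one>\<^sub>t \<cdot> Lunit C (\<one>\<^sub>t \<boxtimes> \<one>\<^sub>t)"
    by (rule Lunit_natural) auto
  then have "?I \<boxtimes>\<^sub>a Lunit C \<one>\<^sub>t = Lunit C (\<one>\<^sub>t \<boxtimes> \<one>\<^sub>t)"
    by (rule iso_cancel_left[OF Lunit_iso, rotated -1]) auto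
  then show "Lunit C \<one>\<^sub>t \<boxtimes>\<^sub>a ?I = Runit C \<one>\<^sub>t \<boxtimes>\<^sub>a ?I"
    using Lunit_Tens[of "\<one>\<^sub>t" "\<one>\<^sub>t"] triangle[of "\<one>\<^sub>t" "\<one>\<^sub>t"] by simp
qed auto

text \<open>The unit is its own dual, with the unitor as evaluation and its inverse as coevaluation.
  Through \<open>compact_iff_dualizable\<close> this makes the unit compact.\<close>

lemma dualizable_Unit: "dualizable C \<one>\<^sub>t"
proof -
  let ?I = "Ident C \<one>\<^sub>t" and ?l = "Lunit C \<one>\<^sub>t" and ?A = "Assoc C \<one>\<^sub>t \<one>\<^sub>t \<one>\<^sub>t"
  obtain n where n: "n \<in> Arr C" "Dom C n = \<one>\<^sub>t" "Cod C n = \<one>\<^sub>t \<boxtimes> \<one>\<^sub>t" "?l \<cdot> n = ?I"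
    using is_isoE[OF Lunit_iso[OF Unit_Obj]] by (metis unitor_simps(2,3) Unit_Obj)
  obtain \<beta> where \<beta>: "inverse_arrows C ?A \<beta>" using Assoc_iso[of "\<one>\<^sub>t" "\<one>\<^sub>t" "\<one>\<^sub>t"] unfolding is_iso_def by auto
  then have b: "\<beta> \<in> Arr C" "Dom C \<beta> = \<one>\<^sub>t \<boxtimes> (\<one>\<^sub>t \<boxtimes> \<one>\<^sub>t)" "Cod C \<beta> = (\<one>\<^sub>t \<boxtimes> \<one>\<^sub>t) \<boxtimes> \<one>\<^sub>t"
    "?A \<cdot> \<beta> = Ident C (\<one>\<^sub>t \<boxtimes> (\<one>\<^sub>t \<boxtimes> \<one>\<^sub>t))" unfolding inverse_arrows_def by auto
  have t: "(?I \<boxtimes>\<^sub>a ?l) \<cdot> ?A = ?l \<boxtimes>\<^sub>a ?I" using triangle[of "\<one>\<^sub>t" "\<one>\<^sub>t"] by (simp add: Lunit_Unit_Runit)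
  have ln: "(?l \<boxtimes>\<^sub>a ?I) \<cdot> (n \<boxtimes>\<^sub>a ?I) = Ident C (\<one>\<^sub>t \<boxtimes> \<one>\<^sub>t)" "(?I \<boxtimes>\<^sub>a ?l) \<cdot> (?I \<boxtimes>\<^sub>a n) = Ident C (\<one>\<^sub>t \<boxtimes> \<one>\<^sub>t)"
    using n by (simp_all add: Tens_Comp_arr)
  have 1: "Runit C \<one>\<^sub>t \<cdot> (?I \<boxtimes>\<^sub>a ?l) \<cdot> ?A \<cdot> (n \<boxtimes>\<^sub>a ?I) = ?l"
  proof -
    have "(?I \<boxtimes>\<^sub>a ?l) \<cdot> ?A \<cdot> (n \<boxtimes>\<^sub>a ?I) = (?l \<boxtimes>\<^sub>a ?I) \<cdot> (n \<boxtimes>\<^sub>a ?I)"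
      by (rule Comp_reassoc[OF t]) (use n in auto)
    then show ?thesis unfolding ln(1) by (simp add: Lunit_Unit_Runit)
  qed
  have 2: "Lunit C \<one>\<^sub>t \<cdot> (?l \<boxtimes>\<^sub>a ?I) \<cdot> \<beta> \<cdot> (?I \<boxtimes>\<^sub>a n) = Runit C \<one>\<^sub>t"
  proof -
    have "(?l \<boxtimes>\<^sub>a ?I) \<cdot> \<beta> = (?I \<boxtimes>\<^sub>a ?l) \<cdot> (?A \<cdot> \<beta>)" unfolding t[symmetric] using b(1-3) by simp
    then have lb: "(?l \<boxtimes>\<^sub>a ?I) \<cdot> \<beta> = ?I \<boxtimes>\<^sub>a ?l" unfolding b(4) by simp
    have "(?l \<boxtimes>\<^sub>a ?I) \<cdot> \<beta> \<cdot> (?I \<boxtimes>\<^sub>a n) = (?I \<boxtimes>\<^sub>a ?l) \<cdot> (?I \<boxtimes>\<^sub>a n)"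
      by (rule Comp_reassoc[OF lb]) (use n b in auto)
    then show ?thesis unfolding ln(2) by (simp add: Lunit_Unit_Runit)
  qed
  show ?thesis
    unfolding dualizable_def
    by (intro conjI bexI[of _ "\<one>\<^sub>t"] bexI[of _ n] bexI[of _ ?l] exI[of _ \<beta>])
      (use 1 2 \<beta> n in auto)
qed

definition tens_inverse :: "'o \<Rightarrow> 'o \<Rightarrow> bool" where
  "tens_inverse x y \<longleftrightarrow> x \<in> Obj C \<and> y \<in> Obj C \<and> isomorphic C (x \<boxtimes> y) \<one>\<^sub>t"

lemma tens_inverse_sym: "tens_inverse x y \<Longrightarrow> tens_inverse y x"
  unfolding tens_inverse_def using isomorphic_Braid isomorphic_trans by blast

text \<open>For inverse objects \<open>y\<close>, \<open>w\<close> the functors \<open>- \<boxtimes> y\<close> and \<open>- \<boxtimes> w\<close> compose to the identity up to the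
  natural isomorphism \<open>\<theta>\<close>.\<close>

lemma tens_inverse_natural_iso:
  assumes "tens_inverse y w"
  obtains \<theta> where "\<And>a. a \<in> Obj C \<Longrightarrow> \<theta> a \<in> Hom C ((a \<boxtimes> y) \<boxtimes> w) a"
    "\<And>a. a \<in> Obj C \<Longrightarrow> is_iso C (\<theta> a)"
    "\<And>a b g. g \<in> Hom C a b \<Longrightarrow> \<theta> b \<cdot> ((g \<boxtimes>\<^sub>a Ident C y) \<boxtimes>\<^sub>a Ident C w) = g \<cdot> \<theta> a"
proof -
  have o: "y \<in> Obj C" "w \<in> Obj C" using assms unfolding tens_inverse_def by auto
  obtain m where m: "m \<in> Arr C" "Dom C m = y \<boxtimes> w" "Cod C m = \<one>\<^sub>t" "is_iso C m"
    using assms unfolding tens_inverse_def isomorphic_def by auto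
  define \<theta> where "\<theta> a = Runit C a \<cdot> ((Ident C a \<boxtimes>\<^sub>a m) \<cdot> Assoc C a y w)" for a
  show ?thesis
  proof (rule that[of \<theta>])
    show "\<theta> a \<in> Hom C ((a \<boxtimes> y) \<boxtimes> w) a" if "a \<in> Obj C" for a
      unfolding \<theta>_def using that o m by simp
    show "is_iso C (\<theta> a)" if "a \<in> Obj C" for a
      unfolding \<theta>_def by (intro is_iso_Comp is_iso_Tens) (use that o m is_iso_Ident in auto)
    show "\<theta> b \<cdot> ((g \<boxtimes>\<^sub>a Ident C y) \<boxtimes>\<^sub>a Ident C w) = g \<cdot> \<theta> a" if g: "g \<in> Hom C a b" for a b g
    proof -
      have ga: "g \<in> Arr C" "Dom C g = a" "Cod C g = b" "a \<in> Obj C" "b \<in> Obj C" using g Hom_Obj[OF g] by auto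
      have "\<theta> b \<cdot> ((g \<boxtimes>\<^sub>a Ident C y) \<boxtimes>\<^sub>a Ident C w) =
          Runit C b \<cdot> ((Ident C b \<boxtimes>\<^sub>a m) \<cdot> (Assoc C b y w \<cdot> ((g \<boxtimes>\<^sub>a Ident C y) \<boxtimes>\<^sub>a Ident C w)))"
        unfolding \<theta>_def using ga o m by simp
      also have "Assoc C b y w \<cdot> ((g \<boxtimes>\<^sub>a Ident C y) \<boxtimes>\<^sub>a Ident C w) =
          (g \<boxtimes>\<^sub>a Ident C (y \<boxtimes> w)) \<cdot> Assoc C a y w"
        using Assoc_natural[OF g, of "Ident C y" y y "Ident C w" w w] o by simp
      also have "(Ident C b \<boxtimes>\<^sub>a m) \<cdot> ((g \<boxtimes>\<^sub>a Ident C (y \<boxtimes> w)) \<cdot> Assoc C a y w) =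
          (g \<boxtimes>\<^sub>a m) \<cdot> Assoc C a y w"
        by (rule Comp_reassoc) (use ga o m in \<open>auto simp: Tens_Comp_arr\<close>)
      also have "g \<boxtimes>\<^sub>a m = (g \<boxtimes>\<^sub>a Ident C \<one>\<^sub>t) \<cdot> (Ident C a \<boxtimes>\<^sub>a m)"
        using ga m by (simp add: Tens_Comp_arr)
      also have "((g \<boxtimes>\<^sub>a Ident C \<one>\<^sub>t) \<cdot> (Ident C a \<boxtimes>\<^sub>a m)) \<cdot> Assoc C a y w =
          (g \<boxtimes>\<^sub>a Ident C \<one>\<^sub>t) \<cdot> ((Ident C a \<boxtimes>\<^sub>a m) \<cdot> Assoc C a y w)"
        using ga o m by simp
      also have "Runit C b \<cdot> ((g \<boxtimes>\<^sub>a Ident C \<one>\<^sub>t) \<cdot> ((Ident C a \<boxtimes>\<^sub>a m) \<cdot> Assoc C a y w)) =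
          (g \<cdot> Runit C a) \<cdot> ((Ident C a \<boxtimes>\<^sub>a m) \<cdot> Assoc C a y w)"
        by (rule Comp_reassoc[OF Runit_natural[OF g]]) (use ga o m in auto)
      also have "\<dots> = g \<cdot> \<theta> a" unfolding \<theta>_def using ga o m by simp
      finally show ?thesis .
    qed
  qed
qed

lemma tens_inverse_faithful:
  assumes "tens_inverse y w" "f \<in> Hom C a b" "g \<in> Hom C a b" "f \<boxtimes>\<^sub>a Ident C y = g \<boxtimes>\<^sub>a Ident C y"
  shows "f = g"
proof -
  obtain \<theta> where \<theta>: "\<And>a. a \<in> Obj C \<Longrightarrow> \<theta> a \<in> Hom C ((a \<boxtimes> y) \<boxtimes> w) a"
    "\<And>a. a \<in> Obj C \<Longrightarrow> is_iso C (\<theta> a)"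
    and nat: "\<And>a b g. g \<in> Hom C a b \<Longrightarrow> \<theta> b \<cdot> ((g \<boxtimes>\<^sub>a Ident C y) \<boxtimes>\<^sub>a Ident C w) = g \<cdot> \<theta> a"
    by (rule tens_inverse_natural_iso[OF assms(1)]) (rule that)
  have a: "a \<in> Obj C" using Hom_Obj[OF assms(2)] by blast
  have "f \<cdot> \<theta> a = g \<cdot> \<theta> a" using nat[OF assms(2)] nat[OF assms(3)] assms(4) by simp
  then show ?thesis by (rule iso_cancel[OF \<theta>(2)[OF a], rotated -1]) (use assms(2,3) \<theta>(1)[OF a] in auto)
qed

text \<open>The preimage is \<open>\<psi> \<boxtimes>\<^sub>a Ident C w\<close> transported along
  \<open>\<theta>\<close>. That it tensors to \<open>\<psi>\<close> is checked after tensoring with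
  \<open>w\<close>, which is faithful because \<open>w\<close> has the inverse
  \<open>y\<close>.\<close>

lemma tens_inverse_full:
  assumes yw: "tens_inverse y w" and \<psi>: "\<psi> \<in> Hom C (a \<boxtimes> y) (b \<boxtimes> y)" and a: "a \<in> Obj C" and b: "b \<in> Obj C"
  obtains g where "g \<in> Arr C" "Dom C g = a" "Cod C g = b" "\<psi> = g \<boxtimes>\<^sub>a Ident C y"
proof -
  have o: "y \<in> Obj C" "w \<in> Obj C" using yw unfolding tens_inverse_def by auto
  obtain \<theta> where \<theta>: "\<And>a. a \<in> Obj C \<Longrightarrow> \<theta> a \<in> Hom C ((a \<boxtimes> y) \<boxtimes> w) a"
    "\<And>a. a \<in> Obj C \<Longrightarrow> is_iso C (\<theta> a)"
    and nat: "\<And>a b g. g \<in> Hom C a b \<Longrightarrow> \<theta> b \<cdot> ((g \<boxtimes>\<^sub>a Ident C y) \<boxtimes>\<^sub>a Ident C w) = g \<cdot> \<theta> a"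
    by (rule tens_inverse_natural_iso[OF yw]) (rule that)
  note ta = \<theta>(1)[OF a, unfolded in_Hom] and tb = \<theta>(1)[OF b, unfolded in_Hom]
  note p = \<psi>[unfolded in_Hom]
  obtain t where t: "t \<in> Arr C" "Dom C t = a" "Cod C t = (a \<boxtimes> y) \<boxtimes> w" "t \<cdot> \<theta> a = Ident C ((a \<boxtimes> y) \<boxtimes> w)"
    using is_isoE[OF \<theta>(2)[OF a]] ta by metis
  define g where "g = \<theta> b \<cdot> ((\<psi> \<boxtimes>\<^sub>a Ident C w) \<cdot> t)"
  have g: "g \<in> Arr C" "Dom C g = a" "Cod C g = b" unfolding g_def using tb p t o by auto
  have "\<theta> b \<cdot> ((g \<boxtimes>\<^sub>a Ident C y) \<boxtimes>\<^sub>a Ident C w) = g \<cdot> \<theta> a" by (rule nat) (use g in auto)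
  also have "\<dots> = \<theta> b \<cdot> (\<psi> \<boxtimes>\<^sub>a Ident C w)" unfolding g_def using ta tb p t o by simp
  finally have e: "\<theta> b \<cdot> ((g \<boxtimes>\<^sub>a Ident C y) \<boxtimes>\<^sub>a Ident C w) = \<theta> b \<cdot> (\<psi> \<boxtimes>\<^sub>a Ident C w)" .
  have "(g \<boxtimes>\<^sub>a Ident C y) \<boxtimes>\<^sub>a Ident C w = \<psi> \<boxtimes>\<^sub>a Ident C w"
    by (rule iso_cancel_left[OF \<theta>(2)[OF b] _ _ _ _ e]) (use g o p tb in auto)
  then have "g \<boxtimes>\<^sub>a Ident C y = \<psi>"
    by (rule tens_inverse_faithful[OF tens_inverse_sym[OF yw], rotated -1]) (use g o p in auto)
  then show ?thesis using that g by blast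
qed

end

section \<open>Tensoring coproducts, and compactness of invertible objects\<close>

context closed_symmetric_monoidal_category
begin

text \<open>By \<open>closed\<close>, \<open>- \<boxtimes> y\<close> is a left adjoint and so
  preserves coproducts: families are transposed into the internal hom object, glued there and
  transposed back.\<close>

lemma coproduct_Tens:
  assumes cp: "is_coproduct C I x s \<iota>" and y: "y \<in> Obj C"
  shows "is_coproduct C I (\<lambda>k. x k \<boxtimes> y) (s \<boxtimes> y) (\<lambda>k. \<iota> k \<boxtimes>\<^sub>a Ident C y)"
proof -
  note D = coproductD[OF cp]
  show ?thesis
  proof (rule is_coproductI)
    show "s \<boxtimes> y \<in> Obj C" using D(1) y by simp
    show "\<iota> k \<boxtimes>\<^sub>a Ident C y \<in> Hom C (x k \<boxtimes> y) (s \<boxtimes> y)" if "k \<in> I" for k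
      using D(2-4)[OF that] y by simp
  next
    fix z f assume z: "z \<in> Obj C" and f: "\<And>k. k \<in> I \<Longrightarrow> f k \<in> Hom C (x k \<boxtimes> y) z"
    obtain h ev where h: "h \<in> Obj C" and ev: "ev \<in> Hom C (h \<boxtimes> y) z" and
      adj: "\<And>x f. x \<in> Obj C \<Longrightarrow> f \<in> Hom C (x \<boxtimes> y) z \<Longrightarrow>
        \<exists>!g. g \<in> Hom C x h \<and> ev \<cdot> (g \<boxtimes>\<^sub>a Ident C y) = f"
      using closed[OF y z] by blast
    have "\<exists>g. g \<in> Hom C (x k) h \<and> ev \<cdot> (g \<boxtimes>\<^sub>a Ident C y) = f k" if "k \<in> I" for k
      using adj[OF D(5)[OF that] f[OF that]] by blast
    then obtain g where g: "\<And>k. k \<in> I \<Longrightarrow> g k \<in> Hom C (x k) h"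
      "\<And>k. k \<in> I \<Longrightarrow> ev \<cdot> (g k \<boxtimes>\<^sub>a Ident C y) = f k" by metis
    obtain u where u: "u \<in> Arr C" "Dom C u = s" "Cod C u = h" "\<And>k. k \<in> I \<Longrightarrow> u \<cdot> \<iota> k = g k"
      by (rule coproduct_map[OF cp h g(1)]) (use that in auto)
    have "(ev \<cdot> (u \<boxtimes>\<^sub>a Ident C y)) \<cdot> (\<iota> k \<boxtimes>\<^sub>a Ident C y) = f k" if k: "k \<in> I" for k
      using ev u(1-3) u(4)[OF k] g(2)[OF k] D(2-4)[OF k] y by (simp add: Tens_Comp_arr)
    then show "\<exists>g \<in> Hom C (s \<boxtimes> y) z. \<forall>k\<in>I. g \<cdot> (\<iota> k \<boxtimes>\<^sub>a Ident C y) = f k"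
      using ev u(1-3) y by (intro bexI[of _ "ev \<cdot> (u \<boxtimes>\<^sub>a Ident C y)"]) auto
  next
    fix z g g' assume g: "g \<in> Hom C (s \<boxtimes> y) z" and g': "g' \<in> Hom C (s \<boxtimes> y) z"
      and eq: "\<And>k. k \<in> I \<Longrightarrow> g \<cdot> (\<iota> k \<boxtimes>\<^sub>a Ident C y) = g' \<cdot> (\<iota> k \<boxtimes>\<^sub>a Ident C y)"
    have z: "z \<in> Obj C" using Hom_Obj[OF g] by blast
    obtain h ev where h: "h \<in> Obj C" and ev: "ev \<in> Hom C (h \<boxtimes> y) z" and
      adj: "\<And>x f. x \<in> Obj C \<Longrightarrow> f \<in> Hom C (x \<boxtimes> y) z \<Longrightarrow>
        \<exists>!g. g \<in> Hom C x h \<and> ev \<cdot> (g \<boxtimes>\<^sub>a Ident C y) = f"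
      using closed[OF y z] by blast
    obtain u where u: "u \<in> Hom C s h" "ev \<cdot> (u \<boxtimes>\<^sub>a Ident C y) = g" using adj[OF D(1) g] by blast
    obtain u' where u': "u' \<in> Hom C s h" "ev \<cdot> (u' \<boxtimes>\<^sub>a Ident C y) = g'" using adj[OF D(1) g'] by blast
    have "u = u'"
    proof (rule coproduct_ext[OF cp u(1) u'(1)])
      fix k assume k: "k \<in> I"
      have *: "v \<cdot> \<iota> k \<in> Hom C (x k) h \<and> ev \<cdot> ((v \<cdot> \<iota> k) \<boxtimes>\<^sub>a Ident C y) = (ev \<cdot> (v \<boxtimes>\<^sub>a Ident C y)) \<cdot> (\<iota> k \<boxtimes>\<^sub>a Ident C y)"
        if "v \<in> Hom C s h" for v
        using that D(2-4)[OF k] y ev by (simp add: Tens_Comp_arr)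
      have "g \<cdot> (\<iota> k \<boxtimes>\<^sub>a Ident C y) \<in> Hom C (x k \<boxtimes> y) z" using g D(2-4)[OF k] y by simp
      from adj[OF D(5)[OF k] this] show "u \<cdot> \<iota> k = u' \<cdot> \<iota> k"
        using *[OF u(1)] *[OF u'(1)] eq[OF k] unfolding u(2) u'(2) by metis
    qed
    then show "g = g'" using u(2) u'(2) by simp
  qed
qed

end

sublocale rigidly_compactly_generated \<subseteq> triangulated_category_with_coproducts
  by unfold_locales (rule small_coproducts)

context rigidly_compactly_generated
begin

text \<open>The factor \<open>y\<close> is stripped off term by term, using fullness of
  \<open>- \<boxtimes> y\<close> for each term.\<close>

lemma Tens_left_inverse_finite_sum:
  assumes yw: "tens_inverse y w" and cp: "is_coproduct C I x s \<iota>" and c: "c \<in> Obj C"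
    and "finite_sum I (\<lambda>k. x k \<boxtimes> y) (\<lambda>k. \<iota> k \<boxtimes>\<^sub>a Ident C y) (c \<boxtimes> y) (s \<boxtimes> y) F"
  shows "\<exists>f. finite_sum I x \<iota> c s f \<and> F = f \<boxtimes>\<^sub>a Ident C y"
  using assms(4)
proof induction
  case zero
  have y: "y \<in> Obj C" using yw unfolding tens_inverse_def by blast
  note s = coproductD(1)[OF cp]
  let ?z = "Zero C c s \<boxtimes>\<^sub>a Ident C y"
  have "?z \<oplus>\<^sub>h ?z = (Zero C c s \<oplus>\<^sub>h Zero C c s) \<boxtimes>\<^sub>a Ident C y"
    using Tens_Add_left[of "Zero C c s" c s "Zero C c s" "Ident C y" y y] y s c by simp
  then have "?z = Zero C (c \<boxtimes> y) (s \<boxtimes> y)" using idem_Zero[of ?z] y s c by simp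
  then show ?case using finite_sum.zero[of I x \<iota> c s] by metis
next
  case (add F k \<psi>)
  have y: "y \<in> Obj C" using yw unfolding tens_inverse_def by blast
  note k = coproductD(2-5)[OF cp add(2)]
  obtain f where f: "finite_sum I x \<iota> c s f" "F = f \<boxtimes>\<^sub>a Ident C y" using add.IH by blast
  obtain g where g: "g \<in> Arr C" "Dom C g = c" "Cod C g = x k" "\<psi> = g \<boxtimes>\<^sub>a Ident C y"
    by (rule tens_inverse_full[OF yw add(3) c k(4)]) (rule that)
  have "finite_sum I x \<iota> c s (f \<oplus>\<^sub>h (\<iota> k \<cdot> g))"
    by (rule finite_sum.add[OF f(1) add(2)]) (use g in simp)
  moreover have "F \<oplus>\<^sub>h (\<iota> k \<boxtimes>\<^sub>a Ident C y) \<cdot> \<psi> = (f \<oplus>\<^sub>h (\<iota> k \<cdot> g)) \<boxtimes>\<^sub>a Ident C y"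
    using Tens_Add_left[of f c s "\<iota> k \<cdot> g" "Ident C y" y y] finite_sum_Hom[OF cp c f(1)] g k y f(2)
    by (simp add: Tens_Comp_arr)
  ultimately show ?case by blast
qed

text \<open>An isomorphism from \<open>x \<boxtimes> y\<close> to the unit need not satisfy the
  duality equations, so compactness is transported from the unit instead. A map from
  \<open>x\<close> is tensored with \<open>y\<close>, decomposed there because
  \<open>x \<boxtimes> y\<close> is isomorphic to the unit, and recovered since
  \<open>- \<boxtimes> y\<close> is fully faithful and preserves coproducts.\<close>

lemma invertible_imp_compact:
  assumes xy: "tens_inverse x y"
  shows "compact_object small C x"
proof (rule relatively_compact_imp_compact)
  have o: "x \<in> Obj C" "y \<in> Obj C" using xy unfolding tens_inverse_def by auto
  have yx: "tens_inverse y x" using tens_inverse_sym[OF xy] .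
  have "compact_object small C \<one>\<^sub>t" using compact_iff_dualizable dualizable_Unit by blast
  then have "relatively_compact (Obj C) \<one>\<^sub>t" by (rule compact_imp_relatively_compact) simp
  moreover have "isomorphic C \<one>\<^sub>t (x \<boxtimes> y)" using xy isomorphic_sym unfolding tens_inverse_def by blast
  ultimately have xyK: "relatively_compact (Obj C) (x \<boxtimes> y)"
    using triangulated_subcategoryD(3)[OF relatively_compact_triangulated[OF triangulated_subcategory_Obj]]
    by blast
  show "relatively_compact (Obj C) x"
  proof (rule relatively_compactI[OF o(1)])
    fix I z s \<iota> f
    assume I: "small I" and cp: "is_coproduct C I z s \<iota>" and f: "f \<in> Hom C x s"
    have "finite_sum I (\<lambda>k. z k \<boxtimes> y) (\<lambda>k. \<iota> k \<boxtimes>\<^sub>a Ident C y) (x \<boxtimes> y) (s \<boxtimes> y) (f \<boxtimes>\<^sub>a Ident C y)"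
      by (rule relatively_compactD[OF xyK I _ coproduct_Tens[OF cp o(2)]])
        (use coproductD(5)[OF cp] o f in auto)
    from Tens_left_inverse_finite_sum[OF yx cp o(1) this] obtain g where
      g: "finite_sum I z \<iota> x s g" "f \<boxtimes>\<^sub>a Ident C y = g \<boxtimes>\<^sub>a Ident C y" by blast
    have "f = g"
      by (rule tens_inverse_faithful[OF yx f _ g(2)]) (use finite_sum_Hom[OF cp o(1) g(1)] in auto)
    then show "finite_sum I z \<iota> x s f" using g(1) by simp
  qed
qed

end

section \<open>Thick tensor subcategories and their spectra\<close>

context closed_tt_category
begin

lemma zero_object_Tens:
  assumes z: "is_zero_object C z" and w: "w \<in> Obj C"
  shows "is_zero_object C (z \<boxtimes> w)"
proof -
  have zO: "z \<in> Obj C" and zz: "Ident C z = Zero C z z" using z by (auto simp: zero_object_iff)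
  have "Zero C z z \<oplus>\<^sub>h Zero C z z = Zero C z z" using zO by simp
  then have "Ident C z \<oplus>\<^sub>h Ident C z = Ident C z" unfolding zz .
  then have "Ident C (z \<boxtimes> w) \<oplus>\<^sub>h Ident C (z \<boxtimes> w) = Ident C (z \<boxtimes> w)"
    using Tens_Add_left[of "Ident C z" z z "Ident C z" "Ident C w" w w] zO w by simp
  then have "Ident C (z \<boxtimes> w) = Zero C (z \<boxtimes> w) (z \<boxtimes> w)"
    using idem_Zero[of "Ident C (z \<boxtimes> w)"] zO w by simp
  then show ?thesis using zO w by (simp add: zero_object_iff)
qed

lemma isomorphic_Susp: "x \<in> Obj C \<Longrightarrow> w \<in> Obj C \<Longrightarrow> isomorphic C (Shift C x \<boxtimes> w) (Shift C (x \<boxtimes> w))"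
  using isomorphicI[OF Susp_iso Susp_Hom] .

text \<open>The preimage of a triangulated subcategory under the exact functor
  \<open>- \<boxtimes> w\<close>; this reduces tensor closure of a hull to its generators.\<close>

lemma triangulated_subcategory_Tens:
  assumes X: "triangulated_subcategory C X" and w: "w \<in> Obj C"
  shows "triangulated_subcategory C {x \<in> Obj C. x \<boxtimes> w \<in> X}"
  unfolding triangulated_subcategory_def
proof (intro conjI allI impI ballI; (elim conjE)?)
  note D = triangulated_subcategoryD[OF X]
  show "{x \<in> Obj C. x \<boxtimes> w \<in> X} \<subseteq> Obj C" by blast
  show "z \<in> {x \<in> Obj C. x \<boxtimes> w \<in> X}" if "is_zero_object C z" for z
    using D(2)[OF zero_object_Tens[OF that w]] that by (simp add: zero_object_iff)
  show "y \<in> {x \<in> Obj C. x \<boxtimes> w \<in> X}" if "x \<in> {x \<in> Obj C. x \<boxtimes> w \<in> X}" "isomorphic C x y" for x y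
    using D(3)[OF isomorphic_Tens[OF that(2) isomorphic_refl[OF w]]] that isomorphic_Obj by blast
  show "Shift C x \<in> {x \<in> Obj C. x \<boxtimes> w \<in> X} \<longleftrightarrow> x \<in> {x \<in> Obj C. x \<boxtimes> w \<in> X}" if x: "x \<in> Obj C" for x
    using D(3)[OF isomorphic_Susp[OF x w]] D(3)[OF isomorphic_sym[OF isomorphic_Susp[OF x w]]]
      D(4)[of "x \<boxtimes> w"] x w by auto
  show "z \<in> {x \<in> Obj C. x \<boxtimes> w \<in> X}"
    if "dist_triangle C x y z f g h" "x \<in> {x \<in> Obj C. x \<boxtimes> w \<in> X}" "y \<in> {x \<in> Obj C. x \<boxtimes> w \<in> X}" for x y z f g h
    using D(5)[OF Tens_exact[OF that(1) w]] that triangleD(12)[OF that(1)] by blast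
qed

text \<open>First one factor is kept in \<open>\<G>\<close> while the other runs through the hull,
  then an object of the hull is kept fixed. \<open>Braid\<close> moves the running factor to the
  left, where exactness is available.\<close>

lemma triangulated_hull_Tens:
  assumes GO: "\<G> \<subseteq> Obj C" and G: "\<And>a b. a \<in> \<G> \<Longrightarrow> b \<in> \<G> \<Longrightarrow> a \<boxtimes> b \<in> \<G>"
    and a: "a \<in> triangulated_hull \<G>" and b: "b \<in> triangulated_hull \<G>"
  shows "a \<boxtimes> b \<in> triangulated_hull \<G>"
proof -
  let ?X = "triangulated_hull \<G>"
  note X = triangulated_hull_triangulated[OF GO]
  note D = triangulated_subcategoryD[OF X]
  have 1: "x \<boxtimes> w \<in> ?X" if x: "x \<in> ?X" and w: "w \<in> \<G>" for x w
  proof -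
    have wO: "w \<in> Obj C" using GO w by blast
    have "?X \<subseteq> {x \<in> Obj C. x \<boxtimes> w \<in> ?X}"
      by (rule triangulated_hull_subset[OF triangulated_subcategory_Tens[OF X wO]])
        (use G w GO triangulated_hull_superset in blast)
    then show ?thesis using x by blast
  qed
  have aO: "a \<in> Obj C" and bO: "b \<in> Obj C" using a b D(1) by auto
  have "?X \<subseteq> {x \<in> Obj C. x \<boxtimes> a \<in> ?X}"
  proof (rule triangulated_hull_subset[OF triangulated_subcategory_Tens[OF X aO]], rule subsetI)
    fix x assume x: "x \<in> \<G>"
    then have xO: "x \<in> Obj C" using GO by blast
    show "x \<in> {x \<in> Obj C. x \<boxtimes> a \<in> ?X}"
      using D(3)[OF isomorphic_Braid[OF aO xO] 1[OF a x]] xO by blast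
  qed
  then have "b \<boxtimes> a \<in> ?X" using b by blast
  then show ?thesis using D(3)[OF isomorphic_Braid[OF bO aO]] by blast
qed

lemma summand_Tens:
  assumes "summand a s" "summand b t"
  shows "summand (a \<boxtimes> b) (s \<boxtimes> t)"
proof -
  obtain i p where ip: "i \<in> Arr C" "Dom C i = a" "Cod C i = s" "p \<in> Arr C" "Dom C p = s" "Cod C p = a"
    "p \<cdot> i = Ident C a" using assms(1) unfolding summand_def by auto
  obtain j q where jq: "j \<in> Arr C" "Dom C j = b" "Cod C j = t" "q \<in> Arr C" "Dom C q = t" "Cod C q = b"
    "q \<cdot> j = Ident C b" using assms(2) unfolding summand_def by auto
  have "a \<in> Obj C" "b \<in> Obj C" using ip jq by auto
  then show ?thesis
    unfolding summand_def
    by (intro bexI[of _ "i \<boxtimes>\<^sub>a j"] bexI[of _ "p \<boxtimes>\<^sub>a q"]) (use ip jq in \<open>auto simp: Tens_Comp_arr\<close>)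
qed

text \<open>For such \<open>S\<close> all notions entering \<open>Spc (full_subcategory C S)\<close>
  can be expressed in \<open>C\<close>, so no locale has to be instantiated at the
  subcategory.\<close>

definition thick_tensor_subcategory :: "'o set \<Rightarrow> bool" where
  "thick_tensor_subcategory S \<longleftrightarrow> thick_subcategory C S \<and> \<one>\<^sub>t \<in> S \<and> (\<forall>a\<in>S. \<forall>b\<in>S. a \<boxtimes> b \<in> S)"

lemma thick_tensor_subcategoryD:
  assumes "thick_tensor_subcategory S"
  shows "thick_subcategory C S" "triangulated_subcategory C S" "S \<subseteq> Obj C" "\<one>\<^sub>t \<in> S"
    "a \<in> S \<Longrightarrow> b \<in> S \<Longrightarrow> a \<boxtimes> b \<in> S"
  using assms unfolding thick_tensor_subcategory_def thick_subcategory_def triangulated_subcategory_def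
  by blast+

lemma full_subcategory_Tens [simp]: "Tens (full_subcategory C S) = Tens C"
  unfolding full_subcategory_def by simp

section \<open>Translation of spectra from a full subcategory to the ambient category\<close>

context
  fixes S
  assumes S: "thick_tensor_subcategory S"
begin

lemma is_zero_object_full_subcategory:
  "is_zero_object (full_subcategory C S) z \<longleftrightarrow> z \<in> S \<and> is_zero_object C z"
proof
  note SO = thick_tensor_subcategoryD(3)[OF S]
  assume z: "is_zero_object (full_subcategory C S) z"
  then have zS: "z \<in> S" unfolding is_zero_object_def by simp
  then have "\<exists>!f. f \<in> Hom C z z" using z unfolding is_zero_object_def by (simp add: Hom_full_subcategory)
  moreover have "Ident C z \<in> Hom C z z" "Zero C z z \<in> Hom C z z" using zS SO by auto
  ultimately show "z \<in> S \<and> is_zero_object C z" using zS SO unfolding zero_object_iff by blast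
next
  note SO = thick_tensor_subcategoryD(3)[OF S]
  assume "z \<in> S \<and> is_zero_object C z"
  then show "is_zero_object (full_subcategory C S) z"
    using SO unfolding is_zero_object_def by (auto simp: Hom_full_subcategory subset_iff simp del: in_Hom)
qed

lemma isomorphic_full_subcategory:
  "isomorphic (full_subcategory C S) x y \<longleftrightarrow> x \<in> S \<and> y \<in> S \<and> isomorphic C x y"
proof -
  have "inverse_arrows (full_subcategory C S) f g \<longleftrightarrow> inverse_arrows C f g" if "f \<in> Hom C x y" "x \<in> S" "y \<in> S" for f g
    using that unfolding inverse_arrows_def Hom_full_subcategory full_subcategory_simps
    by (simp add: full_subcategory_def)
  then show ?thesis
    unfolding isomorphic_def is_iso_def Hom_full_subcategory by (auto simp del: in_Hom)
qed

lemma dist_triangle_full_subcategory: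
  "dist_triangle (full_subcategory C S) x y z f g h \<longleftrightarrow>
    x \<in> S \<and> y \<in> S \<and> z \<in> S \<and> dist_triangle C x y z f g h"
proof -
  have "Shift C x \<in> S" if "x \<in> S"
    using that triangulated_subcategoryD(1,4)[OF thick_tensor_subcategoryD(2)[OF S]] by blast
  then show ?thesis
    unfolding dist_triangle_def is_triangle_def Hom_full_subcategory full_subcategory_simps
    by (auto simp: full_subcategory_def split: if_splits)
qed

lemma is_biproduct_full_subcategory:
  "is_biproduct (full_subcategory C S) x y s \<longleftrightarrow> x \<in> S \<and> y \<in> S \<and> s \<in> S \<and> is_biproduct C x y s"
  unfolding is_biproduct_def Hom_full_subcategory full_subcategory_simps by auto

text \<open>\<open>S\<close> is itself closed under isomorphisms, shifts and cones, so every object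
  that the ambient conditions force into \<open>P\<close> is already in \<open>S\<close>, where the
  internal conditions apply.\<close>

lemma triangulated_full_subcategory:
  "triangulated_subcategory (full_subcategory C S) P \<longleftrightarrow> P \<subseteq> S \<and> triangulated_subcategory C P"
proof -
  note D = triangulated_subcategoryD[OF thick_tensor_subcategoryD(2)[OF S]]
  have *: "triangulated_subcategory (full_subcategory C S) P \<longleftrightarrow> P \<subseteq> S \<and>
     (\<forall>z. z \<in> S \<and> is_zero_object C z \<longrightarrow> z \<in> P) \<and>
     (\<forall>x y. x \<in> P \<and> x \<in> S \<and> y \<in> S \<and> isomorphic C x y \<longrightarrow> y \<in> P) \<and>
     (\<forall>x \<in> S. Shift C x \<in> P \<longleftrightarrow> x \<in> P) \<and>
     (\<forall>x y z f g h. x \<in> S \<and> y \<in> S \<and> z \<in> S \<and> dist_triangle C x y z f g h \<and> x \<in> P \<and> y \<in> P \<longrightarrow> z \<in> P)"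
    unfolding triangulated_subcategory_def is_zero_object_full_subcategory isomorphic_full_subcategory
      dist_triangle_full_subcategory full_subcategory_simps by auto
  show ?thesis
  proof
    assume "triangulated_subcategory (full_subcategory C S) P"
    then have P: "P \<subseteq> S" "\<And>z. z \<in> S \<Longrightarrow> is_zero_object C z \<Longrightarrow> z \<in> P"
      "\<And>x y. x \<in> P \<Longrightarrow> x \<in> S \<Longrightarrow> y \<in> S \<Longrightarrow> isomorphic C x y \<Longrightarrow> y \<in> P"
      "\<And>x. x \<in> S \<Longrightarrow> Shift C x \<in> P \<longleftrightarrow> x \<in> P"
      "\<And>x y z f g h. x \<in> S \<Longrightarrow> y \<in> S \<Longrightarrow> z \<in> S \<Longrightarrow> dist_triangle C x y z f g h \<Longrightarrow> x \<in> P \<Longrightarrow> y \<in> P \<Longrightarrow> z \<in> P"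
      unfolding * by blast+
    have "triangulated_subcategory C P"
      unfolding triangulated_subcategory_def
    proof (intro conjI allI impI ballI; (elim conjE)?)
      show "P \<subseteq> Obj C" using P(1) D(1) by blast
      show "z \<in> P" if "is_zero_object C z" for z using P(2)[OF D(2)[OF that] that] .
      show "y \<in> P" if "x \<in> P" "isomorphic C x y" for x y using P(1,3) D(3) that by blast
      show "Shift C x \<in> P \<longleftrightarrow> x \<in> P" if "x \<in> Obj C" for x using P(1,4) D(4)[OF that] by blast
      show "z \<in> P" if "dist_triangle C x y z f g h" "x \<in> P" "y \<in> P" for x y z f g h
        using P(1) D(5)[OF that(1)] P(5)[OF _ _ _ that] that(2,3) by blast
    qed
    then show "P \<subseteq> S \<and> triangulated_subcategory C P" using P(1) by blast
  next
    assume "P \<subseteq> S \<and> triangulated_subcategory C P"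
    then have PS: "P \<subseteq> S" and P: "triangulated_subcategory C P" by auto
    note PD = triangulated_subcategoryD[OF P]
    show "triangulated_subcategory (full_subcategory C S) P"
      unfolding * using PS PD(2,3,5) PD(4) D(1) by blast
  qed
qed

lemma thick_full_subcategory:
  "thick_subcategory (full_subcategory C S) P \<longleftrightarrow> P \<subseteq> S \<and> thick_subcategory C P"
proof -
  have "x \<in> S \<and> y \<in> S" if "is_biproduct C x y s" "s \<in> S" for x y s
    using that thick_tensor_subcategoryD(1)[OF S] unfolding thick_subcategory_def by blast
  then show ?thesis
    unfolding thick_subcategory_def triangulated_full_subcategory is_biproduct_full_subcategory by blast
qed

lemma Spc_full_subcategory_topspace:
  "topspace (Spc (full_subcategory C S)) = prime_ideals (full_subcategory C S)"
proof -
  \<comment> \<open>A zero object lies in every prime, so the basic open set belonging to it is the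
    whole spectrum.\<close>
  obtain z where z: "is_zero_object C z" using zero_object_exists by blast
  have zS: "z \<in> S" using triangulated_subcategoryD(2)[OF thick_tensor_subcategoryD(2)[OF S] z] .
  have "z \<in> P" if "P \<in> prime_ideals (full_subcategory C S)" for P
  proof -
    have "thick_subcategory C P"
      using that unfolding prime_ideals_def thick_tensor_ideal_def thick_full_subcategory by blast
    then show ?thesis using triangulated_subcategoryD(2)[OF _ z] unfolding thick_subcategory_def by blast
  qed
  then have "prime_ideals (full_subcategory C S) - supp (full_subcategory C S) z =
      prime_ideals (full_subcategory C S)" unfolding supp_def by blast
  then show ?thesis
    unfolding Spc_def topology_generated_by_topspace using zS by (auto simp: full_subcategory_simps)
qed

text \<open>Properness becomes the absence of the unit, since an ideal containing the unit contains
  \<open>a \<boxtimes> \<one>\<close>, hence \<open>a\<close>, for every \<open>a\<close> in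
  \<open>S\<close>. In this form properness passes to restrictions and to directed unions.\<close>

lemma prime_ideals_full_subcategory:
  "P \<in> prime_ideals (full_subcategory C S) \<longleftrightarrow> P \<subseteq> S \<and> thick_subcategory C P \<and>
    (\<forall>a\<in>S. \<forall>b\<in>P. a \<boxtimes> b \<in> P) \<and> \<one>\<^sub>t \<notin> P \<and> (\<forall>a\<in>S. \<forall>b\<in>S. a \<boxtimes> b \<in> P \<longrightarrow> a \<in> P \<or> b \<in> P)"
proof -
  have "P = S" if "P \<subseteq> S" "thick_subcategory C P" "\<forall>a\<in>S. \<forall>b\<in>P. a \<boxtimes> b \<in> P" "\<one>\<^sub>t \<in> P"
  proof (rule equalityI[OF that(1)], rule subsetI)
    fix a assume a: "a \<in> S"
    then have aO: "a \<in> Obj C" using thick_tensor_subcategoryD(3)[OF S] by blast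
    have "a \<boxtimes> \<one>\<^sub>t \<in> P" using that a by blast
    moreover have "isomorphic C (a \<boxtimes> \<one>\<^sub>t) a" using isomorphicI[OF Runit_iso Runit_Hom] aO by blast
    ultimately show "a \<in> P" using that(2) unfolding thick_subcategory_def triangulated_subcategory_def by blast
  qed
  then show ?thesis
    using thick_tensor_subcategoryD(4)[OF S]
    unfolding prime_ideals_def thick_tensor_ideal_def thick_full_subcategory full_subcategory_Tens
      full_subcategory_simps by auto
qed

lemma openin_Spc_basic:
  "a \<in> S \<Longrightarrow> openin (Spc (full_subcategory C S)) {P \<in> prime_ideals (full_subcategory C S). a \<in> P}"
  unfolding Spc_def supp_def
  by (rule topology_generated_by_Basis) (auto simp: full_subcategory_simps)

lemma continuous_map_into_Spc:
  assumes "\<And>p. p \<in> topspace X \<Longrightarrow> f p \<in> prime_ideals (full_subcategory C S)"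
    and "\<And>a. a \<in> S \<Longrightarrow> openin X {p \<in> topspace X. a \<in> f p}"
  shows "continuous_map X (Spc (full_subcategory C S)) f"
  unfolding Spc_def
proof (rule continuous_on_generated_topo)
  fix U assume "U \<in> {prime_ideals (full_subcategory C S) - supp (full_subcategory C S) a |a.
    a \<in> Obj (full_subcategory C S)}"
  then obtain a where a: "a \<in> S" and U: "U = {P \<in> prime_ideals (full_subcategory C S). a \<in> P}"
    unfolding supp_def by auto
  have "f -` U \<inter> topspace X = {p \<in> topspace X. a \<in> f p}" unfolding U using assms(1) by auto
  then show "openin X (f -` U \<inter> topspace X)" using assms(2)[OF a] by simp
next
  show "f ` topspace X \<subseteq> \<Union> {prime_ideals (full_subcategory C S) - supp (full_subcategory C S) a |a.
    a \<in> Obj (full_subcategory C S)}"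
    unfolding Spc_full_subcategory_topspace[unfolded Spc_def topology_generated_by_topspace]
    using assms(1) by (rule image_subsetI)
qed

end

section \<open>Primes of a directed union of subcategories\<close>

lemma prime_ideals_restrict:
  assumes S: "thick_tensor_subcategory S" and R: "thick_tensor_subcategory R" and "R \<subseteq> S"
    and P: "P \<in> prime_ideals (full_subcategory C S)"
  shows "P \<inter> R \<in> prime_ideals (full_subcategory C R)"
proof -
  note P' = P[unfolded prime_ideals_full_subcategory[OF S]]
  note RD = thick_tensor_subcategoryD[OF R]
  have "triangulated_subcategory C (\<Inter>{P, R})"
    by (rule triangulated_subcategory_Inter) (use P' RD(2) in \<open>auto simp: thick_subcategory_def\<close>)
  moreover have "x \<in> P \<and> y \<in> P \<and> x \<in> R \<and> y \<in> R" if "is_biproduct C x y s" "s \<in> P" "s \<in> R" for x y s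
    using that P' RD(1) unfolding thick_subcategory_def by blast
  ultimately have "thick_subcategory C (P \<inter> R)" unfolding thick_subcategory_def by auto
  then show ?thesis
    unfolding prime_ideals_full_subcategory[OF R] using P' RD(5) \<open>R \<subseteq> S\<close> by blast
qed

text \<open>By compatibility, whether an object lies in the union can be decided at any stage
  \<open>H\<close> with the object in \<open>K H\<close>. Each defining condition of a prime
  involves finitely many objects and is therefore checked at a single stage.\<close>

lemma prime_ideals_directed_Union:
  assumes dir: "directed_by_inclusion \<H>"
    and K: "\<And>H. H \<in> \<H> \<Longrightarrow> thick_tensor_subcategory (K H)"
    and mono: "\<And>H H'. H \<in> \<H> \<Longrightarrow> H' \<in> \<H> \<Longrightarrow> H \<subseteq> H' \<Longrightarrow> K H \<subseteq> K H'"
    and S: "thick_tensor_subcategory S" and un: "S = (\<Union>H\<in>\<H>. K H)"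
    and p: "\<And>H. H \<in> \<H> \<Longrightarrow> p H \<in> prime_ideals (full_subcategory C (K H))"
    and compat: "\<And>H H'. H \<in> \<H> \<Longrightarrow> H' \<in> \<H> \<Longrightarrow> H \<subseteq> H' \<Longrightarrow> p H' \<inter> K H = p H"
  shows "(\<Union>H\<in>\<H>. p H) \<in> prime_ideals (full_subcategory C S)"
    and "H \<in> \<H> \<Longrightarrow> (\<Union>H\<in>\<H>. p H) \<inter> K H = p H"
proof -
  let ?U = "\<Union>H\<in>\<H>. p H"
  have pK: "p H \<subseteq> K H" and p_thick: "thick_subcategory C (p H)"
    and p_ideal: "\<And>a b. a \<in> K H \<Longrightarrow> b \<in> p H \<Longrightarrow> a \<boxtimes> b \<in> p H" and p_proper: "\<one>\<^sub>t \<notin> p H"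
    and p_prime: "\<And>a b. a \<in> K H \<Longrightarrow> b \<in> K H \<Longrightarrow> a \<boxtimes> b \<in> p H \<Longrightarrow> a \<in> p H \<or> b \<in> p H"
    if "H \<in> \<H>" for H
    using p[OF that, unfolded prime_ideals_full_subcategory[OF K[OF that]]] by simp_all
  have ub: "\<exists>H''\<in>\<H>. H \<subseteq> H'' \<and> H' \<subseteq> H''" if "H \<in> \<H>" "H' \<in> \<H>" for H H'
    using dir that unfolding directed_by_inclusion_def by blast
  show res: "?U \<inter> K H = p H" if H: "H \<in> \<H>" for H
  proof
    show "p H \<subseteq> ?U \<inter> K H" using pK[OF H] H by blast
    show "?U \<inter> K H \<subseteq> p H"
    proof
      fix a assume a: "a \<in> ?U \<inter> K H"
      then obtain H' where H': "H' \<in> \<H>" "a \<in> p H'" by blast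
      obtain H'' where H'': "H'' \<in> \<H>" "H \<subseteq> H''" "H' \<subseteq> H''" using ub[OF H H'(1)] by blast
      have "a \<in> p H''" using compat[OF H'(1) H''(1,3)] H'(2) by blast
      then show "a \<in> p H" using compat[OF H H''(1,2)] a by blast
    qed
  qed
  have mem: "a \<in> ?U \<longleftrightarrow> a \<in> p H" if "H \<in> \<H>" "a \<in> K H" for a H using res[OF that(1)] that by blast
  have ne: "\<exists>H. H \<in> \<H>" using dir unfolding directed_by_inclusion_def by auto
  have two: "\<exists>H\<in>\<H>. a \<in> K H \<and> b \<in> K H" if "a \<in> S" "b \<in> S" for a b
  proof -
    obtain H H' where H: "H \<in> \<H>" "a \<in> K H" "H' \<in> \<H>" "b \<in> K H'" using \<open>a \<in> S\<close> \<open>b \<in> S\<close> un by blast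
    obtain H'' where "H'' \<in> \<H>" "H \<subseteq> H''" "H' \<subseteq> H''" using ub[OF H(1,3)] by blast
    then show ?thesis using mono[OF H(1)] mono[OF H(3)] H(2,4) by blast
  qed
  have US: "?U \<subseteq> S" unfolding un using pK by blast
  note SD = triangulated_subcategoryD[OF thick_tensor_subcategoryD(2)[OF S]]
  have pT: "triangulated_subcategory C (p H)" if "H \<in> \<H>" for H
    using p_thick[OF that] unfolding thick_subcategory_def by blast
  have "triangulated_subcategory C ?U"
    by (rule triangulated_subcategory_directed_Union[OF dir pT]) (use compat in blast)+
  moreover have "x \<in> ?U \<and> y \<in> ?U" if bp: "is_biproduct C x y s" and s: "s \<in> ?U" for x y s
  proof -
    obtain H where H: "H \<in> \<H>" "s \<in> p H" using s by blast
    then have "x \<in> p H \<and> y \<in> p H" using p_thick[OF H(1)] bp unfolding thick_subcategory_def by blast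
    then show ?thesis using H(1) by blast
  qed
  ultimately have thick: "thick_subcategory C ?U" unfolding thick_subcategory_def by blast
  have ideal: "a \<boxtimes> b \<in> ?U" if a: "a \<in> S" and b: "b \<in> ?U" for a b
  proof -
    obtain H where H: "H \<in> \<H>" "a \<in> K H" "b \<in> K H" using two[OF a, of b] b US by blast
    then have "b \<in> p H" using mem b by blast
    then show ?thesis using p_ideal[OF H(1,2)] H(1) by blast
  qed
  have proper: "\<one>\<^sub>t \<notin> ?U" using p_proper by blast
  have prime: "a \<in> ?U \<or> b \<in> ?U" if a: "a \<in> S" and b: "b \<in> S" and ab: "a \<boxtimes> b \<in> ?U" for a b
  proof -
    obtain H where H: "H \<in> \<H>" "a \<in> K H" "b \<in> K H" using two[OF a b] by blast
    then have "a \<boxtimes> b \<in> p H" using mem[OF H(1)] thick_tensor_subcategoryD(5)[OF K[OF H(1)]] ab by blast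
    then show ?thesis using p_prime[OF H] H(1) by blast
  qed
  show "?U \<in> prime_ideals (full_subcategory C S)"
    unfolding prime_ideals_full_subcategory[OF S]
    by (intro conjI ballI impI) (fact US thick proper | erule ideal prime, assumption+)+
qed

text \<open>The inverse map sends a compatible family to its union. Both topologies are governed by
  conditions on single objects, and each object of \<open>S\<close> already lies in one
  \<open>K H\<close>.\<close>

theorem Spc_directed_Union_homeomorphic:
  assumes dir: "directed_by_inclusion \<H>"
    and K: "\<And>H. H \<in> \<H> \<Longrightarrow> thick_tensor_subcategory (K H)"
    and mono: "\<And>H H'. H \<in> \<H> \<Longrightarrow> H' \<in> \<H> \<Longrightarrow> H \<subseteq> H' \<Longrightarrow> K H \<subseteq> K H'"
    and S: "thick_tensor_subcategory S" and un: "S = (\<Union>H\<in>\<H>. K H)"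
  shows "homeomorphic_map (Spc (full_subcategory C S))
    (limit_topology \<H> (\<subseteq>) (\<lambda>H. Spc (full_subcategory C (K H)))
       (\<lambda>H H'. Spc_map (full_subcategory C (K H)) (\<lambda>a. a)))
    (\<lambda>P. \<lambda>H\<in>\<H>. Spc_map (full_subcategory C (K H)) (\<lambda>a. a) P)"
proof -
  let ?X = "Spc (full_subcategory C S)"
  let ?A = "\<lambda>H. Spc (full_subcategory C (K H))"
  let ?Y = "limit_topology \<H> (\<subseteq>) ?A (\<lambda>H H'. Spc_map (full_subcategory C (K H)) (\<lambda>a. a))"
  let ?F = "\<lambda>P. \<lambda>H\<in>\<H>. Spc_map (full_subcategory C (K H)) (\<lambda>a. a) P"
  let ?G = "\<lambda>p. \<Union>H\<in>\<H>. p H"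
  have F: "?F P = (\<lambda>H\<in>\<H>. P \<inter> K H)" for P
    unfolding Spc_map_def by (auto simp: restrict_def fun_eq_iff)
  have topX: "topspace ?X = prime_ideals (full_subcategory C S)"
    by (rule Spc_full_subcategory_topspace[OF S])
  have KS: "K H \<subseteq> S" if "H \<in> \<H>" for H using un that by blast
  have topY: "p \<in> topspace ?Y \<longleftrightarrow>
      p \<in> (\<Pi>\<^sub>E H\<in>\<H>. prime_ideals (full_subcategory C (K H))) \<and>
      (\<forall>H\<in>\<H>. \<forall>H'\<in>\<H>. H \<subseteq> H' \<longrightarrow> p H' \<inter> K H = p H)" for p
  proof -
    have "(\<Pi>\<^sub>E H\<in>\<H>. topspace (?A H)) = (\<Pi>\<^sub>E H\<in>\<H>. prime_ideals (full_subcategory C (K H)))"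
      by (rule PiE_cong) (rule Spc_full_subcategory_topspace[OF K])
    moreover have "Spc_map (full_subcategory C (K H)) (\<lambda>a. a) Q = Q \<inter> K H" for H Q
      unfolding Spc_map_def by auto
    ultimately show ?thesis unfolding limit_topology_def topspace_subtopology topspace_product_topology by auto
  qed
  have prime: "P \<inter> K H \<in> prime_ideals (full_subcategory C (K H))"
    if "P \<in> prime_ideals (full_subcategory C S)" "H \<in> \<H>" for P H
    using prime_ideals_restrict[OF S K[OF that(2)] KS[OF that(2)] that(1)] .
  have FY: "?F P \<in> topspace ?Y" if "P \<in> prime_ideals (full_subcategory C S)" for P
    unfolding topY F using prime[OF that] mono by auto
  have contF: "continuous_map ?X ?Y ?F"
  proof -
    have "continuous_map ?X (product_topology ?A \<H>) ?F"
      unfolding continuous_map_componentwise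
    proof (intro conjI ballI)
      show "?F ` topspace ?X \<subseteq> extensional \<H>" by auto
      fix H assume H: "H \<in> \<H>"
      show "continuous_map ?X (?A H) (\<lambda>P. ?F P H)"
      proof (rule continuous_map_into_Spc[OF K[OF H]])
        show "?F P H \<in> prime_ideals (full_subcategory C (K H))" if "P \<in> topspace ?X" for P
          unfolding F using prime H that topX by simp
        fix a assume a: "a \<in> K H"
        have "{P \<in> topspace ?X. a \<in> ?F P H} = {P \<in> prime_ideals (full_subcategory C S). a \<in> P}"
          unfolding F topX using H a by auto
        then show "openin ?X {P \<in> topspace ?X. a \<in> ?F P H}"
          using openin_Spc_basic[OF S, of a] KS[OF H] a by auto
      qed
    qed
    moreover have "?F ` topspace ?X \<subseteq> topspace ?Y" using FY topX by blast
    ultimately show ?thesis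
      unfolding limit_topology_def topspace_subtopology
      by (subst continuous_map_in_subtopology) auto
  qed
  have pY: "H \<in> \<H> \<Longrightarrow> p H \<in> prime_ideals (full_subcategory C (K H))"
    "H \<in> \<H> \<Longrightarrow> H' \<in> \<H> \<Longrightarrow> H \<subseteq> H' \<Longrightarrow> p H' \<inter> K H = p H"
    if "p \<in> topspace ?Y" for p H H'
    using that[unfolded topY] by (simp_all add: PiE_iff)
  have G: "?G p \<in> prime_ideals (full_subcategory C S)" "\<And>H. H \<in> \<H> \<Longrightarrow> ?G p \<inter> K H = p H"
    if p: "p \<in> topspace ?Y" for p
    by (rule prime_ideals_directed_Union[OF dir K mono S un pY[OF p]]; assumption)+
  have contG: "continuous_map ?Y ?X ?G"
  proof (rule continuous_map_into_Spc[OF S])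
    show "?G p \<in> prime_ideals (full_subcategory C S)" if "p \<in> topspace ?Y" for p using G(1)[OF that] .
    fix a assume "a \<in> S"
    then obtain H where H: "H \<in> \<H>" "a \<in> K H" using un by blast
    have "continuous_map ?Y (?A H) (\<lambda>p. p H)"
      unfolding limit_topology_def
      by (rule continuous_map_from_subtopology) (rule continuous_map_product_projection[OF H(1)])
    then have "openin ?Y {p \<in> topspace ?Y. p H \<in> {P \<in> prime_ideals (full_subcategory C (K H)). a \<in> P}}"
      by (rule openin_continuous_map_preimage) (rule openin_Spc_basic[OF K[OF H(1)] H(2)])
    \<comment> \<open>For \<open>a\<close> in \<open>K H\<close> the component at \<open>H\<close>
      alone decides whether \<open>a\<close> lies in the union, so the basic open set pulls back
      along one projection.\<close>
    moreover have "{p \<in> topspace ?Y. p H \<in> {P \<in> prime_ideals (full_subcategory C (K H)). a \<in> P}} =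
        {p \<in> topspace ?Y. a \<in> ?G p}"
      using G(2)[OF _ H(1)] H topY by (auto simp: PiE_iff)
    ultimately show "openin ?Y {p \<in> topspace ?Y. a \<in> ?G p}" by simp
  qed
  have "homeomorphic_maps ?X ?Y ?F ?G"
    unfolding homeomorphic_maps_def
  proof (intro conjI ballI)
    show "?G (?F P) = P" if "P \<in> topspace ?X" for P
    proof -
      have "P \<subseteq> S" using that[unfolded topX prime_ideals_full_subcategory[OF S]] by simp
      then show ?thesis unfolding F un by auto
    qed
    show "?F (?G p) = p" if p: "p \<in> topspace ?Y" for p
    proof (rule extensionalityI[of _ \<H>])
      show "p \<in> extensional \<H>" using p[unfolded topY] by (simp add: PiE_iff)
      show "?F (?G p) H = p H" if "H \<in> \<H>" for H unfolding F using G(2)[OF p that] that by simp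
    qed (simp add: F)
  qed (use contF contG in auto)
  then show ?thesis by (rule homeomorphic_maps_imp_map)
qed

end

section \<open>Compact parts of concentrations at subgroups of the Picard group\<close>

context rigidly_compactly_generated
begin

definition Pic_compacts :: "'o set set \<Rightarrow> 'o set" where
  "Pic_compacts H = {c. relatively_compact (Loc small C (\<Union>H)) c}"

lemma Pic_subset_compact:
  assumes H: "H \<subseteq> carrier (Pic C)" and a: "a \<in> \<Union>H"
  shows "a \<in> Obj C" "compact_object small C a"
proof -
  obtain A where A: "A \<in> H" "a \<in> A" using a by blast
  then obtain x where x: "invertible_object C x" "A = iso_class C x" using H unfolding Pic_def by auto
  obtain y where xy: "x \<in> Obj C" "y \<in> Obj C" "isomorphic C (x \<boxtimes> y) \<one>\<^sub>t"
    using x(1) unfolding invertible_object_def by blast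
  have xa: "a \<in> Obj C" "isomorphic C x a" using A(2) x(2) unfolding iso_class_def by auto
  have "isomorphic C (a \<boxtimes> y) (x \<boxtimes> y)"
    using isomorphic_Tens[OF isomorphic_sym[OF xa(2)] isomorphic_refl[OF xy(2)]] .
  then have "tens_inverse a y" unfolding tens_inverse_def using xa(1) xy isomorphic_trans by blast
  then show "a \<in> Obj C" "compact_object small C a" using xa invertible_imp_compact by auto
qed

lemma compact_part_Pic_concentration:
  assumes "H \<subseteq> carrier (Pic C)"
  shows "compact_part small (Pic_concentration small C H) = full_subcategory C (Pic_compacts H)"
proof -
  have "\<Union>H \<subseteq> Obj C" using Pic_subset_compact(1)[OF assms] by blast
  note L = Loc_localizing[OF this]
  have "{x. compact_object small (full_subcategory C (Loc small C (\<Union>H))) x} = Pic_compacts H"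
    unfolding compact_object_full_subcategory[OF L] Pic_compacts_def ..
  moreover have "Pic_compacts H \<subseteq> Loc small C (\<Union>H)"
    unfolding Pic_compacts_def relatively_compact_def by blast
  ultimately show ?thesis
    unfolding compact_part_def Pic_concentration_def concentration_def
    by (simp add: full_subcategory_full_subcategory)
qed

lemma Pic_compacts_iff:
  assumes "H \<subseteq> carrier (Pic C)"
  shows "c \<in> Pic_compacts H \<longleftrightarrow> (\<exists>t \<in> triangulated_hull (\<Union>H). summand c t)"
  unfolding Pic_compacts_def mem_Collect_eq
  by (rule relatively_compact_Loc_iff) (use Pic_subset_compact[OF assms] in blast)+

lemma Pic_compacts_thick_tensor:
  assumes H: "subgroup H (Pic C)"
  shows "thick_tensor_subcategory (Pic_compacts H)"
proof -
  note Hc = subgroup.subset[OF H]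
  have GO: "\<Union>H \<subseteq> Obj C" using Pic_subset_compact(1)[OF Hc] by blast
  note L = Loc_localizing[OF GO]
  note K = relatively_compact_triangulated[OF localizing_subcategoryD(1)[OF L], folded Pic_compacts_def]
  note iff = Pic_compacts_iff[OF Hc]
  note sup = triangulated_hull_superset[of "\<Union>H"]
  have self: "summand a a" if "a \<in> Obj C" for a
    using isomorphic_imp_summand[OF isomorphic_refl[OF that]] .
  \<comment> \<open>The generators are closed under tensor products on the nose: the product of two
    classes in \<open>Pic\<close> contains \<open>a \<boxtimes> b\<close> for all their members
    \<open>a\<close> and \<open>b\<close>.\<close>
  have G: "a \<boxtimes> b \<in> \<Union>H" if "a \<in> \<Union>H" "b \<in> \<Union>H" for a b
  proof -
    obtain A B where AB: "A \<in> H" "a \<in> A" "B \<in> H" "b \<in> B" using \<open>a \<in> \<Union>H\<close> \<open>b \<in> \<Union>H\<close> by blast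
    have "a \<in> Obj C" "b \<in> Obj C" using \<open>a \<in> \<Union>H\<close> \<open>b \<in> \<Union>H\<close> GO by blast+
    then have o: "a \<boxtimes> b \<in> Obj C" by simp
    have "A \<otimes>\<^bsub>Pic C\<^esub> B \<in> H" using subgroup.m_closed[OF H AB(1,3)] .
    moreover have "a \<boxtimes> b \<in> A \<otimes>\<^bsub>Pic C\<^esub> B"
      unfolding Pic_def using AB(2,4) o isomorphic_refl[OF o] by auto
    ultimately show ?thesis by blast
  qed
  have "thick_subcategory C (Pic_compacts H)"
    unfolding thick_subcategory_def using K biproduct_summand summand_trans iff by meson
  moreover have "\<one>\<^sub>t \<in> Pic_compacts H"
  proof -
    have "iso_class C \<one>\<^sub>t \<in> H" using subgroup.one_closed[OF H] unfolding Pic_def by simp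
    moreover have "\<one>\<^sub>t \<in> iso_class C \<one>\<^sub>t" unfolding iso_class_def using isomorphic_refl by simp
    ultimately show ?thesis using iff self[OF Unit_Obj] sup by blast
  qed
  moreover have "a \<boxtimes> b \<in> Pic_compacts H" if "a \<in> Pic_compacts H" "b \<in> Pic_compacts H" for a b
    using that summand_Tens triangulated_hull_Tens[OF GO G] unfolding iff by blast
  ultimately show ?thesis unfolding thick_tensor_subcategory_def by blast
qed

lemma Pic_compacts_mono:
  assumes "H' \<subseteq> carrier (Pic C)" "H \<subseteq> H'"
  shows "Pic_compacts H \<subseteq> Pic_compacts H'"
  using triangulated_hull_mono[of "\<Union>H" "\<Union>H'"] Pic_compacts_iff[of H] Pic_compacts_iff[of H'] assms by blast

text \<open>\<open>Loc\<close> need not commute with directed unions, as an infinite coproduct may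
  use generators from all members at once. Triangulated hulls do commute, and the compact objects
  depend only on the hull.\<close>

lemma Pic_compacts_directed_Union:
  assumes dir: "directed_by_inclusion \<H>" and H: "\<And>H. H \<in> \<H> \<Longrightarrow> H \<subseteq> carrier (Pic C)"
  shows "Pic_compacts (\<Union>\<H>) = (\<Union>H\<in>\<H>. Pic_compacts H)"
proof
  have GO: "\<Union>H \<subseteq> Obj C" if "H \<in> \<H>" for H using Pic_subset_compact(1)[OF H[OF that]] by blast
  have un: "\<Union>\<H> \<subseteq> carrier (Pic C)" using H by blast
  show "(\<Union>H\<in>\<H>. Pic_compacts H) \<subseteq> Pic_compacts (\<Union>\<H>)"
    by (rule UN_least, rule Pic_compacts_mono[OF un]) blast
  have tri: "triangulated_subcategory C (\<Union>H\<in>\<H>. triangulated_hull (\<Union>H))"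
    by (rule triangulated_subcategory_directed_Union[OF dir triangulated_hull_triangulated[OF GO]])
      (assumption, rule triangulated_hull_mono, blast)
  have "\<Union>(\<Union>\<H>) \<subseteq> (\<Union>H\<in>\<H>. triangulated_hull (\<Union>H))"
  proof
    fix a assume "a \<in> \<Union>(\<Union>\<H>)"
    then obtain H where "H \<in> \<H>" "a \<in> \<Union>H" by auto
    then show "a \<in> (\<Union>H\<in>\<H>. triangulated_hull (\<Union>H))"
      using subsetD[OF triangulated_hull_superset[of "\<Union>H"]] by (intro UN_I)
  qed
  then have hull: "triangulated_hull (\<Union>(\<Union>\<H>)) \<subseteq> (\<Union>H\<in>\<H>. triangulated_hull (\<Union>H))"
    by (rule triangulated_hull_subset[OF tri])
  show "Pic_compacts (\<Union>\<H>) \<subseteq> (\<Union>H\<in>\<H>. Pic_compacts H)"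
  proof
    fix c assume "c \<in> Pic_compacts (\<Union>\<H>)"
    then obtain t where t: "t \<in> triangulated_hull (\<Union>(\<Union>\<H>))" "summand c t"
      unfolding Pic_compacts_iff[OF un] by blast
    from subsetD[OF hull t(1)] obtain K where K: "K \<in> \<H>" "t \<in> triangulated_hull (\<Union>K)" by (rule UN_E)
    then have "c \<in> Pic_compacts K" unfolding Pic_compacts_iff[OF H[OF K(1)]] using t(2) by (intro bexI)
    then show "c \<in> (\<Union>H\<in>\<H>. Pic_compacts H)" using K(1) by (intro UN_I)
  qed
qed

end

theorem proposition14p5:
  fixes small :: "'i set \<Rightarrow> bool"
    and \<T> :: "('o, 'm) tt_category"
    and \<H> :: "'o set set set"
    and G :: "'o set set"
  assumes "rigidly_compactly_generated small \<T>"
    and "\<And>H. H \<in> \<H> \<Longrightarrow> subgroup H (Pic \<T>)"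
    and "directed_by_inclusion \<H>"
    and "G = \<Union>\<H>"
  shows "homeomorphic_map
    (Spc (compact_part small (Pic_concentration small \<T> G)))
    (limit_topology \<H> (\<subseteq>)
       (\<lambda>H. Spc (compact_part small (Pic_concentration small \<T> H)))
       (\<lambda>H H'. Spc_map (compact_part small (Pic_concentration small \<T> H)) (\<lambda>a. a)))
    (\<lambda>P. \<lambda>H\<in>\<H>. Spc_map (compact_part small (Pic_concentration small \<T> H)) (\<lambda>a. a) P)"
proof -
  interpret rigidly_compactly_generated small \<T> by fact
  note sub = assms(2)
  have G: "subgroup G (Pic \<T>)" unfolding assms(4) by (rule subgroup_directed_Union[OF assms(3) sub])
  have eq: "compact_part small (Pic_concentration small \<T> H) = full_subcategory \<T> (Pic_compacts H)"
    if "subgroup H (Pic \<T>)" for H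
    using compact_part_Pic_concentration[OF subgroup.subset[OF that]] .
  let ?K = "\<lambda>H. full_subcategory \<T> (Pic_compacts H)"
  have main: "homeomorphic_map (Spc (?K G))
    (limit_topology \<H> (\<subseteq>) (\<lambda>H. Spc (?K H)) (\<lambda>H H'. Spc_map (?K H) (\<lambda>a. a)))
    (\<lambda>P. \<lambda>H\<in>\<H>. Spc_map (?K H) (\<lambda>a. a) P)"
  proof (rule Spc_directed_Union_homeomorphic[OF assms(3)])
    show "Pic_compacts G = (\<Union>H\<in>\<H>. Pic_compacts H)"
      unfolding assms(4) by (rule Pic_compacts_directed_Union[OF assms(3) subgroup.subset[OF sub]])
    show "Pic_compacts H \<subseteq> Pic_compacts H'" if "H' \<in> \<H>" "H \<subseteq> H'" for H H'
      by (rule Pic_compacts_mono[OF subgroup.subset[OF sub[OF that(1)]] that(2)])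
  qed (use Pic_compacts_thick_tensor sub G in blast)+
  \<comment> \<open>The compact parts are identified only for subgroups, in particular for the
    members of \<open>\<H>\<close>, so rewriting goes through congruences restricted to this index
    set.\<close>
  have "limit_topology \<H> (\<subseteq>)
       (\<lambda>H. Spc (compact_part small (Pic_concentration small \<T> H)))
       (\<lambda>H H'. Spc_map (compact_part small (Pic_concentration small \<T> H)) (\<lambda>a. a)) =
    limit_topology \<H> (\<subseteq>) (\<lambda>H. Spc (?K H)) (\<lambda>H H'. Spc_map (?K H) (\<lambda>a. a))"
    unfolding limit_topology_def using eq[OF sub]
    by (intro arg_cong2[of _ _ _ _ subtopology] product_topology_cong) auto
  moreover have "(\<lambda>P. \<lambda>H\<in>\<H>. Spc_map (compact_part small (Pic_concentration small \<T> H)) (\<lambda>a. a) P) =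
      (\<lambda>P. \<lambda>H\<in>\<H>. Spc_map (?K H) (\<lambda>a. a) P)"
    using eq[OF sub] by (intro ext restrict_ext) simp
  ultimately show ?thesis unfolding eq[OF G] using main by simp
qed

end
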